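(* For every integer $\ell\geq 4$, the problem \textsc{$(\ell-1)$-Colored $P_\ell$ Deletion} is NP-hard, even when restricted to input graphs of maximum degree $16$.
   Context: A $c$-colored (edge-colored) graph is a simple graph $G=(V,E)$ whose edge set is partitioned into $c$ pairwise disjoint non-empty sets $E=E_1\sqcup\dots\sqcup E_c$; an edge in $E_i$ has color $i$. A path is $c$-colored if its edge set contains edges of exactly $c$ distinct colors. $P_\ell$ denotes a path on $\ell$ vertices. \textsc{$c$-Colored $P_\ell$ Deletion}: given a $c$-colored graph $G$ and an integer $k$, decide whether there is a set $S$ of at most $k$ edges such that $G-S$ contains no $c$-colored $P_\ell$ as an induced subgraph. Here $c=\ell-1$. *)

theory Defs
  imports Complex_Main "HOL-Computational_Algebra.Polynomial"
begin

section \<open>Multi-tape Turing machines, polynomial time and NP\<close>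

text \<open>
  States are the numbers below \<open>states\<close>, with start state 0 and accepting state 1; tape symbols are
  the numbers below \<open>symbols\<close>, where 0 is the blank and 1, 2 stand for the bits False, True.
  Tapes are two-way infinite. A machine halts when no transition applies.
\<close>

datatype move = Left | Stay | Right

record tm =
  tapes :: nat
  states :: nat
  symbols :: nat
  delta :: "nat \<Rightarrow> nat list \<Rightarrow> (nat \<times> (nat \<times> move) list) set"

definition reads :: "tm \<Rightarrow> nat list set" where
  "reads M = {ss. length ss = tapes M \<and> (\<forall>s\<in>set ss. s < symbols M)}"

definition turing_machine :: "tm \<Rightarrow> bool" where
  "turing_machine M \<longleftrightarrow> tapes M \<ge> 1 \<and> states M \<ge> 2 \<and> symbols M \<ge> 3 \<and>
     (\<forall>q<states M. \<forall>ss\<in>reads M. \<forall>(q', as)\<in>delta M q ss.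
        q' < states M \<and> length as = tapes M \<and> (\<forall>(s, m)\<in>set as. s < symbols M))"

definition deterministic :: "tm \<Rightarrow> bool" where
  "deterministic M \<longleftrightarrow>
     (\<forall>q<states M. \<forall>ss\<in>reads M. \<forall>a\<in>delta M q ss. \<forall>b\<in>delta M q ss. a = b)"

type_synonym tape = "(int \<Rightarrow> nat) \<times> int"
type_synonym config = "nat \<times> tape list"

fun offset :: "move \<Rightarrow> int" where
  "offset Left = - 1"
| "offset Stay = 0"
| "offset Right = 1"

definition read :: "tape \<Rightarrow> nat" where
  "read t = (fst t) (snd t)"

definition act :: "tape \<Rightarrow> nat \<times> move \<Rightarrow> tape" where
  "act t a = ((fst t)(snd t := fst a), snd t + offset (snd a))"

definition step :: "tm \<Rightarrow> config \<Rightarrow> config \<Rightarrow> bool" where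
  "step M C C' \<longleftrightarrow>
     (\<exists>(q', as)\<in>delta M (fst C) (map read (snd C)). C' = (q', map2 act (snd C) as))"

definition halted :: "tm \<Rightarrow> config \<Rightarrow> bool" where
  "halted M C \<longleftrightarrow> (\<nexists>C'. step M C C')"

definition contents :: "bool list \<Rightarrow> int \<Rightarrow> nat" where
  "contents w i =
     (if 0 \<le> i \<and> i < int (length w) then (if w ! nat i then 2 else 1) else 0)"

definition initial :: "tm \<Rightarrow> bool list \<Rightarrow> config" where
  "initial M x = (0, (contents x, 0) # replicate (tapes M - 1) (contents [], 0))"

text \<open>The output of a computation is the content of the last tape.\<close>

definition polytime :: "(bool list \<Rightarrow> bool list) \<Rightarrow> bool" where
  "polytime f \<longleftrightarrow> (\<exists>M p. turing_machine M \<and> deterministic M \<and>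
     (\<forall>x. \<exists>t C. t \<le> poly p (length x) \<and> (step M ^^ t) (initial M x) C \<and>
        halted M C \<and> fst (last (snd C)) = contents (f x)))"

definition NP :: "bool list set set" where
  "NP = {L. \<exists>M p. turing_machine M \<and>
     (\<forall>x t C. (step M ^^ t) (initial M x) C \<longrightarrow> t \<le> poly p (length x)) \<and>
     (\<forall>x. x \<in> L \<longleftrightarrow>
        (\<exists>t C. (step M ^^ t) (initial M x) C \<and> halted M C \<and> fst C = 1))}"

text \<open>
  NP-hardness, under polynomial-time many-one reductions, of the decision problem with yes-instances
  \<open>Y\<close> restricted to the instances in \<open>D\<close>; instances are presented to machines by means of \<open>enc\<close>.
\<close>

definition NP_hard :: "('i \<Rightarrow> bool list) \<Rightarrow> 'i set \<Rightarrow> 'i set \<Rightarrow> bool" where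
  "NP_hard enc D Y \<longleftrightarrow>
     (\<forall>L\<in>NP. \<exists>g. polytime (\<lambda>x. enc (g x)) \<and> (\<forall>x. g x \<in> D \<and> (x \<in> L \<longleftrightarrow> g x \<in> Y)))"


section \<open>Edge-colored graphs\<close>

text \<open>The list \<open>classes G\<close> consists of the color classes; its \<open>i\<close>-th entry is the set of edges of color \<open>i\<close>.\<close>

record 'a ecgraph =
  verts :: "'a set"
  classes :: "'a set set list"

definition edges :: "'a ecgraph \<Rightarrow> 'a set set" where
  "edges G = \<Union> (set (classes G))"

definition colored_graph :: "nat \<Rightarrow> 'a ecgraph \<Rightarrow> bool" where
  "colored_graph c G \<longleftrightarrow> finite (verts G) \<and>
     (\<forall>e\<in>edges G. e \<subseteq> verts G \<and> card e = 2) \<and>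
     length (classes G) = c \<and>
     (\<forall>i<c. classes G ! i \<noteq> {}) \<and>
     (\<forall>i<c. \<forall>j<c. i \<noteq> j \<longrightarrow> classes G ! i \<inter> classes G ! j = {})"

definition degree :: "'a ecgraph \<Rightarrow> 'a \<Rightarrow> nat" where
  "degree G v = card {e \<in> edges G. v \<in> e}"

definition max_degree :: "'a ecgraph \<Rightarrow> nat" where
  "max_degree G = Max (degree G ` verts G)"

definition delete_edges :: "'a ecgraph \<Rightarrow> 'a set set \<Rightarrow> 'a ecgraph" where
  "delete_edges G S = G\<lparr>classes := map (\<lambda>E. E - S) (classes G)\<rparr>"

definition induced_path :: "'a ecgraph \<Rightarrow> nat \<Rightarrow> 'a list \<Rightarrow> bool" where
  "induced_path G l vs \<longleftrightarrow> length vs = l \<and> distinct vs \<and> set vs \<subseteq> verts G \<and>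
     (\<forall>i j. i < j \<and> j < l \<longrightarrow> ({vs ! i, vs ! j} \<in> edges G \<longleftrightarrow> j = Suc i))"

definition path_edges :: "'a list \<Rightarrow> 'a set set" where
  "path_edges vs = {{vs ! i, vs ! Suc i} | i. Suc i < length vs}"

definition colors_of :: "'a ecgraph \<Rightarrow> 'a set set \<Rightarrow> nat set" where
  "colors_of G F = {i. i < length (classes G) \<and> classes G ! i \<inter> F \<noteq> {}}"

definition has_colored_induced_path :: "nat \<Rightarrow> nat \<Rightarrow> 'a ecgraph \<Rightarrow> bool" where
  "has_colored_induced_path c l G \<longleftrightarrow>
     (\<exists>vs. induced_path G l vs \<and> card (colors_of G (path_edges vs)) = c)"

definition deletable :: "nat \<Rightarrow> nat \<Rightarrow> 'a ecgraph \<Rightarrow> nat \<Rightarrow> bool" where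
  "deletable c l G k \<longleftrightarrow>
     (\<exists>S\<subseteq>edges G. card S \<le> k \<and> \<not> has_colored_induced_path c l (delete_edges G S))"


section \<open>Problem instances and their encoding as bit strings\<close>

text \<open>
  An instance consists of a list of the vertices, a list of the edges of each color, and the
  number \<open>k\<close>. Order, repetition and orientation in these lists are immaterial.
\<close>

type_synonym inst = "nat list \<times> (nat \<times> nat) list list \<times> nat"

definition inst_graph :: "inst \<Rightarrow> nat ecgraph" where
  "inst_graph = (\<lambda>(vs, ess, k).
     \<lparr>verts = set vs, classes = map (\<lambda>es. (\<lambda>(u, v). {u, v}) ` set es) ess\<rparr>)"

definition inst_bound :: "inst \<Rightarrow> nat" where
  "inst_bound = (\<lambda>(vs, ess, k). k)"

definition path_deletion_instances :: "nat \<Rightarrow> inst set" where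
  "path_deletion_instances c = {I. colored_graph c (inst_graph I)}"

definition colored_path_deletion :: "nat \<Rightarrow> nat \<Rightarrow> inst set" where
  "colored_path_deletion c l =
     {I \<in> path_deletion_instances c. deletable c l (inst_graph I) (inst_bound I)}"

text \<open>Binary representation, least significant bit first.\<close>

fun binary :: "nat \<Rightarrow> bool list" where
  "binary n = (if n = 0 then [] else odd n # binary (n div 2))"

declare binary.simps [simp del]

fun enc_list :: "('b \<Rightarrow> bool list) \<Rightarrow> 'b list \<Rightarrow> bool list" where
  "enc_list e [] = [False]"
| "enc_list e (x # xs) = True # e x @ enc_list e xs"

definition enc_nat :: "nat \<Rightarrow> bool list" where
  "enc_nat n = enc_list (\<lambda>b. [b]) (binary n)"

definition enc_edge :: "nat \<times> nat \<Rightarrow> bool list" where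
  "enc_edge = (\<lambda>(u, v). enc_nat u @ enc_nat v)"

definition enc_inst :: "inst \<Rightarrow> bool list" where
  "enc_inst = (\<lambda>(vs, ess, k).
     enc_list enc_nat vs @ enc_list (enc_list enc_edge) ess @ enc_nat k)"

definition prefix_free :: "('b \<Rightarrow> bool list) \<Rightarrow> bool" where
  "prefix_free e \<longleftrightarrow> (\<forall>x y r s. e x @ r = e y @ s \<longrightarrow> x = y \<and> r = s)"

lemma prefix_freeD: "prefix_free e \<Longrightarrow> e x @ r = e y @ s \<Longrightarrow> x = y \<and> r = s"
  unfolding prefix_free_def by blast

lemma prefix_free_enc_list:
  assumes "prefix_free e"
  shows "prefix_free (enc_list e)"
proof -
  have "xs = ys \<and> r = s" if "enc_list e xs @ r = enc_list e ys @ s" for xs ys r s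
    using that
  proof (induction xs arbitrary: ys)
    case Nil
    then show ?case by (cases ys) auto
  next
    case (Cons x xs)
    then obtain y ys' where ys: "ys = y # ys'"
      by (cases ys) auto
    with Cons.prems have "e x @ (enc_list e xs @ r) = e y @ (enc_list e ys' @ s)"
      by simp
    from prefix_freeD [OF assms this] Cons.IH [of ys'] ys show ?case by simp
  qed
  then show ?thesis unfolding prefix_free_def by blast
qed

lemma binary_inject: "binary m = binary n \<Longrightarrow> m = n"
proof (induction m arbitrary: n rule: less_induct)
  case (less m)
  show ?case
  proof (cases "m = 0 \<or> n = 0")
    case True
    with less.prems show ?thesis
      by (auto simp: binary.simps [of m] binary.simps [of n] split: if_splits)
  next
    case False
    with less.prems have *: "odd m = odd n" "binary (m div 2) = binary (n div 2)"
      by (simp_all add: binary.simps [of m] binary.simps [of n])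
    with False less.IH [of "m div 2" "n div 2"] have "m div 2 = n div 2" by simp
    with *(1) show ?thesis by presburger
  qed
qed

lemma prefix_free_enc_nat: "prefix_free enc_nat"
proof -
  have "prefix_free (\<lambda>b::bool. [b])" by (simp add: prefix_free_def)
  then have "prefix_free (enc_list (\<lambda>b::bool. [b]))" by (rule prefix_free_enc_list)
  then show ?thesis
    unfolding prefix_free_def enc_nat_def using binary_inject by metis
qed

lemma prefix_free_enc_edge: "prefix_free enc_edge"
  unfolding prefix_free_def enc_edge_def
  by (auto dest!: prefix_freeD [OF prefix_free_enc_nat])

lemma inj_enc_inst: "inj enc_inst"
proof (rule injI)
  fix I J assume "enc_inst I = enc_inst J"
  then show "I = J"
    using prefix_freeD [OF prefix_free_enc_nat, where r = "[]" and s = "[]"]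
    by (cases I; cases J)
      (auto simp: enc_inst_def
        dest!: prefix_freeD [OF prefix_free_enc_list [OF prefix_free_enc_nat]]
          prefix_freeD [OF prefix_free_enc_list [OF prefix_free_enc_list [OF prefix_free_enc_edge]]])
qed

end

theory Submission
  imports Defs "HOL-Library.Nat_Bijection"
begin

text \<open>
  Write the tableau of a nondeterministic machine in coordinates relative to the heads: the cell in row
  \<open>t\<close> and column \<open>c\<close> holds the symbols at offset \<open>c - N\<close> from all heads at time \<open>t\<close> together with the
  transition applied at time \<open>t\<close>. Then all tapes fit into one row and acceptance is a binary constraint
  problem between neighbouring cells over a constant domain. A pair of a cell and a value becomes a
  vertex, conflicting pairs become edges, and a solution is a small vertex cover. To bound the degree
  each such vertex is replaced by a path with an odd number of vertices on whose even positions the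
  conflict edges end: a cover is cheapest on a path if it uses only odd positions, which means that
  the value is selected.

  These paths are colored with three colors such that every edge has an end all of whose neighbours
  have the same color. A vertex \<open>u\<close> of the cover problem becomes a vertex with a pendant edge of the
  color of \<open>u\<close>, extended by a tail in the remaining \<open>l - 4\<close> colors, and an edge \<open>uv\<close> becomes an edge of
  the third color. The rainbow paths on \<open>l\<close> vertices then run from the end of the tail of \<open>u\<close> through
  \<open>v\<close> to the end of its pendant edge; for \<open>l = 4\<close> the coloring excludes rainbow paths of three
  connecting edges. Deleting the pendant edges of a cover is an optimal way to destroy all of them.
  All degrees are at most 4, and a disjoint star in a single color raises the maximum degree.

  Vertex names are bit strings with unary coordinates, so that a machine with stacks as tapes prints
  the instance by nested loops over unary counters.
\<close>


section \<open>Rainbow paths\<close>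

lemma verts_delete_edges [simp]: "verts (delete_edges G S) = verts G"
  by (simp add: delete_edges_def)

lemma edges_delete_edges [simp]: "edges (delete_edges G S) = edges G - S"
  by (auto simp: delete_edges_def edges_def)

lemma length_classes_delete_edges [simp]:
  "length (classes (delete_edges G S)) = length (classes G)"
  by (simp add: delete_edges_def)

lemma nth_classes_delete_edges [simp]:
  "i < length (classes G) \<Longrightarrow> classes (delete_edges G S) ! i = classes G ! i - S"
  by (simp add: delete_edges_def)

lemma degree_eq_card_neighbours:
  assumes "\<And>e. e \<in> edges G \<Longrightarrow> card e = 2"
  shows "degree G x = card {y. {x, y} \<in> edges G}"
proof -
  have "{e \<in> edges G. x \<in> e} = (\<lambda>y. {x, y}) ` {y. {x, y} \<in> edges G}"
    using assms by (fastforce simp: card_2_iff insert_commute)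
  moreover have "inj_on (\<lambda>y. {x, y}) {y. {x, y} \<in> edges G}"
    by (auto simp: inj_on_def doubleton_eq_iff)
  ultimately show ?thesis by (simp add: degree_def card_image)
qed

definition rainbow_path :: "'a ecgraph \<Rightarrow> 'a list \<Rightarrow> nat list \<Rightarrow> bool" where
  "rainbow_path G vs cs \<longleftrightarrow> length vs = Suc (length cs) \<and> distinct vs \<and> distinct cs \<and>
     (\<forall>i<length cs. cs ! i < length (classes G) \<and> {vs ! i, vs ! Suc i} \<in> classes G ! (cs ! i))"

lemma obtain_rainbow_path:
  assumes path: "has_colored_induced_path c (Suc c) G"
    and disjoint: "\<And>i j. i < length (classes G) \<Longrightarrow> j < length (classes G) \<Longrightarrow> i \<noteq> j \<Longrightarrow>
      classes G ! i \<inter> classes G ! j = {}"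
  obtains vs cs where "length cs = c" "rainbow_path G vs cs"
proof -
  from path obtain vs where vs: "induced_path G (Suc c) vs"
    and card_colors: "card (colors_of G (path_edges vs)) = c"
    unfolding has_colored_induced_path_def by blast
  have length_vs: "length vs = Suc c" using vs by (simp add: induced_path_def)
  have "\<exists>k<length (classes G). {vs ! i, vs ! Suc i} \<in> classes G ! k" if "i < c" for i
  proof -
    have "{vs ! i, vs ! Suc i} \<in> edges G" using vs that by (auto simp: induced_path_def)
    then show ?thesis by (auto simp: edges_def in_set_conv_nth)
  qed
  then obtain col where col: "\<And>i. i < c \<Longrightarrow>
      col i < length (classes G) \<and> {vs ! i, vs ! Suc i} \<in> classes G ! col i"
    by metis
  have "colors_of G (path_edges vs) \<subseteq> col ` {..<c}"
  proof
    fix k assume "k \<in> colors_of G (path_edges vs)"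
    then obtain i where i: "i < c" "k < length (classes G)" "{vs ! i, vs ! Suc i} \<in> classes G ! k"
      by (auto simp: colors_of_def path_edges_def length_vs)
    with col[OF i(1)] disjoint[of k "col i"] have "k = col i" by blast
    with i(1) show "k \<in> col ` {..<c}" by blast
  qed
  then have "c \<le> card (col ` {..<c})"
    unfolding card_colors[symmetric] by (intro card_mono) auto
  then have "inj_on col {..<c}"
    using card_image_le[of "{..<c}" col] by (intro eq_card_imp_inj_on) auto
  then have "rainbow_path G vs (map col [0..<c])"
    using vs col length_vs
    by (auto simp: rainbow_path_def induced_path_def distinct_map atLeast0LessThan)
  then show thesis using that[of "map col [0..<c]" vs] by simp
qed

lemma rainbow_path_rev:
  assumes "rainbow_path G vs cs"
  shows "rainbow_path G (rev vs) (rev cs)"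
proof -
  have "rev cs ! i < length (classes G) \<and> {rev vs ! i, rev vs ! Suc i} \<in> classes G ! (rev cs ! i)"
    if "i < length cs" for i
  proof -
    define j where "j = length cs - Suc i"
    have j: "j < length cs" "length cs - i = Suc j" using that by (auto simp: j_def)
    then have "rev cs ! i = cs ! j" "rev vs ! i = vs ! Suc j" "rev vs ! Suc i = vs ! j"
      using assms that by (auto simp: rainbow_path_def rev_nth j_def)
    then show ?thesis using assms j(1) by (simp add: rainbow_path_def insert_commute)
  qed
  then show ?thesis using assms by (auto simp: rainbow_path_def)
qed


section \<open>Vertex cover as rainbow path deletion\<close>

definition ends :: "'a \<times> 'a \<Rightarrow> 'a set" where
  "ends = (\<lambda>(u, v). {u, v})"

definition vertex_cover :: "('u \<times> 'u) set \<Rightarrow> 'u set \<Rightarrow> bool" where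
  "vertex_cover E C \<longleftrightarrow> (\<forall>(u, v)\<in>E. u \<in> C \<or> v \<in> C)"

text \<open>
  \<open>tail u 0\<close> represents \<open>u\<close>, \<open>tail u 1\<close> is the end of its pendant edge, and \<open>star 0\<close> is the center of
  the star.
\<close>

locale cover_graph =
  fixes U :: "'u set" and E :: "('u \<times> 'u) set" and \<chi> :: "'u \<Rightarrow> nat"
    and tail :: "'u \<Rightarrow> nat \<Rightarrow> 'a" and star :: "nat \<Rightarrow> 'a" and l \<Delta> :: nat
  assumes l: "l \<ge> 4" and \<Delta>: "\<Delta> \<ge> 2"
    and finite_U: "finite U"
    and E_subset: "E \<subseteq> U \<times> U"
    and color_less: "u \<in> U \<Longrightarrow> \<chi> u < 3"
    and color_proper: "(u, v) \<in> E \<Longrightarrow> \<chi> u \<noteq> \<chi> v"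
    and color_surj: "i < 3 \<Longrightarrow> i \<in> \<chi> ` U"
    and monochromatic_end: "(u, v) \<in> E \<union> E\<inverse> \<Longrightarrow>
      (\<forall>w. (u, w) \<in> E \<union> E\<inverse> \<longrightarrow> \<chi> w = \<chi> v) \<or> (\<forall>w. (v, w) \<in> E \<union> E\<inverse> \<longrightarrow> \<chi> w = \<chi> u)"
    and card_neighbours_less: "card {v. (u, v) \<in> E \<union> E\<inverse>} < \<Delta>"
    and tail_eq_iff: "tail u r = tail v s \<longleftrightarrow> u = v \<and> r = s"
    and star_eq_iff: "star i = star j \<longleftrightarrow> i = j"
    and star_neq_tail: "u \<in> U \<Longrightarrow> star i \<noteq> tail u r"
begin

definition adj :: "'u \<Rightarrow> 'u \<Rightarrow> bool" where
  "adj u v \<longleftrightarrow> (u, v) \<in> E \<union> E\<inverse>"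

definition third :: "'u \<Rightarrow> 'u \<Rightarrow> nat" where
  "third u v = 3 - (\<chi> u + \<chi> v)"

definition tail_color :: "'u \<Rightarrow> nat \<Rightarrow> nat" where
  "tail_color u r = (if r = 0 then \<chi> u else r + 2)"

definition class_pairs :: "nat \<Rightarrow> ('a \<times> 'a) set" where
  "class_pairs i = {(tail u r, tail u (Suc r)) | u r. u \<in> U \<and> r < l - 3 \<and> tail_color u r = i} \<union>
     {(tail u 0, tail v 0) | u v. (u, v) \<in> E \<and> third u v = i} \<union>
     {(star 0, star (Suc j)) | j. i = 0 \<and> j < \<Delta>}"

definition color_class :: "nat \<Rightarrow> 'a set set" where
  "color_class i = ends ` class_pairs i"

definition graph :: "'a ecgraph" where
  "graph = \<lparr>verts = {tail u r | u r. u \<in> U \<and> r < l - 2} \<union> star ` {..\<Delta>},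
     classes = map color_class [0..<l - 1]\<rparr>"

lemma adj_sym: "adj u v \<Longrightarrow> adj v u"
  by (auto simp: adj_def)

lemma adj_in_U: "adj u v \<Longrightarrow> u \<in> U \<and> v \<in> U"
  using E_subset by (auto simp: adj_def)

lemma adj_color_neq: "adj u v \<Longrightarrow> \<chi> u \<noteq> \<chi> v"
  using color_proper by (fastforce simp: adj_def)

lemma finite_neighbours: "finite {v. adj u v}"
  by (rule finite_subset[OF _ finite_U]) (auto dest: adj_in_U)

lemma third_commute: "third u v = third v u"
  by (simp add: third_def add.commute)

lemma colors_adj: "adj u v \<Longrightarrow> {\<chi> u, \<chi> v, third u v} = {..<3}"
  using color_less[of u] color_less[of v] adj_color_neq[of u v] adj_in_U[of u v]
  by (auto simp: third_def)

lemma third_less: "adj u v \<Longrightarrow> third u v < 3"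
  using colors_adj by blast

lemma tail_neq_star: "u \<in> U \<Longrightarrow> tail u r \<noteq> star i"
  using star_neq_tail by metis

lemmas point_eq_simps = tail_eq_iff star_eq_iff star_neq_tail tail_neq_star

lemma color_class_eq:
  "color_class i = {{tail u r, tail u (Suc r)} | u r. u \<in> U \<and> r < l - 3 \<and> tail_color u r = i} \<union>
     {{tail u 0, tail v 0} | u v. adj u v \<and> third u v = i} \<union>
     {{star 0, star (Suc j)} | j. i = 0 \<and> j < \<Delta>}"
proof -
  have "ends ` {(tail u 0, tail v 0) | u v. (u, v) \<in> E \<and> third u v = i} =
      {{tail u 0, tail v 0} | u v. adj u v \<and> third u v = i}"
    unfolding ends_def adj_def
    by (auto simp: image_Collect insert_commute third_commute)
      (use third_commute insert_commute in metis)+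
  then show ?thesis
    unfolding color_class_def class_pairs_def image_Un by (auto simp: ends_def image_Collect)
qed

lemma tail_edge_iff:
  assumes "u \<in> U"
  shows "{tail u r, y} \<in> color_class i \<longleftrightarrow>
    (r < l - 3 \<and> i = tail_color u r \<and> y = tail u (Suc r)) \<or>
    (\<exists>s<l - 3. r = Suc s \<and> i = tail_color u s \<and> y = tail u s) \<or>
    (\<exists>v. r = 0 \<and> adj u v \<and> i = third u v \<and> y = tail v 0)"
  using assms unfolding color_class_eq
  by (auto simp: doubleton_eq_iff point_eq_simps dest: adj_in_U)
    (metis adj_sym third_commute)+

lemma star_edge_iff:
  "{star j, y} \<in> color_class i \<longleftrightarrow>
     i = 0 \<and> (j = 0 \<and> (\<exists>k<\<Delta>. y = star (Suc k)) \<or> (\<exists>k<\<Delta>. j = Suc k \<and> y = star 0))"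
  unfolding color_class_eq
  by (auto simp: doubleton_eq_iff point_eq_simps dest: adj_in_U)

lemma color_class_cases:
  assumes "e \<in> color_class i"
  obtains (tail) u r y where "u \<in> U" "e = {tail u r, y}"
  | (star) j y where "e = {star j, y}"
  using assms unfolding color_class_eq by (auto dest: adj_in_U)

lemma color_class_unique:
  assumes "e \<in> color_class i" "e \<in> color_class j"
  shows "i = j"
  using assms(1)
proof (cases rule: color_class_cases)
  case (tail u r y)
  with assms show ?thesis by (auto simp: tail_edge_iff point_eq_simps)
next
  case (star k y)
  with assms show ?thesis by (auto simp: star_edge_iff)
qed

lemma color_class_less:
  assumes "e \<in> color_class i"
  shows "i < l - 1"
  using assms
proof (cases rule: color_class_cases)
  case (tail u r y)
  show ?thesis
    using assms tail l color_less[of u] third_less[of u]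
    by (fastforce simp: tail_edge_iff tail_color_def)
next
  case (star k y)
  then show ?thesis using assms l by (simp add: star_edge_iff)
qed

lemma length_classes_graph: "length (classes graph) = l - 1"
  by (simp add: graph_def)

lemma nth_classes_graph: "i < l - 1 \<Longrightarrow> classes graph ! i = color_class i"
  by (simp add: graph_def)

lemma edges_graph: "edges graph = (\<Union>i. color_class i)"
  using color_class_less by (fastforce simp: edges_def graph_def)

lemma finite_verts: "finite (verts graph)"
proof -
  have "{tail u r | u r. u \<in> U \<and> r < l - 2} = (\<lambda>(u, r). tail u r) ` (U \<times> {..<l - 2})" by auto
  then show ?thesis by (simp add: graph_def finite_U)
qed

lemma tail_in_verts: "u \<in> U \<Longrightarrow> r < l - 2 \<Longrightarrow> tail u r \<in> verts graph"
  by (auto simp: graph_def)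

lemma star_in_verts: "j \<le> \<Delta> \<Longrightarrow> star j \<in> verts graph"
  by (auto simp: graph_def)

lemma color_class_subset: "e \<in> color_class i \<Longrightarrow> e \<subseteq> verts graph"
  using l by (auto simp: color_class_eq dest: adj_in_U intro!: tail_in_verts star_in_verts)

lemma card_edge: "e \<in> color_class i \<Longrightarrow> card e = 2"
  by (auto simp: color_class_eq point_eq_simps card_2_iff' dest: adj_color_neq)

lemma color_class_nonempty:
  assumes "i < l - 1"
  shows "color_class i \<noteq> {}"
proof (cases "i < 3")
  case True
  then obtain u where "u \<in> U" "\<chi> u = i" using color_surj by blast
  then have "{tail u 0, tail u 1} \<in> color_class i"
    using l by (simp add: tail_edge_iff tail_color_def)
  then show ?thesis by blast
next
  case False
  obtain u where "u \<in> U" using color_surj[of 0] by auto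
  moreover obtain r where "i = r + 2" "r \<noteq> 0" using that[of "i - 2"] False by simp
  moreover from this assms have "r < l - 3" by linarith
  ultimately have "{tail u r, tail u (Suc r)} \<in> color_class i"
    by (simp add: tail_edge_iff tail_color_def)
  then show ?thesis by blast
qed

theorem colored_graph: "colored_graph (l - 1) graph"
  unfolding colored_graph_def
proof (intro conjI allI impI ballI)
  show "e \<subseteq> verts graph" "card e = 2" if "e \<in> edges graph" for e
    using that color_class_subset card_edge by (auto simp: edges_graph)
  show "classes graph ! i \<noteq> {}" if "i < l - 1" for i
    using color_class_nonempty that by (simp add: nth_classes_graph)
  show "classes graph ! i \<inter> classes graph ! j = {}" if "i < l - 1" "j < l - 1" "i \<noteq> j" for i j
    using that color_class_unique by (auto simp: nth_classes_graph)
qed (simp_all add: finite_verts length_classes_graph)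

lemma finite_edges: "finite (edges graph)"
proof (rule finite_subset)
  show "edges graph \<subseteq> Pow (verts graph)" using colored_graph by (auto simp: colored_graph_def)
qed (simp add: finite_verts)


subsection \<open>Degrees\<close>

lemma degree_graph: "degree graph x = card {y. \<exists>i. {x, y} \<in> color_class i}"
  by (subst degree_eq_card_neighbours) (auto simp: edges_graph card_edge)

lemma degree_tail:
  assumes u: "u \<in> U"
  shows "degree graph (tail u r) \<le> \<Delta>"
proof (cases r)
  case 0
  have "{y. \<exists>i. {tail u r, y} \<in> color_class i} = insert (tail u 1) ((\<lambda>v. tail v 0) ` {v. adj u v})"
    using 0 l by (auto simp: tail_edge_iff[OF u])
  then have "degree graph (tail u r) \<le> Suc (card ((\<lambda>v. tail v 0) ` {v. adj u v}))"
    unfolding degree_graph by (simp add: card_insert_le_m1)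
  also have "\<dots> \<le> Suc (card {v. adj u v})"
    using card_image_le[OF finite_neighbours] by simp
  also have "\<dots> \<le> \<Delta>"
    using card_neighbours_less[of u] unfolding adj_def by simp
  finally show ?thesis .
next
  case (Suc s)
  have "{y. \<exists>i. {tail u r, y} \<in> color_class i} \<subseteq> {tail u (Suc r), tail u s}"
    using Suc by (auto simp: tail_edge_iff[OF u])
  then have "degree graph (tail u r) \<le> card {tail u (Suc r), tail u s}"
    unfolding degree_graph by (intro card_mono) auto
  also have "\<dots> \<le> 2" by (simp add: card_insert_if)
  also have "\<dots> \<le> \<Delta>" by (rule \<Delta>)
  finally show ?thesis .
qed

lemma degree_star_center: "degree graph (star 0) = \<Delta>"
proof -
  have "{y. \<exists>i. {star 0, y} \<in> color_class i} = (\<lambda>k. star (Suc k)) ` {..<\<Delta>}"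
    by (auto simp: star_edge_iff)
  moreover have "inj_on (\<lambda>k. star (Suc k)) {..<\<Delta>}"
    by (simp add: inj_on_def star_eq_iff)
  ultimately show ?thesis by (simp add: degree_graph card_image)
qed

lemma degree_star: "degree graph (star j) \<le> \<Delta>"
proof (cases "j = 0")
  case False
  then have "{y. \<exists>i. {star j, y} \<in> color_class i} \<subseteq> {star 0}" by (auto simp: star_edge_iff)
  then have "degree graph (star j) \<le> card {star 0}"
    unfolding degree_graph by (intro card_mono) auto
  then show ?thesis using \<Delta> by simp
qed (simp add: degree_star_center)

theorem max_degree_graph: "max_degree graph = \<Delta>"
  unfolding max_degree_def
proof (rule Max_eqI)
  show "\<Delta> \<in> degree graph ` verts graph"
    using degree_star_center by (auto simp: graph_def intro!: image_eqI[of _ _ "star 0"])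
  show "d \<le> \<Delta>" if "d \<in> degree graph ` verts graph" for d
    using that degree_tail degree_star by (auto simp: graph_def)
qed (simp add: finite_verts)


subsection \<open>From covers to deletion sets\<close>

definition rainbow :: "'a set set \<Rightarrow> 'a list \<Rightarrow> nat list \<Rightarrow> bool" where
  "rainbow S vs cs \<longleftrightarrow> rainbow_path (delete_edges graph S) vs cs \<and> length cs = l - 1"

lemma obtain_rainbow:
  assumes "has_colored_induced_path (l - 1) l (delete_edges graph S)"
  obtains vs cs where "rainbow S vs cs"
proof (rule obtain_rainbow_path)
  show "has_colored_induced_path (l - 1) (Suc (l - 1)) (delete_edges graph S)"
    using assms l by simp
  show "classes (delete_edges graph S) ! i \<inter> classes (delete_edges graph S) ! j = {}"
    if "i < length (classes (delete_edges graph S))" "j < length (classes (delete_edges graph S))"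
      "i \<noteq> j"
    for i j
    using that color_class_unique by (auto simp: length_classes_graph nth_classes_graph)
qed (use that in \<open>simp add: rainbow_def\<close>)

lemma rainbow_rev: "rainbow S vs cs \<Longrightarrow> rainbow S (rev vs) (rev cs)"
  by (simp add: rainbow_def rainbow_path_rev)

lemma rainbowD:
  assumes "rainbow S vs cs"
  shows "length vs = l" "length cs = l - 1" "distinct vs" "distinct cs"
    "\<And>i. i < l - 1 \<Longrightarrow> {vs ! i, vs ! Suc i} \<in> color_class (cs ! i)"
    "\<And>i. i < l - 1 \<Longrightarrow> {vs ! i, vs ! Suc i} \<notin> S"
  using assms l by (auto simp: rainbow_def rainbow_path_def length_classes_graph nth_classes_graph)

lemma rainbow_nth_neq:
  "rainbow S vs cs \<Longrightarrow> i < l \<Longrightarrow> j < l \<Longrightarrow> i \<noteq> j \<Longrightarrow> vs ! i \<noteq> vs ! j"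
  by (simp add: nth_eq_iff_index_eq rainbowD)

lemma rainbow_colors_neq:
  "rainbow S vs cs \<Longrightarrow> i < l - 1 \<Longrightarrow> j < l - 1 \<Longrightarrow> i \<noteq> j \<Longrightarrow> cs ! i \<noteq> cs ! j"
  by (simp add: nth_eq_iff_index_eq rainbowD)

definition tip :: "'u \<Rightarrow> 'a" where
  "tip u = tail u (l - 3)"

lemma tip_neighbour_unique:
  assumes "u \<in> U" "{tip u, x} \<in> color_class i" "{tip u, y} \<in> color_class j"
  shows "x = y"
  using assms l by (auto simp: tip_def tail_edge_iff)

lemma rainbow_tip_at_end:
  assumes rb: "rainbow S vs cs" and i: "i < l" "vs ! i = tip u" and u: "u \<in> U"
  shows "i = 0 \<or> i = l - 1"
proof (rule ccontr)
  assume "\<not> ?thesis"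
  then obtain j where j: "i = Suc j" "Suc i < l" using i(1) by (cases i) auto
  have "{vs ! i, vs ! j} \<in> color_class (cs ! j)" "{vs ! i, vs ! Suc i} \<in> color_class (cs ! i)"
    using rainbowD(5)[OF rb, of j] rainbowD(5)[OF rb, of i] j by (auto simp: insert_commute)
  then have "vs ! j = vs ! Suc i" unfolding i(2) by (rule tip_neighbour_unique[OF u])
  then show False using rainbow_nth_neq[OF rb, of j "Suc i"] j by simp
qed

lemma last_color_at_tip:
  assumes "l > 4" "e \<in> color_class (l - 2)"
  shows "\<exists>u\<in>U. tip u \<in> e"
proof -
  have "third u v \<noteq> l - 2" if "adj u v" for u v using third_less[OF that] assms(1) by linarith
  moreover have color_neq: "\<chi> u \<noteq> l - 2" if "u \<in> U" for u
    using color_less[OF that] assms(1) by linarith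
  ultimately obtain u r where u: "u \<in> U" "tail_color u r = l - 2" "e = {tail u r, tail u (Suc r)}"
    using assms unfolding color_class_eq by auto
  then have "r = l - 4" using color_neq by (auto simp: tail_color_def split: if_splits)
  then have "Suc r = l - 3" using l by simp
  then show ?thesis using u by (auto simp: tip_def)
qed

lemma tip_free_vertex_cases:
  assumes "l = 4" "x \<in> verts graph" "\<forall>u\<in>U. x \<noteq> tip u"
  obtains (represented) u where "u \<in> U" "x = tail u 0" | (star) j where "x = star j"
proof -
  have "l - 2 = 2" "l - 3 = 1" using assms(1) by simp_all
  with assms(2,3) that show thesis by (auto simp: graph_def tip_def less_2_cases_iff)
qed

lemma tip_free_tail_edge:
  assumes "l = 4" "u \<in> U" "{tail u 0, y} \<in> color_class c" "\<forall>v\<in>U. y \<noteq> tip v"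
  obtains w where "adj u w" "c = third u w" "y = tail w 0"
proof -
  have "l - 3 = 1" using assms(1) by simp
  with assms(2-4) that show thesis by (auto simp: tail_edge_iff tip_def)
qed

text \<open>For \<open>l = 4\<close> a rainbow path that avoids the tips would consist of three connecting edges.\<close>

lemma rainbow_P4_has_tip:
  assumes l4: "l = 4" and rb: "rainbow S vs cs"
  shows "\<exists>u\<in>U. \<exists>i<l. vs ! i = tip u"
proof (rule ccontr)
  assume no_tip: "\<not> ?thesis"
  obtain c0 c1 c2 where cs: "cs = [c0, c1, c2]"
    using rainbowD(2)[OF rb] l4 by (auto simp: numeral_eq_Suc length_Suc_conv)
  obtain v0 v1 v2 v3 where vs: "vs = [v0, v1, v2, v3]"
    using rainbowD(1)[OF rb] l4 by (auto simp: numeral_eq_Suc length_Suc_conv)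
  have edges: "{v1, v0} \<in> color_class c0" "{v1, v2} \<in> color_class c1" "{v2, v3} \<in> color_class c2"
    using rainbowD(5)[OF rb, of 0] rainbowD(5)[OF rb, of 1] rainbowD(5)[OF rb, of 2] l4
    by (auto simp: cs vs insert_commute numeral_eq_Suc)
  have cs_neq: "c0 \<noteq> c1" "c1 \<noteq> c2" using rainbowD(4)[OF rb] by (auto simp: cs)
  have tip_free: "\<forall>u\<in>U. v \<noteq> tip u" if v: "v \<in> set vs" for v
  proof -
    obtain i where "i < l" "vs ! i = v" using v rainbowD(1)[OF rb] by (auto simp: in_set_conv_nth)
    then show ?thesis using no_tip by blast
  qed
  have v1: "v1 \<in> verts graph" "\<forall>u\<in>U. v1 \<noteq> tip u"
    using color_class_subset[OF edges(2)] tip_free by (simp_all add: vs)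
  from l4 v1 show False
  proof (cases rule: tip_free_vertex_cases)
    case (represented u)
    obtain w where w: "adj u w" "c0 = third u w"
      using tip_free_tail_edge[OF l4 represented(1), of v0 c0] edges(1) tip_free[of v0]
        represented(2)
      by (auto simp: vs)
    obtain v where v: "adj u v" "c1 = third u v" "v2 = tail v 0"
      using tip_free_tail_edge[OF l4 represented(1), of v2 c1] edges(2) tip_free[of v2]
        represented(2)
      by (auto simp: vs)
    have "v \<in> U" using adj_in_U[OF v(1)] by simp
    then obtain z where z: "adj v z" "c2 = third v z"
      using tip_free_tail_edge[OF l4, of v v3 c2] edges(3) tip_free[of v3] v(3) by (auto simp: vs)
    have "\<chi> w = \<chi> v \<or> \<chi> z = \<chi> u"
      using monochromatic_end[of u v] v(1) w(1) z(1) unfolding adj_def by blast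
    then show False using cs_neq v(2) w(2) z(2) by (auto simp: third_def add.commute)
  next
    case (star j)
    then show False using edges(1,2) cs_neq by (auto simp: star_edge_iff)
  qed
qed

lemma rainbow_has_tip:
  assumes rb: "rainbow S vs cs"
  shows "\<exists>u\<in>U. \<exists>i<l. vs ! i = tip u"
proof (cases "l = 4")
  case True
  then show ?thesis using rainbow_P4_has_tip rb by blast
next
  case False
  have "set cs = {..<l - 1}"
  proof (rule card_subset_eq)
    show "set cs \<subseteq> {..<l - 1}"
      using rainbowD(2)[OF rb] color_class_less[OF rainbowD(5)[OF rb]]
      by (auto simp: in_set_conv_nth)
    show "card (set cs) = card {..<l - 1}"
      using rainbowD(2,4)[OF rb] by (simp add: distinct_card)
  qed simp
  then have "l - 2 \<in> set cs" using l by simp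
  then obtain i where i: "i < l - 1" "cs ! i = l - 2"
    using rainbowD(2)[OF rb] by (auto simp: in_set_conv_nth)
  then obtain u where u: "u \<in> U" "tip u = vs ! i \<or> tip u = vs ! Suc i"
    using last_color_at_tip[of "{vs ! i, vs ! Suc i}"] rainbowD(5)[OF rb i(1)] l False by auto
  have "i < l" "Suc i < l" using i(1) by simp_all
  with u show ?thesis by metis
qed

lemma rainbow_from_tip_descends:
  assumes rb: "rainbow S vs cs" and u: "u \<in> U" "vs ! 0 = tip u" and i: "i \<le> l - 3"
  shows "vs ! i = tail u (l - 3 - i)"
  using i
proof (induction i rule: less_induct)
  case (less i)
  show ?case
  proof (cases i)
    case 0
    then show ?thesis using u by (simp add: tip_def)
  next
    case (Suc j)
    have vj: "vs ! j = tail u (l - 3 - j)" using less Suc by simp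
    have "{tail u (l - 3 - j), vs ! i} \<in> color_class (cs ! j)"
      using rainbowD(5)[OF rb, of j] less.prems Suc unfolding vj by simp
    moreover have height: "l - 3 - j = Suc (l - 3 - i)" using less.prems Suc by simp
    ultimately consider (up) "vs ! i = tail u (Suc (l - 3 - j))" "l - 3 - j < l - 3"
      | (down) "vs ! i = tail u (l - 3 - i)"
      using less.prems Suc unfolding height by (auto simp: tail_edge_iff[OF u(1)])
    then show ?thesis
    proof cases
      case up
      then obtain k where k: "j = Suc k" by (cases j) auto
      then have "l - 3 - k = Suc (l - 3 - j)" using less.prems Suc by simp
      then have "vs ! k = vs ! i" using less k Suc up(1) by simp
      moreover have "k < l" "i < l" "k \<noteq> i" using less.prems Suc k l by simp_all
      ultimately show ?thesis using rainbow_nth_neq[OF rb] by blast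
    qed
  qed
qed

definition pendant :: "'u \<Rightarrow> 'a set" where
  "pendant u = {tail u 0, tail u 1}"

lemma pendant_in_color_class: "u \<in> U \<Longrightarrow> pendant u \<in> color_class (\<chi> u)"
  using l by (simp add: pendant_def tail_edge_iff tail_color_def)

text \<open>
  Past the tail of \<open>u\<close> the path visits a neighbour \<open>v\<close> of \<open>u\<close>. Its last edge is the pendant edge of
  \<open>v\<close>: another connecting edge would repeat a color.
\<close>

lemma rainbow_from_tip_meets_pendants:
  assumes rb: "rainbow S vs cs" and u: "u \<in> U" "vs ! 0 = tip u"
  obtains v where "adj u v" "pendant u \<notin> S" "pendant v \<notin> S"
proof -
  have walk: "vs ! (l - 4) = tail u 1" "vs ! (l - 3) = tail u 0"
    using rainbow_from_tip_descends[OF rb u, of "l - 4"]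
      rainbow_from_tip_descends[OF rb u, of "l - 3"] l
    by simp_all
  have Suc_simps: "Suc (l - 4) = l - 3" "Suc (l - 3) = l - 2" "Suc (l - 2) = l - 1"
    using l by simp_all
  have pendant_u: "{tail u 0, tail u 1} \<in> color_class (cs ! (l - 4))" "pendant u \<notin> S"
    using rainbowD(5,6)[OF rb, of "l - 4"] l walk
    by (simp_all add: Suc_simps pendant_def insert_commute)
  then have color_u: "cs ! (l - 4) = \<chi> u"
    by (auto simp: tail_edge_iff[OF u(1)] tail_color_def tail_eq_iff)
  have "{tail u 0, vs ! (l - 2)} \<in> color_class (cs ! (l - 3))"
    using rainbowD(5)[OF rb, of "l - 3"] l walk by (simp add: Suc_simps)
  moreover have "vs ! (l - 2) \<noteq> tail u 1"
    using rainbow_nth_neq[OF rb, of "l - 4" "l - 2"] l walk(1) by fastforce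
  ultimately obtain v where v: "adj u v" "cs ! (l - 3) = third u v" "vs ! (l - 2) = tail v 0"
    by (auto simp: tail_edge_iff[OF u(1)])
  have vU: "v \<in> U" using adj_in_U[OF v(1)] by simp
  have last_edge: "{tail v 0, vs ! (l - 1)} \<in> color_class (cs ! (l - 2))"
    "{tail v 0, vs ! (l - 1)} \<notin> S"
    using rainbowD(5,6)[OF rb, of "l - 2"] l v(3) by (simp_all add: Suc_simps)
  have "vs ! (l - 1) = tail v 1"
  proof (rule ccontr)
    assume "vs ! (l - 1) \<noteq> tail v 1"
    then obtain z where z: "adj v z" "cs ! (l - 2) = third v z"
      using last_edge(1) by (auto simp: tail_edge_iff[OF vU])
    have "third v z = \<chi> u \<or> third v z = third u v"
      using color_less[OF u(1)] color_less[OF vU] color_less[of z] adj_in_U[OF z(1)]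
        adj_color_neq[OF v(1)] adj_color_neq[OF z(1)]
      unfolding third_def by arith
    moreover have "cs ! (l - 2) \<noteq> cs ! (l - 4)" "cs ! (l - 2) \<noteq> cs ! (l - 3)"
      using rainbow_colors_neq[OF rb] l by simp_all
    ultimately show False using color_u v(2) z(2) by auto
  qed
  then show thesis using that[OF v(1)] pendant_u(2) last_edge(2) by (simp add: pendant_def)
qed

theorem deletable_if_cover:
  assumes C: "C \<subseteq> U" "vertex_cover E C" and k: "card C \<le> k"
  shows "deletable (l - 1) l graph k"
  unfolding deletable_def
proof (intro exI conjI notI)
  show "pendant ` C \<subseteq> edges graph"
    using C(1) pendant_in_color_class by (auto simp: edges_graph)
  show "card (pendant ` C) \<le> k"
    using card_image_le[OF finite_subset[OF C(1) finite_U], of pendant] k by linarith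
  have no_path_from_tip: False if rb: "rainbow (pendant ` C) vs cs" and u: "u \<in> U" "vs ! 0 = tip u"
    for vs cs u
  proof (rule rainbow_from_tip_meets_pendants[OF rb u])
    fix v assume "adj u v" "pendant u \<notin> pendant ` C" "pendant v \<notin> pendant ` C"
    then show False using C(2) by (auto simp: vertex_cover_def adj_def)
  qed
  assume "has_colored_induced_path (l - 1) l (delete_edges graph (pendant ` C))"
  then obtain vs cs where rb: "rainbow (pendant ` C) vs cs" by (rule obtain_rainbow)
  then obtain u i where ui: "u \<in> U" "i < l" "vs ! i = tip u" using rainbow_has_tip by blast
  from rainbow_tip_at_end[OF rb ui(2,3,1)] show False
  proof
    assume "i = 0"
    then show False using no_path_from_tip[OF rb ui(1)] ui(3) by simp
  next
    assume "i = l - 1"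
    then have "rev vs ! 0 = tip u" using rainbowD(1)[OF rb] ui by (simp add: rev_nth)
    then show False by (rule no_path_from_tip[OF rainbow_rev[OF rb] ui(1)])
  qed
qed


subsection \<open>From deletion sets to covers\<close>

definition crossing_path :: "'u \<Rightarrow> 'u \<Rightarrow> 'a list" where
  "crossing_path u v =
     map (\<lambda>i. if i < l - 2 then tail u (l - 3 - i) else tail v (i - (l - 2))) [0..<l]"

lemma length_crossing_path: "length (crossing_path u v) = l"
  by (simp add: crossing_path_def)

lemma nth_crossing_path:
  "i < l \<Longrightarrow> crossing_path u v ! i = (if i < l - 2 then tail u (l - 3 - i) else tail v (i - (l - 2)))"
  by (simp add: crossing_path_def)

lemma crossing_path_in_verts:
  assumes "adj u v"
  shows "set (crossing_path u v) \<subseteq> verts graph"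
  using adj_in_U[OF assms] l by (auto simp: crossing_path_def intro!: tail_in_verts)

lemma distinct_crossing_path:
  assumes "adj u v"
  shows "distinct (crossing_path u v)"
  using adj_color_neq[OF assms]
  by (auto simp: distinct_conv_nth nth_crossing_path length_crossing_path tail_eq_iff)

definition crossing_color :: "'u \<Rightarrow> 'u \<Rightarrow> nat \<Rightarrow> nat" where
  "crossing_color u v i =
     (if i < l - 3 then tail_color u (l - 4 - i)
      else if i = l - 3 then third u v
      else \<chi> v)"

lemma crossing_path_edge_iff:
  assumes uv: "adj u v" and ij: "i < j" "j < l"
  shows "{crossing_path u v ! i, crossing_path u v ! j} \<in> color_class k \<longleftrightarrow>
    j = Suc i \<and> k = crossing_color u v i"
proof -
  have neq: "u \<noteq> v" using adj_color_neq[OF uv] by auto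
  note in_U = conjunct1[OF adj_in_U[OF uv]] conjunct2[OF adj_in_U[OF uv]]
  consider (descend) "i < l - 3" | (cross) "i = l - 3" | (ascend) "i = l - 2" using ij by arith
  then show ?thesis
  proof cases
    case descend
    then have "l - 3 - i = Suc (l - 4 - i)" "i < l - 2" by simp_all
    then have vi: "crossing_path u v ! i = tail u (Suc (l - 4 - i))"
      using ij by (simp add: nth_crossing_path)
    have "l - 4 - i = l - 3 - j \<and> j < l - 2 \<longleftrightarrow> j = Suc i" using descend ij by arith
    then show ?thesis
      using descend ij neq unfolding vi tail_edge_iff[OF in_U(1)]
      by (auto simp: nth_crossing_path tail_eq_iff crossing_color_def)
  next
    case cross
    then show ?thesis
      using ij neq uv l
      by (auto simp: nth_crossing_path tail_edge_iff[OF in_U(1)] tail_eq_iff crossing_color_def)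
  next
    case ascend
    then have "j = Suc i" "j - (l - 2) = 1" using ij by linarith+
    then have "j = Suc i" "crossing_path u v ! i = tail v 0" "crossing_path u v ! j = tail v 1"
      using ascend ij by (auto simp: nth_crossing_path)
    then show ?thesis
      using ascend l
      by (auto simp: tail_edge_iff[OF in_U(2)] tail_eq_iff crossing_color_def tail_color_def)
  qed
qed

lemma crossing_color_surj:
  assumes uv: "adj u v"
  shows "crossing_color u v ` {..<l - 1} = {..<l - 1}"
proof (intro equalityI subsetI)
  fix k assume "k \<in> crossing_color u v ` {..<l - 1}"
  then obtain i where i: "i < l - 1" "k = crossing_color u v i" by auto
  then have "{crossing_path u v ! i, crossing_path u v ! Suc i} \<in> color_class k"
    using crossing_path_edge_iff[OF uv, of i "Suc i"] by simp
  then show "k \<in> {..<l - 1}" using color_class_less by blast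
next
  fix k assume k: "k \<in> {..<l - 1}"
  have "crossing_color u v (l - 4) = \<chi> u" "crossing_color u v (l - 3) = third u v"
    "crossing_color u v (l - 2) = \<chi> v"
    using l by (auto simp: crossing_color_def tail_color_def)
  then have "{..<3} \<subseteq> crossing_color u v ` {..<l - 1}"
    using l imageI[of "l - 4" "{..<l - 1}" "crossing_color u v"]
      imageI[of "l - 3" "{..<l - 1}" "crossing_color u v"]
      imageI[of "l - 2" "{..<l - 1}" "crossing_color u v"]
    unfolding colors_adj[OF uv, symmetric] by simp
  moreover have "k = crossing_color u v (l - 2 - k)" if "3 \<le> k"
  proof -
    have "l - 2 - k < l - 3" "l - 4 - (l - 2 - k) = k - 2" using k that by auto
    then show ?thesis using that by (simp add: crossing_color_def tail_color_def)
  qed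
  ultimately show "k \<in> crossing_color u v ` {..<l - 1}"
    using l by (cases "k < 3") auto
qed

lemma crossing_path_survives:
  assumes uv: "adj u v"
    and path: "\<And>i. i < l - 1 \<Longrightarrow> {crossing_path u v ! i, crossing_path u v ! Suc i} \<notin> S"
  shows "has_colored_induced_path (l - 1) l (delete_edges graph S)"
proof -
  let ?H = "delete_edges graph S" and ?vs = "crossing_path u v"
  have edge_iff: "{?vs ! i, ?vs ! j} \<in> edges ?H \<longleftrightarrow> j = Suc i" if "i < j" "j < l" for i j
  proof -
    have "i < l - 1" using that by linarith
    then show ?thesis using crossing_path_edge_iff[OF uv that] path by (auto simp: edges_graph)
  qed
  have "induced_path ?H l ?vs"
    using edge_iff crossing_path_in_verts[OF uv] distinct_crossing_path[OF uv]
    by (auto simp: induced_path_def length_crossing_path)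
  moreover have "colors_of ?H (path_edges ?vs) = {..<l - 1}"
  proof -
    have "k \<in> colors_of ?H (path_edges ?vs)" if k: "k < l - 1" for k
    proof -
      obtain i where i: "i < l - 1" "k = crossing_color u v i"
        using crossing_color_surj[OF uv] k by blast
      then have "{?vs ! i, ?vs ! Suc i} \<in> color_class k"
        using crossing_path_edge_iff[OF uv, of i "Suc i" k] by simp
      moreover have "{?vs ! i, ?vs ! Suc i} \<in> path_edges ?vs"
        using i(1) by (auto simp: path_edges_def length_crossing_path)
      ultimately show ?thesis
        using k path[OF i(1)] by (auto simp: colors_of_def length_classes_graph nth_classes_graph)
    qed
    then show ?thesis by (auto simp: colors_of_def length_classes_graph)
  qed
  ultimately show ?thesis by (auto simp: has_colored_induced_path_def)
qed

theorem cover_if_deletable: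
  assumes "deletable (l - 1) l graph k"
  shows "\<exists>C\<subseteq>U. card C \<le> k \<and> vertex_cover E C"
proof -
  from assms obtain S where S: "S \<subseteq> edges graph" "card S \<le> k"
    and rainbow_free: "\<not> has_colored_induced_path (l - 1) l (delete_edges graph S)"
    unfolding deletable_def by blast
  have finite_S: "finite S" using S(1) finite_edges finite_subset by blast
  define owner where "owner e = (SOME u. \<exists>r. tail u r \<in> e)" for e
  have owner: "\<exists>r. tail (owner e) r \<in> e" if "tail u r \<in> e" for e u r
    unfolding owner_def by (rule someI[of _ u]) (use that in blast)
  define C where "C = owner ` S \<inter> U"
  have "card C \<le> card (owner ` S)" unfolding C_def using finite_S by (intro card_mono) auto
  also have "\<dots> \<le> k" using card_image_le[OF finite_S, of owner] S(2) by linarith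
  finally have "card C \<le> k" .
  moreover have "u \<in> C \<or> v \<in> C" if uv: "(u, v) \<in> E" for u v
  proof -
    have adj: "adj u v" using uv by (simp add: adj_def)
    obtain i where i: "i < l - 1" "{crossing_path u v ! i, crossing_path u v ! Suc i} \<in> S"
      (is "?e \<in> S")
      using crossing_path_survives[OF adj] rainbow_free by blast
    have points: "\<And>x. x \<in> ?e \<Longrightarrow> \<exists>r. x = tail u r \<or> x = tail v r"
      using i(1) by (auto simp: nth_crossing_path)
    then obtain r where "tail (owner ?e) r \<in> ?e" using owner by (metis insertI1)
    then have "owner ?e = u \<or> owner ?e = v" using points by (metis tail_eq_iff)
    moreover have "owner ?e \<in> owner ` S" using i(2) by (rule imageI)
    ultimately show ?thesis using adj_in_U[OF adj] by (auto simp: C_def)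
  qed
  ultimately show ?thesis by (intro exI[of _ C]) (auto simp: C_def vertex_cover_def)
qed

theorem deletable_iff_cover:
  "deletable (l - 1) l graph k \<longleftrightarrow> (\<exists>C\<subseteq>U. card C \<le> k \<and> vertex_cover E C)"
  using cover_if_deletable deletable_if_cover by blast

end


section \<open>Binary constraint problems as vertex cover\<close>

lemma strict_mono_on_card_ge:
  fixes g :: "nat \<Rightarrow> nat"
  assumes "finite D" "\<And>i. i < n \<Longrightarrow> g i \<in> D" "\<And>i k. i < k \<Longrightarrow> k < n \<Longrightarrow> g i < g k"
  shows "n \<le> card D"
proof -
  have "inj_on g {..<n}"
    by (rule strict_mono_on_imp_inj_on) (use assms(3) in \<open>simp add: strict_mono_on_def\<close>)
  then show ?thesis using card_inj_on_le[of g "{..<n}" D] assms(1,2) by auto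
qed

lemma card_path_cover_ge:
  fixes D :: "nat set"
  assumes "finite D" "\<And>p. p < 2 * m \<Longrightarrow> p \<in> D \<or> Suc p \<in> D"
  shows "m \<le> card D"
proof (rule strict_mono_on_card_ge[OF assms(1)])
  let ?g = "\<lambda>i. if 2 * i \<in> D then 2 * i else Suc (2 * i)"
  show "?g i \<in> D" if "i < m" for i using assms(2)[of "2 * i"] that by auto
  show "?g i < ?g k" if "i < k" "k < m" for i k using that by auto
qed

lemma card_path_cover_even_ge:
  fixes D :: "nat set"
  assumes "finite D" "\<And>p. p < 2 * m \<Longrightarrow> p \<in> D \<or> Suc p \<in> D" and j: "2 * j \<in> D" "j \<le> m"
  shows "Suc m \<le> card D"
proof (rule strict_mono_on_card_ge[OF assms(1)])
  let ?g = "\<lambda>i. if 2 * i \<in> D then 2 * i else if i < j then 2 * i + 1 else 2 * i - 1"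
  show "?g i \<in> D" if "i < Suc m" for i
  proof (cases "i \<le> j")
    case True
    then show ?thesis using assms(2)[of "2 * i"] j by (cases "i = j") auto
  next
    case False
    then have "Suc (2 * i - 1) = 2 * i" "2 * i - 1 < 2 * m" using that by auto
    then show ?thesis using assms(2)[of "2 * i - 1"] False by auto
  qed
  show "?g i < ?g k" if "i < k" "k < Suc m" for i k
    using that j by (cases "k = j"; cases "i = j") auto
qed

lemma card_evens: "card {p. p \<le> 2 * n \<and> even p} = Suc n"
proof -
  have "{p. p \<le> 2 * n \<and> even p} = (\<lambda>i. 2 * i) ` {..n}" by (auto elim!: evenE)
  then show ?thesis by (simp add: card_image inj_on_def)
qed

lemma card_odds: "card {p. p \<le> 2 * n \<and> odd p} = n"
proof -
  have "{p. p \<le> 2 * n \<and> odd p} = (\<lambda>i. 2 * i + 1) ` {..<n}" by (auto elim!: oddE)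
  then show ?thesis by (simp add: card_image inj_on_def)
qed

lemma mult_add_eq_iff:
  fixes d d' b b' A :: nat
  assumes "b < A" "b' < A"
  shows "d * A + b = d' * A + b' \<longleftrightarrow> d = d' \<and> b = b'"
proof
  assume "d * A + b = d' * A + b'"
  then have "(d * A + b) div A = (d' * A + b') div A" "(d * A + b) mod A = (d' * A + b') mod A"
    by simp_all
  then show "d = d' \<and> b = b'" using assms by simp
qed simp

text \<open>
  In direction \<open>d\<close> every variable is constrained with at most one other variable from either side;
  direction 0 relates a variable to itself, so that it excludes two values at once and can express
  unary constraints.
\<close>

locale directed_csp =
  fixes V :: "'v set" and A D :: nat and conflict :: "nat \<Rightarrow> 'v \<Rightarrow> nat \<Rightarrow> 'v \<Rightarrow> nat \<Rightarrow> bool"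
  assumes finite_V: "finite V" and V_nonempty: "V \<noteq> {}" and A_pos: "A \<ge> 1"
    and conflict_range: "conflict d v a w b \<Longrightarrow> d < D \<and> v \<in> V \<and> w \<in> V \<and> a < A \<and> b < A"
    and conflict_values: "v \<in> V \<Longrightarrow> a < A \<Longrightarrow> b < A \<Longrightarrow> a \<noteq> b \<Longrightarrow> conflict 0 v a v b"
    and target_unique: "conflict d v a w b \<Longrightarrow> conflict d v a' w' b' \<Longrightarrow> w = w'"
    and source_unique: "conflict d v a w b \<Longrightarrow> conflict d v' a' w b' \<Longrightarrow> v = v'"
begin

definition solvable :: bool where
  "solvable \<longleftrightarrow> (\<exists>f. (\<forall>v\<in>V. f v < A) \<and> (\<forall>d v w. \<not> conflict d v (f v) w (f w)))"

definition gap :: nat where "gap = 2 * (D * A)"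
definition half :: nat where "half = 2 * (D * A) + 3"
definition out_port :: "nat \<Rightarrow> nat \<Rightarrow> nat" where "out_port d b = 2 * (d * A + b)"
definition in_port :: "nat \<Rightarrow> nat \<Rightarrow> nat" where "in_port d a = gap + 8 + 2 * (d * A + a)"

definition nodes :: "('v \<times> nat \<times> nat) set" where
  "nodes = V \<times> {..<A} \<times> {..2 * half}"

definition copy_edges :: "(('v \<times> nat \<times> nat) \<times> ('v \<times> nat \<times> nat)) set" where
  "copy_edges = {((v, a, p), (v, a, Suc p)) | v a p. v \<in> V \<and> a < A \<and> p < 2 * half}"

definition conflict_edges :: "(('v \<times> nat \<times> nat) \<times> ('v \<times> nat \<times> nat)) set" where
  "conflict_edges =
     {((v, a, out_port d b), (w, b, in_port d a)) | d v a w b. conflict d v a w b}"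

definition budget :: nat where
  "budget = card V * (A * half + A - 1)"

lemma port_index_less: "d < D \<Longrightarrow> b < A \<Longrightarrow> d * A + b < D * A"
  using mult_le_mono1[of "Suc d" D A] by simp

lemma out_port_less: "d < D \<Longrightarrow> b < A \<Longrightarrow> out_port d b < gap"
  unfolding out_port_def gap_def by (intro mult_strict_left_mono port_index_less) simp_all

lemma in_port_le: "d < D \<Longrightarrow> a < A \<Longrightarrow> in_port d a \<le> 2 * half"
  using mult_le_mono2[OF Suc_leI[OF port_index_less], of d a 2]
  by (simp add: in_port_def gap_def half_def mult.commute[of A D])

lemma even_gap: "even gap"
  by (simp add: gap_def)

lemma even_ports: "even (out_port d b)" "even (in_port d a)"
  by (simp_all add: out_port_def in_port_def gap_def)

lemma conflict_edges_subset: "conflict_edges \<subseteq> nodes \<times> nodes"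
proof -
  have "(v, a, out_port d b) \<in> nodes \<and> (w, b, in_port d a) \<in> nodes" if "conflict d v a w b"
    for d v a w b
    using conflict_range[OF that] out_port_less[of d b] in_port_le[of d a]
    by (auto simp: nodes_def half_def gap_def)
  then show ?thesis by (auto simp: conflict_edges_def)
qed

lemma edges_subset: "copy_edges \<union> conflict_edges \<subseteq> nodes \<times> nodes"
  using conflict_edges_subset by (auto simp: copy_edges_def nodes_def)

lemma finite_nodes: "finite nodes"
  by (simp add: nodes_def finite_V)


subsection \<open>Degrees and colors\<close>

lemma conflict_target_unique:
  assumes "(x, y) \<in> conflict_edges" "(x, y') \<in> conflict_edges"
  shows "y = y'"
proof -
  from assms obtain d v a w b d' w' b'
    where xy: "x = (v, a, out_port d b)" "y = (w, b, in_port d a)"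
    "y' = (w', b', in_port d' a)" and port: "out_port d b = out_port d' b'"
    and c: "conflict d v a w b" "conflict d' v a w' b'"
    by (auto simp: conflict_edges_def)
  have "d * A + b = d' * A + b'" using port by (simp only: out_port_def mult_cancel1) simp
  then have "d = d' \<and> b = b'"
    using conflict_range[OF c(1)] conflict_range[OF c(2)] mult_add_eq_iff by simp
  then show ?thesis using xy c target_unique by auto
qed

lemma conflict_source_unique:
  assumes "(x, y) \<in> conflict_edges" "(x', y) \<in> conflict_edges"
  shows "x = x'"
proof -
  from assms obtain d v a w b d' v' a'
    where xy: "x = (v, a, out_port d b)" "y = (w, b, in_port d a)"
    "x' = (v', a', out_port d' b)" and port: "in_port d a = in_port d' a'"
    and c: "conflict d v a w b" "conflict d' v' a' w b"
    by (auto simp: conflict_edges_def)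
  have "d * A + a = d' * A + a'"
    using port by (simp only: in_port_def add_left_cancel mult_cancel1) simp
  then have "d = d' \<and> a = a'"
    using conflict_range[OF c(1)] conflict_range[OF c(2)] mult_add_eq_iff by simp
  then show ?thesis using xy c source_unique by auto
qed

lemma conflict_edges_no_path: "(x, y) \<in> conflict_edges \<Longrightarrow> (y, z) \<notin> conflict_edges"
  using out_port_less by (fastforce simp: conflict_edges_def in_port_def dest: conflict_range)

lemma card_neighbours_le:
  "card {y. (x, y) \<in> copy_edges \<union> conflict_edges \<union> (copy_edges \<union> conflict_edges)\<inverse>} \<le> 3"
proof -
  obtain v a p where x: "x = (v, a, p)" by (cases x) auto
  let ?P = "{(v, a, Suc p), (v, a, p - 1)}"
    and ?X = "{y. (x, y) \<in> conflict_edges \<union> conflict_edges\<inverse>}"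
  have fin: "finite ?X"
    by (rule finite_subset[OF _ finite_nodes]) (use conflict_edges_subset in auto)
  have "card {y. (x, y) \<in> copy_edges \<union> conflict_edges \<union> (copy_edges \<union> conflict_edges)\<inverse>} \<le>
      card (?P \<union> ?X)"
    by (rule card_mono) (use fin in \<open>auto simp: copy_edges_def x\<close>)
  also have "\<dots> \<le> card ?P + card ?X" by (rule card_Un_le)
  moreover have "card ?P \<le> 2" by (simp add: card_insert_if)
  moreover have "y = z" if "y \<in> ?X" "z \<in> ?X" for y z
    using that conflict_target_unique conflict_source_unique conflict_edges_no_path by blast
  then have "card ?X \<le> 1" using fin by (simp only: One_nat_def card_le_Suc0_iff_eq) blast
  ultimately show ?thesis by linarith
qed

text \<open>
  Conflict edges run from color 0 below the gap to color 1 above it. All neighbours of a position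
  other than the pairwise non-adjacent \<open>gap + 1\<close>, \<open>gap + 4\<close> and \<open>gap + 7\<close> have the same color.
\<close>

definition position_color :: "nat \<Rightarrow> nat" where
  "position_color p =
     (if p < gap then p mod 2
      else if p < gap + 8 then [0, 1, 2, 1, 2, 0, 2, 0] ! (p - gap)
      else Suc p mod 2)"

definition color :: "'v \<times> nat \<times> nat \<Rightarrow> nat" where
  "color = (\<lambda>(v, a, p). position_color p)"

definition mixed :: "nat \<Rightarrow> bool" where
  "mixed p \<longleftrightarrow> p \<in> {gap + 1, gap + 4, gap + 7}"

lemma gap_cases:
  obtains (below) "p < gap"
  | "p = gap" | "p = gap + 1" | "p = gap + 2" | "p = gap + 3" | "p = gap + 4"
  | "p = gap + 5" | "p = gap + 6" | "p = gap + 7"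
  | (above) "p \<ge> gap + 8"
  by linarith

lemma gap_mod_2: "gap mod 2 = 0"
  using even_gap by simp

lemma position_color_gap:
  "position_color gap = 0" "position_color (gap + 1) = 1" "position_color (gap + 2) = 2"
  "position_color (gap + 3) = 1" "position_color (gap + 4) = 2" "position_color (gap + 5) = 0"
  "position_color (gap + 6) = 2" "position_color (gap + 7) = 0"
  by (simp_all add: position_color_def)

lemma position_color_less: "position_color p < 3"
  by (cases p rule: gap_cases) (simp_all add: position_color_gap, auto simp: position_color_def)

lemma position_color_Suc_neq: "position_color p \<noteq> position_color (Suc p)"
proof (cases p rule: gap_cases)
  case below
  then consider "Suc p < gap" | (last) "Suc p = gap" by linarith
  then show ?thesis
  proof cases
    case last
    then have "odd p" using even_gap by (metis even_Suc)
    then show ?thesis using below last position_color_gap(1)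
      by (simp add: position_color_def odd_iff_mod_2_eq_one)
  qed (simp add: position_color_def mod_Suc)
next
  case above
  then show ?thesis by (simp add: position_color_def mod_Suc)
qed (use gap_mod_2 in \<open>simp_all add: position_color_def mod_Suc eval_nat_numeral\<close>)

lemma position_color_Suc_Suc: "\<not> mixed (Suc p) \<Longrightarrow> position_color (Suc (Suc p)) = position_color p"
proof (cases p rule: gap_cases)
  case below
  then consider "Suc (Suc p) < gap" | (last_but_one) "Suc (Suc p) = gap" | (last) "Suc p = gap"
    by linarith
  then show ?thesis
  proof cases
    case last_but_one
    then have "even p" using even_gap by (metis even_Suc)
    then show ?thesis using below last_but_one position_color_gap(1)
      by (simp add: position_color_def even_iff_mod_2_eq_zero)
  next
    case last
    then have "odd p" using even_gap by (metis even_Suc)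
    then show ?thesis using below last position_color_gap(2)
      by (simp add: position_color_def odd_iff_mod_2_eq_one)
  qed (simp add: position_color_def mod_Suc)
next
  case above
  then show ?thesis by (simp add: position_color_def mod_Suc)
qed (use gap_mod_2 in \<open>simp_all add: position_color_def mixed_def mod_Suc eval_nat_numeral\<close>)

lemma mixed_not_adjacent: "\<not> (mixed p \<and> mixed (Suc p))"
  by (auto simp: mixed_def)

lemma out_port_colors:
  assumes "d < D" "b < A"
  shows "position_color (out_port d b) = 0" "position_color (Suc (out_port d b)) = 1"
    "\<not> mixed (out_port d b)"
proof -
  have "even (out_port d b)" "out_port d b < gap" using even_ports out_port_less[OF assms] by auto
  moreover from this have "Suc (out_port d b) < gap" "out_port d b mod 2 = 0"
    using even_gap by presburger+
  ultimately show "position_color (out_port d b) = 0" "position_color (Suc (out_port d b)) = 1"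
    "\<not> mixed (out_port d b)"
    by (auto simp: position_color_def mixed_def mod_Suc)
qed

lemma in_port_colors:
  "position_color (in_port d a) = 1" "position_color (Suc (in_port d a)) = 0"
    "\<not> mixed (in_port d a)"
proof -
  have "in_port d a \<ge> gap + 8" "in_port d a mod 2 = 0"
    using even_ports by (auto simp: in_port_def)
  then show "position_color (in_port d a) = 1" "position_color (Suc (in_port d a)) = 0"
    "\<not> mixed (in_port d a)"
    by (auto simp: position_color_def mixed_def mod_Suc)
qed

definition adjacent :: "'v \<times> nat \<times> nat \<Rightarrow> 'v \<times> nat \<times> nat \<Rightarrow> bool" where
  "adjacent x y \<longleftrightarrow> (x, y) \<in> copy_edges \<union> conflict_edges \<union> (copy_edges \<union> conflict_edges)\<inverse>"

lemma adjacent_cases: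
  assumes "adjacent x y"
  obtains (up) v a p where "x = (v, a, p)" "y = (v, a, Suc p)"
  | (down) v a p where "x = (v, a, Suc p)" "y = (v, a, p)"
  | (outgoing) d v a w b where "d < D" "b < A" "x = (v, a, out_port d b)" "y = (w, b, in_port d a)"
  | (incoming) d v a w b where "d < D" "b < A" "x = (w, b, in_port d a)" "y = (v, a, out_port d b)"
  using assms
  unfolding adjacent_def copy_edges_def conflict_edges_def
  by (elim UnE) (blast dest: conflict_range)+

lemma adjacent_color_neq:
  assumes "adjacent x y"
  shows "color x \<noteq> color y"
  using assms
proof (cases rule: adjacent_cases)
  case up
  then show ?thesis using position_color_Suc_neq by (simp add: color_def)
next
  case down
  then show ?thesis using position_color_Suc_neq by (metis color_def case_prod_conv)
qed (simp_all add: color_def out_port_colors in_port_colors)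

lemma neighbour_color:
  assumes "adjacent (v, a, p) y" "\<not> mixed p"
  shows "color y = position_color (Suc p)"
  using assms(1)
proof (cases rule: adjacent_cases)
  case down
  then show ?thesis using assms(2) position_color_Suc_Suc by (simp add: color_def)
qed (simp_all add: color_def out_port_colors in_port_colors)

lemma adjacent_not_mixed:
  assumes "adjacent (v, a, p) (w, b, q)"
  shows "\<not> mixed p \<or> \<not> mixed q"
  using assms
  by (cases rule: adjacent_cases)
    (use mixed_not_adjacent in \<open>auto simp: out_port_colors in_port_colors\<close>)

lemma adjacent_sym: "adjacent x y \<Longrightarrow> adjacent y x"
  by (auto simp: adjacent_def)

lemma monochromatic_end:
  assumes "adjacent x y"
  shows "(\<forall>z. adjacent x z \<longrightarrow> color z = color y) \<or> (\<forall>z. adjacent y z \<longrightarrow> color z = color x)"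
proof -
  obtain v a p where x: "x = (v, a, p)" by (cases x) auto
  obtain w b q where y: "y = (w, b, q)" by (cases y) auto
  have yx: "adjacent y x" using assms by (rule adjacent_sym)
  from adjacent_not_mixed[OF assms[unfolded x y]] show ?thesis
    using neighbour_color assms yx unfolding x y by metis
qed

lemma color_less: "color x < 3"
  by (cases x) (simp add: color_def position_color_less)

lemma color_surj:
  assumes "i < 3"
  shows "i \<in> color ` nodes"
proof -
  obtain v where "v \<in> V" using V_nonempty by blast
  then have "(v, 0, gap + i) \<in> nodes" using A_pos assms by (simp add: nodes_def half_def gap_def)
  moreover have "i = 0 \<or> i = 1 \<or> i = 2" using assms by auto
  then have "position_color (gap + i) = i" using position_color_gap by auto
  ultimately show ?thesis by (force simp: color_def)
qed

theorem cover_graph_nodes: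
  assumes "l \<ge> 4" "\<Delta> \<ge> 4"
    and "\<And>x y r s. tail x r = tail y s \<longleftrightarrow> x = y \<and> r = s" "\<And>i j. star i = star j \<longleftrightarrow> i = j"
    and "\<And>x r i. x \<in> nodes \<Longrightarrow> star i \<noteq> tail x r"
  shows "cover_graph nodes (copy_edges \<union> conflict_edges) color tail star l \<Delta>"
proof
  show "card {y. (x, y) \<in> copy_edges \<union> conflict_edges \<union> (copy_edges \<union> conflict_edges)\<inverse>} < \<Delta>" for x
    using card_neighbours_le[of x] assms(2) by linarith
  show "color x \<noteq> color y" if "(x, y) \<in> copy_edges \<union> conflict_edges" for x y
    using adjacent_color_neq[of x y] that by (auto simp: adjacent_def)
  show "(\<forall>z. (x, z) \<in> copy_edges \<union> conflict_edges \<union> (copy_edges \<union> conflict_edges)\<inverse> \<longrightarrow>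
      color z = color y) \<or>
      (\<forall>z. (y, z) \<in> copy_edges \<union> conflict_edges \<union> (copy_edges \<union> conflict_edges)\<inverse> \<longrightarrow>
        color z = color x)"
    if "(x, y) \<in> copy_edges \<union> conflict_edges \<union> (copy_edges \<union> conflict_edges)\<inverse>" for x y
    using monochromatic_end[of x y] that unfolding adjacent_def by blast
qed (use assms edges_subset color_less color_surj in \<open>auto simp: finite_nodes\<close>)


subsection \<open>Solutions and covers\<close>

lemma budget_eq: "budget + card V = card (V \<times> {..<A}) * Suc half"
proof -
  have "budget + card V = card V * (A * half + A - 1 + 1)" by (simp add: budget_def)
  also have "A * half + A - 1 + 1 = A * Suc half" using A_pos by simp
  finally show ?thesis by (simp only: card_cartesian_product card_lessThan mult.assoc)
qed

definition copy :: "('v \<times> nat \<times> nat) set \<Rightarrow> 'v \<times> nat \<Rightarrow> nat set" where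
  "copy C = (\<lambda>(v, a). {p. (v, a, p) \<in> C})"

lemma finite_copy:
  assumes "C \<subseteq> nodes"
  shows "finite (copy C x)"
  by (rule finite_subset[of _ "{..2 * half}"]) (use assms in \<open>auto simp: copy_def nodes_def\<close>)

lemma card_eq_sum_copies:
  assumes "C \<subseteq> nodes"
  shows "card C = (\<Sum>x\<in>V \<times> {..<A}. card (copy C x))"
proof -
  have "C = (\<lambda>((v, a), p). (v, a, p)) ` (SIGMA x:V \<times> {..<A}. copy C x)"
    using assms by (force simp: copy_def nodes_def)
  moreover have "inj_on (\<lambda>((v, a), p). (v, a, p)) (SIGMA x:V \<times> {..<A}. copy C x)"
    by (auto simp: inj_on_def)
  ultimately have "card C = card (SIGMA x:V \<times> {..<A}. copy C x)" by (metis card_image)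
  then show ?thesis using finite_V finite_copy[OF assms] by simp
qed

lemma cover_if_solvable:
  assumes "solvable"
  shows "\<exists>C\<subseteq>nodes. card C \<le> budget \<and> vertex_cover (copy_edges \<union> conflict_edges) C"
proof -
  from assms obtain f where f_less: "\<And>v. v \<in> V \<Longrightarrow> f v < A"
    and no_conflict: "\<And>d v w. \<not> conflict d v (f v) w (f w)"
    unfolding solvable_def by blast
  define C where "C = {(v, a, p) \<in> nodes. f v = a \<longleftrightarrow> odd p}"
  have C_subset: "C \<subseteq> nodes" by (auto simp: C_def)
  have card_copy: "card (copy C x) + of_bool (f (fst x) = snd x) = Suc half" if "x \<in> V \<times> {..<A}"
    for x
  proof -
    have "copy C x =
        (if f (fst x) = snd x then {p. p \<le> 2 * half \<and> odd p} else {p. p \<le> 2 * half \<and> even p})"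
      using that by (auto simp: copy_def C_def nodes_def)
    then show ?thesis by (simp add: card_evens card_odds)
  qed
  have "V \<times> {..<A} \<inter> {x. f (fst x) = snd x} = (\<lambda>v. (v, f v)) ` V"
    using f_less by auto
  then have "(\<Sum>x\<in>V \<times> {..<A}. of_bool (f (fst x) = snd x)) = card V"
    using finite_V by (simp add: card_image inj_on_def)
  then have "card C + card V = (\<Sum>x\<in>V \<times> {..<A}. card (copy C x) + of_bool (f (fst x) = snd x))"
    by (simp add: card_eq_sum_copies[OF C_subset] sum.distrib)
  also have "\<dots> = budget + card V" using card_copy budget_eq by simp
  finally have "card C \<le> budget" by simp
  moreover have "x \<in> C \<or> y \<in> C" if "(x, y) \<in> copy_edges" for x y
    using that by (auto simp: copy_edges_def C_def nodes_def)
  moreover have "x \<in> C \<or> y \<in> C" if "(x, y) \<in> conflict_edges" for x y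
    using that no_conflict conflict_edges_subset even_ports
    by (fastforce simp: conflict_edges_def C_def)
  ultimately have "vertex_cover (copy_edges \<union> conflict_edges) C"
    unfolding vertex_cover_def by blast
  with \<open>card C \<le> budget\<close> C_subset show ?thesis by blast
qed

definition free :: "('v \<times> nat \<times> nat) set \<Rightarrow> 'v \<times> nat \<Rightarrow> bool" where
  "free C x \<longleftrightarrow> (\<forall>p. even p \<longrightarrow> p \<notin> copy C x)"

lemma card_copy_ge:
  assumes C_subset: "C \<subseteq> nodes" and cover: "vertex_cover (copy_edges \<union> conflict_edges) C"
    and x: "x \<in> V \<times> {..<A}"
  shows "Suc half \<le> card (copy C x) + of_bool (free C x)"
proof -
  have covered: "p \<in> copy C x \<or> Suc p \<in> copy C x" if "p < 2 * half" for p
    using cover that x by (auto simp: vertex_cover_def copy_edges_def copy_def)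
  show ?thesis
  proof (cases "free C x")
    case True
    then show ?thesis using card_path_cover_ge[OF finite_copy[OF C_subset] covered] by simp
  next
    case False
    then obtain j where j: "2 * j \<in> copy C x" by (auto simp: free_def elim: evenE)
    then have "j \<le> half" using C_subset by (auto simp: copy_def nodes_def)
    then show ?thesis
      using card_path_cover_even_ge[OF finite_copy[OF C_subset] covered j] False by simp
  qed
qed

lemma free_not_in_conflict:
  assumes cover: "vertex_cover (copy_edges \<union> conflict_edges) C" and "free C (v, a)" "free C (w, b)"
  shows "\<not> conflict d v a w b"
proof
  assume "conflict d v a w b"
  then have "((v, a, out_port d b), (w, b, in_port d a)) \<in> conflict_edges"
    unfolding conflict_edges_def by blast
  then have "out_port d b \<in> copy C (v, a) \<or> in_port d a \<in> copy C (w, b)"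
    using cover by (auto simp: vertex_cover_def copy_def)
  then show False using assms(2,3) even_ports by (auto simp: free_def)
qed

text \<open>
  At most one value per variable is free, and the budget enforces that there is exactly one.
\<close>

lemma solvable_if_cover:
  assumes C_subset: "C \<subseteq> nodes" and card_C: "card C \<le> budget"
    and cover: "vertex_cover (copy_edges \<union> conflict_edges) C"
  shows "solvable"
proof -
  define F where "F = V \<times> {..<A} \<inter> Collect (free C)"
  have inj: "inj_on fst F"
    using free_not_in_conflict[OF cover] conflict_values by (fastforce simp: inj_on_def F_def)
  have "card C + card F = (\<Sum>x\<in>V \<times> {..<A}. card (copy C x) + of_bool (free C x))"
    using finite_V by (simp add: card_eq_sum_copies[OF C_subset] sum.distrib F_def)
  also have "\<dots> \<ge> card (V \<times> {..<A}) * Suc half"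
    using sum_mono[of "V \<times> {..<A}" "\<lambda>_. Suc half", OF card_copy_ge[OF C_subset cover]] by simp
  finally have "card V \<le> card (fst ` F)"
    using card_C budget_eq by (simp add: card_image[OF inj])
  then have "fst ` F = V"
    using finite_V by (intro card_seteq) (auto simp: F_def)
  then have "\<exists>a<A. free C (v, a)" if "v \<in> V" for v
    using that by (force simp: F_def)
  then obtain f where f: "\<And>v. v \<in> V \<Longrightarrow> f v < A \<and> free C (v, f v)" by metis
  then have "\<not> conflict d v (f v) w (f w)" for d v w
    using free_not_in_conflict[OF cover] conflict_range by blast
  with f show ?thesis unfolding solvable_def by blast
qed

theorem solvable_iff_cover:
  "solvable \<longleftrightarrow> (\<exists>C\<subseteq>nodes. card C \<le> budget \<and> vertex_cover (copy_edges \<union> conflict_edges) C)"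
  using cover_if_solvable solvable_if_cover by blast

end


section \<open>Accepting computations as grid constraint problems\<close>

subsection \<open>Grid constraint problems\<close>

record 'v grid_problem =
  cell_values :: "'v set"
  compatible :: "nat \<Rightarrow> 'v \<Rightarrow> 'v \<Rightarrow> bool"
  first_row :: "bool \<Rightarrow> nat \<Rightarrow> 'v \<Rightarrow> bool"
  accepting :: "'v \<Rightarrow> bool"

text \<open>
  The conditions in the directions 1 to 4 relate a cell to its right, lower and lower right neighbour
  and its lower to its right neighbour. The last one has its source in the lower row because all
  offsets are natural numbers and columns should not decrease.
\<close>

definition src_row :: "nat \<Rightarrow> nat" where "src_row d = (if d = 4 then 1 else 0)"
definition tgt_row :: "nat \<Rightarrow> nat" where "tgt_row d = (if d = 2 \<or> d = 3 then 1 else 0)"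
definition tgt_col :: "nat \<Rightarrow> nat" where "tgt_col d = (if d = 1 \<or> d = 3 \<or> d = 4 then 1 else 0)"

lemmas direction_defs = src_row_def tgt_row_def tgt_col_def

abbreviation input_symbol :: "nat \<Rightarrow> bool list \<Rightarrow> nat \<Rightarrow> nat" where
  "input_symbol N x c \<equiv> contents x (int c - int N)"

definition grid_solution :: "'v grid_problem \<Rightarrow> nat \<Rightarrow> bool list \<Rightarrow> (nat \<Rightarrow> nat \<Rightarrow> 'v) \<Rightarrow> bool" where
  "grid_solution P N x v \<longleftrightarrow>
     (\<forall>t\<le>N. \<forall>c\<le>2 * N. v t c \<in> cell_values P) \<and>
     (\<forall>d\<in>{1..4}. \<forall>t<N. \<forall>c<2 * N. compatible P d (v (t + src_row d) c)
       (v (t + tgt_row d) (c + tgt_col d))) \<and>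
     (\<forall>c\<le>2 * N. first_row P (c = N) (input_symbol N x c) (v 0 c)) \<and>
     accepting P (v N N)"

definition grid_solvable :: "'v grid_problem \<Rightarrow> nat \<Rightarrow> bool list \<Rightarrow> bool" where
  "grid_solvable P N x \<longleftrightarrow> (\<exists>v. grid_solution P N x v)"

lemma direction_bounds: "src_row d \<le> 1" "tgt_row d \<le> 1" "tgt_col d \<le> 1"
  by (auto simp: direction_defs)

definition pullback :: "('a \<Rightarrow> 'v) \<Rightarrow> 'a set \<Rightarrow> 'v grid_problem \<Rightarrow> 'a grid_problem" where
  "pullback h X P = \<lparr>cell_values = X, compatible = (\<lambda>d a b. compatible P d (h a) (h b)),
     first_row = (\<lambda>m s a. first_row P m s (h a)), accepting = (\<lambda>a. accepting P (h a))\<rparr>"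

lemma grid_solvable_pullback:
  assumes cell_values: "cell_values P = h ` X"
  shows "grid_solvable (pullback h X P) N x \<longleftrightarrow> grid_solvable P N x"
proof
  assume "grid_solvable (pullback h X P) N x"
  then obtain v where "grid_solution (pullback h X P) N x v" by (auto simp: grid_solvable_def)
  then have "grid_solution P N x (\<lambda>t c. h (v t c))"
    by (simp add: grid_solution_def pullback_def cell_values)
  then show "grid_solvable P N x" by (auto simp: grid_solvable_def)
next
  assume "grid_solvable P N x"
  then obtain v where v: "grid_solution P N x v" by (auto simp: grid_solvable_def)
  define u where "u t c = inv_into X h (v t c)" for t c
  have u: "u t c \<in> X" "h (u t c) = v t c" if "t \<le> N" "c \<le> 2 * N" for t c
    using v that by (simp_all add: grid_solution_def cell_values u_def inv_into_into f_inv_into_f)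
  have "h (u (t + src_row d) c) = v (t + src_row d) c"
    "h (u (t + tgt_row d) (c + tgt_col d)) = v (t + tgt_row d) (c + tgt_col d)"
    if "t < N" "c < 2 * N" for t c d
    using that direction_bounds[of d] by (simp_all add: u)
  then have "grid_solution (pullback h X P) N x u"
    using v u by (auto simp: grid_solution_def pullback_def)
  then show "grid_solvable (pullback h X P) N x" by (auto simp: grid_solvable_def)
qed


subsection \<open>Computations as sequences of transitions\<close>

datatype transition =
  Transition (source: nat) (reading: "nat list") (target: nat) (actions: "(nat \<times> move) list")
    (idle: bool)

definition head_offset :: "transition \<Rightarrow> nat \<Rightarrow> int" where
  "head_offset d j = offset (snd (actions d ! j))"

definition apply_transition :: "transition \<Rightarrow> config \<Rightarrow> config" where
  "apply_transition d C = (target d, map2 act (snd C) (actions d))"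

definition symbol_at :: "config \<Rightarrow> nat \<Rightarrow> int \<Rightarrow> nat" where
  "symbol_at C j i = fst (snd C ! j) (snd (snd C ! j) + i)"

locale ntm =
  fixes M :: tm
  assumes turing_machine: "turing_machine M"
begin

definition well_formed :: "config \<Rightarrow> bool" where
  "well_formed C \<longleftrightarrow> fst C < states M \<and> length (snd C) = tapes M \<and>
     (\<forall>j<tapes M. \<forall>i. fst (snd C ! j) i < symbols M)"

definition idle_transition :: "nat list \<Rightarrow> transition" where
  "idle_transition ss = Transition 1 ss 1 (map (\<lambda>s. (s, Stay)) ss) True"

text \<open>The idle transitions make all accepting computations equally long.\<close>

definition transitions :: "transition set" where
  "transitions =
     {Transition q ss q' as False | q ss q' as. q < states M \<and> ss \<in> reads M \<and>
       (q', as) \<in> delta M q ss} \<union>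
     {idle_transition ss | ss. ss \<in> reads M \<and> delta M 1 ss = {}}"

definition enabled :: "transition \<Rightarrow> config \<Rightarrow> bool" where
  "enabled d C \<longleftrightarrow> d \<in> transitions \<and> source d = fst C \<and> reading d = map read (snd C)"

definition run :: "nat \<Rightarrow> bool list \<Rightarrow> (nat \<Rightarrow> transition) \<Rightarrow> (nat \<Rightarrow> config) \<Rightarrow> bool" where
  "run N x ds C \<longleftrightarrow> C 0 = initial M x \<and>
     (\<forall>t\<le>N. enabled (ds t) (C t) \<and> C (Suc t) = apply_transition (ds t) (C t)) \<and> idle (ds N)"

definition accepts :: "bool list \<Rightarrow> bool" where
  "accepts x \<longleftrightarrow> (\<exists>t C. (step M ^^ t) (initial M x) C \<and> halted M C \<and> fst C = 1)"

lemma machine_bounds: "tapes M \<ge> 1" "states M \<ge> 2" "symbols M \<ge> 3"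
  using turing_machine by (auto simp: turing_machine_def)

lemma well_formed_initial: "well_formed (initial M x)"
  using machine_bounds by (auto simp: well_formed_def initial_def contents_def nth_Cons')

lemma symbol_at_less: "well_formed C \<Longrightarrow> j < tapes M \<Longrightarrow> symbol_at C j i < symbols M"
  by (simp add: well_formed_def symbol_at_def)

lemma map_read_eq: "well_formed C \<Longrightarrow> map read (snd C) = map (\<lambda>j. symbol_at C j 0) [0..<tapes M]"
  by (rule nth_equalityI) (auto simp: well_formed_def symbol_at_def read_def)

lemma finite_reads: "finite (reads M)"
  using finite_lists_length_eq[of "{..<symbols M}" "tapes M"]
  by (rule finite_subset[rotated]) (auto simp: reads_def)

lemma map_read_in_reads: "well_formed C \<Longrightarrow> map read (snd C) \<in> reads M"
  by (auto simp: map_read_eq reads_def symbol_at_less)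

lemma transition_bounds:
  assumes "d \<in> transitions"
  shows "target d < states M" "length (actions d) = tapes M"
    "\<And>j. j < tapes M \<Longrightarrow> fst (actions d ! j) < symbols M"
    "reading d \<in> reads M" "source d < states M"
proof -
  from assms consider (step) q ss q' as where "d = Transition q ss q' as False" "q < states M"
      "ss \<in> reads M" "(q', as) \<in> delta M q ss"
    | (idle) ss where "d = idle_transition ss" "ss \<in> reads M"
    unfolding transitions_def by blast
  then have "target d < states M \<and> length (actions d) = tapes M \<and>
    (\<forall>j<tapes M. fst (actions d ! j) < symbols M) \<and> reading d \<in> reads M \<and> source d < states M"
  proof cases
    case step
    then have actions: "q' < states M" "length as = tapes M" "\<forall>(s, m)\<in>set as. s < symbols M"
      using turing_machine unfolding turing_machine_def by blast+
    then have "fst (as ! j) < symbols M" if "j < tapes M" for j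
      using nth_mem[of j as] that by (cases "as ! j") auto
    with actions step show ?thesis by simp
  next
    case idle
    then show ?thesis using machine_bounds by (auto simp: reads_def idle_transition_def)
  qed
  then show "target d < states M" "length (actions d) = tapes M"
    "\<And>j. j < tapes M \<Longrightarrow> fst (actions d ! j) < symbols M"
    "reading d \<in> reads M" "source d < states M"
    by auto
qed

lemma well_formed_apply:
  "well_formed C \<Longrightarrow> d \<in> transitions \<Longrightarrow> well_formed (apply_transition d C)"
  using transition_bounds[of d] by (auto simp: well_formed_def apply_transition_def act_def)

lemma symbol_at_apply:
  assumes "well_formed C" "d \<in> transitions" "j < tapes M"
  shows "symbol_at (apply_transition d C) j i =
    (if i + head_offset d j = 0 then fst (actions d ! j) else symbol_at C j (i + head_offset d j))"
proof -
  have "j < length (snd C)" "j < length (actions d)"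
    using assms transition_bounds by (auto simp: well_formed_def)
  moreover have "snd (snd C ! j) + head_offset d j + i = snd (snd C ! j) \<longleftrightarrow> i + head_offset d j = 0"
    by auto
  ultimately show ?thesis
    by (auto simp: symbol_at_def apply_transition_def act_def head_offset_def algebra_simps)
qed

lemma step_if_enabled: "enabled d C \<Longrightarrow> \<not> idle d \<Longrightarrow> step M C (apply_transition d C)"
  by (fastforce simp: enabled_def transitions_def step_def apply_transition_def idle_transition_def)

lemma enabled_if_step:
  assumes "step M C C'" "well_formed C"
  shows "\<exists>d. enabled d C \<and> C' = apply_transition d C"
proof -
  from assms obtain q' as where
    step: "(q', as) \<in> delta M (fst C) (map read (snd C))" "C' = (q', map2 act (snd C) as)"
    by (auto simp: step_def)
  let ?d = "Transition (fst C) (map read (snd C)) q' as False"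
  have "enabled ?d C"
    using step assms map_read_in_reads by (auto simp: enabled_def transitions_def well_formed_def)
  with step show ?thesis by (intro exI[of _ ?d]) (simp add: apply_transition_def)
qed

lemma idle_if_halted:
  assumes "well_formed C" "halted M C" "fst C = 1"
  shows "enabled (idle_transition (map read (snd C))) C"
proof -
  have "delta M 1 (map read (snd C)) = {}" using assms(2,3) by (auto simp: halted_def step_def)
  then show ?thesis
    using assms map_read_in_reads by (auto simp: enabled_def transitions_def idle_transition_def)
qed

lemma apply_idle_transition:
  "fst C = 1 \<Longrightarrow> apply_transition (idle_transition (map read (snd C))) C = C"
  by (cases C) (auto simp: apply_transition_def idle_transition_def act_def read_def
      intro!: nth_equalityI)

lemma halted_if_idle:
  assumes "enabled d C" "idle d"
  shows "halted M C" "fst C = 1"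
  using assms by (auto simp: enabled_def transitions_def idle_transition_def halted_def step_def)

lemma run_if_accepts:
  assumes time: "\<And>t C. (step M ^^ t) (initial M x) C \<Longrightarrow> t \<le> N" and "accepts x"
  shows "\<exists>ds C. run N x ds C"
proof -
  from \<open>accepts x\<close> obtain T C' where "(step M ^^ T) (initial M x) C'" "halted M C'" "fst C' = 1"
    unfolding accepts_def by blast
  with time obtain Cs where Cs: "Cs 0 = initial M x" "Cs T = C'"
    "\<And>t. t < T \<Longrightarrow> step M (Cs t) (Cs (Suc t))" and "T \<le> N"
    unfolding relpowp_fun_conv by blast
  have well_formed_Cs: "t \<le> T \<Longrightarrow> well_formed (Cs t)" for t
  proof (induction t)
    case (Suc t)
    then show ?case using Cs(3)[of t] enabled_if_step well_formed_apply
      by (fastforce simp: enabled_def)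
  qed (simp add: Cs well_formed_initial)
  have "\<exists>d. enabled d (Cs t) \<and> Cs (Suc t) = apply_transition d (Cs t)" if "t < T" for t
    using enabled_if_step[OF Cs(3)[OF that]] well_formed_Cs that by simp
  then obtain ds where ds:
    "\<And>t. t < T \<Longrightarrow> enabled (ds t) (Cs t) \<and> Cs (Suc t) = apply_transition (ds t) (Cs t)"
    by metis
  let ?idle = "idle_transition (map read (snd C'))"
  have idle: "enabled ?idle C'" "apply_transition ?idle C' = C'" "idle ?idle"
    using idle_if_halted apply_idle_transition well_formed_Cs[of T] Cs(2) \<open>halted M C'\<close> \<open>fst C' = 1\<close>
    by (simp_all add: idle_transition_def)
  have "run N x (\<lambda>t. if t < T then ds t else ?idle) (\<lambda>t. Cs (min t T))"
    unfolding run_def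
  proof (intro conjI allI impI)
    fix t
    show "enabled (if t < T then ds t else ?idle) (Cs (min t T))"
      using ds idle Cs(2) by (simp add: min_def)
    show "Cs (min (Suc t) T) = apply_transition (if t < T then ds t else ?idle) (Cs (min t T))"
      using ds[of t] idle Cs(2) by (cases "t < T") (auto simp: min_def le_Suc_eq not_less)
  qed (use Cs idle \<open>T \<le> N\<close> in simp_all)
  then show ?thesis by blast
qed

lemma accepts_if_run:
  assumes run: "run N x ds C"
  shows "accepts x"
proof -
  define T where "T = (LEAST t. idle (ds t))"
  have T: "idle (ds T)" "T \<le> N"
    using run LeastI[of "\<lambda>t. idle (ds t)" N] Least_le[of "\<lambda>t. idle (ds t)" N]
    by (auto simp: run_def T_def)
  have "step M (C t) (C (Suc t))" if "t < T" for t
  proof -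
    have "\<not> idle (ds t)" using that not_less_Least unfolding T_def by blast
    then show ?thesis using run that T(2) step_if_enabled by (auto simp: run_def)
  qed
  then have "(step M ^^ T) (initial M x) (C T)"
    unfolding relpowp_fun_conv using run by (intro exI[of _ C]) (auto simp: run_def)
  moreover have "enabled (ds T) (C T)" using run T by (auto simp: run_def)
  ultimately show ?thesis using halted_if_idle T(1) unfolding accepts_def by blast
qed

end


subsection \<open>The tableau\<close>

datatype cell = Cell (at_head: bool) (scanned: "nat list") (applied: transition)

definition rewritten :: "cell \<Rightarrow> nat \<Rightarrow> nat" where
  "rewritten z j = (if at_head z then fst (actions (applied z) ! j) else scanned z ! j)"

context ntm
begin

definition cells :: "cell set" where
  "cells = {z. scanned z \<in> reads M \<and> applied z \<in> transitions \<and>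
     (at_head z \<longrightarrow> scanned z = reading (applied z))}"

definition cell_compatible :: "nat \<Rightarrow> cell \<Rightarrow> cell \<Rightarrow> bool" where
  "cell_compatible d z z' \<longleftrightarrow>
     (d = 1 \<longrightarrow> applied z = applied z') \<and>
     (d = 2 \<longrightarrow> at_head z = at_head z' \<and> (at_head z \<longrightarrow> target (applied z) = source (applied z')) \<and>
        (\<forall>j<tapes M. head_offset (applied z) j = 0 \<longrightarrow> scanned z' ! j = rewritten z j)) \<and>
     (d = 3 \<longrightarrow> (\<forall>j<tapes M. head_offset (applied z) j = - 1 \<longrightarrow> scanned z' ! j = rewritten z j)) \<and>
     (d = 4 \<longrightarrow> (\<forall>j<tapes M. head_offset (applied z') j = 1 \<longrightarrow> scanned z ! j = rewritten z' j))"

definition tableau :: "cell grid_problem" where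
  "tableau = \<lparr>cell_values = cells, compatible = cell_compatible,
     first_row = (\<lambda>m s z. at_head z = m \<and> scanned z = s # replicate (tapes M - 1) 0 \<and>
       source (applied z) = 0),
     accepting = (\<lambda>z. idle (applied z))\<rparr>"

lemma finite_transitions: "finite transitions"
proof (rule finite_subset)
  let ?As = "{as :: (nat \<times> move) list. set as \<subseteq> {..<symbols M} \<times> UNIV \<and> length as = tapes M}"
  let ?S = "{..<states M} \<times> reads M \<times> {..<states M} \<times> ?As \<times> (UNIV :: bool set)"
  show "transitions \<subseteq> (\<lambda>(q, ss, q', as, i). Transition q ss q' as i) ` ?S"
  proof
    fix d assume d: "d \<in> transitions"
    have "set (actions d) \<subseteq> {..<symbols M} \<times> UNIV"
      using transition_bounds(2,3)[OF d] by (auto simp: in_set_conv_nth) (metis fst_conv)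
    then have "(source d, reading d, target d, actions d, idle d) \<in> ?S"
      using transition_bounds[OF d] by simp
    then show "d \<in> (\<lambda>(q, ss, q', as, i). Transition q ss q' as i) ` ?S"
      by (rule rev_image_eqI) simp
  qed
  have "(UNIV :: move set) = {Left, Stay, Right}" using move.exhaust by auto
  then have "finite (UNIV :: move set)" by (metis finite.emptyI finite.insertI)
  then show "finite ((\<lambda>(q, ss, q', as, i). Transition q ss q' as i) ` ?S)"
    using finite_lists_length_eq[of "{..<symbols M} \<times> (UNIV :: move set)"] finite_reads by simp
qed

lemma finite_cells: "finite cells"
proof (rule finite_subset)
  show "cells \<subseteq> (\<lambda>(m, ss, d). Cell m ss d) ` (UNIV \<times> reads M \<times> transitions)"
  proof
    fix z assume "z \<in> cells"
    then have "(at_head z, scanned z, applied z) \<in> UNIV \<times> reads M \<times> transitions"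
      by (simp add: cells_def)
    then show "z \<in> (\<lambda>(m, ss, d). Cell m ss d) ` (UNIV \<times> reads M \<times> transitions)"
      by (rule rev_image_eqI) simp
  qed
qed (simp add: finite_reads finite_transitions)

lemma cells_nonempty: "cells \<noteq> {}"
proof -
  let ?ss = "replicate (tapes M) 0"
  have reads: "?ss \<in> reads M" using machine_bounds by (auto simp: reads_def)
  have "\<exists>d\<in>transitions. reading d = ?ss"
  proof (cases "delta M 1 ?ss = {}")
    case True
    then have "idle_transition ?ss \<in> transitions" using reads by (auto simp: transitions_def)
    then show ?thesis by (force simp: idle_transition_def)
  next
    case False
    then obtain q' as where "(q', as) \<in> delta M 1 ?ss" by auto
    then have "Transition 1 ?ss q' as False \<in> transitions"
      using reads machine_bounds by (auto simp: transitions_def)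
    then show ?thesis by force
  qed
  then obtain d where "d \<in> transitions" "reading d = ?ss" by blast
  then have "Cell True ?ss d \<in> cells" using reads by (simp add: cells_def)
  then show ?thesis by blast
qed

lemma symbol_at_initial:
  "j < tapes M \<Longrightarrow> symbol_at (initial M x) j i = (if j = 0 then contents x i else 0)"
  by (auto simp: symbol_at_def initial_def nth_Cons' contents_def)

lemma well_formed_run: "run N x ds C \<Longrightarrow> t \<le> Suc N \<Longrightarrow> well_formed (C t)"
proof (induction t)
  case (Suc t)
  then show ?case using well_formed_apply by (auto simp: run_def enabled_def)
qed (simp add: run_def well_formed_initial)

definition run_cell :: "nat \<Rightarrow> (nat \<Rightarrow> transition) \<Rightarrow> (nat \<Rightarrow> config) \<Rightarrow> nat \<Rightarrow> nat \<Rightarrow> cell" where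
  "run_cell N ds C t c = Cell (c = N) (map (\<lambda>j. symbol_at (C t) j (int c - int N)) [0..<tapes M])
     (ds t)"

lemma run_cell_simps [simp]:
  "at_head (run_cell N ds C t c) = (c = N)" "applied (run_cell N ds C t c) = ds t"
  by (simp_all add: run_cell_def)

lemma run_cell_in_cells:
  assumes run: "run N x ds C" and t: "t \<le> N"
  shows "run_cell N ds C t c \<in> cells"
  using well_formed_run[OF run, of t] run t map_read_eq[of "C t"]
  by (auto simp: run_cell_def cells_def run_def enabled_def reads_def symbol_at_less)

lemma scanned_run_cell_Suc:
  assumes run: "run N x ds C" and "t \<le> N" "j < tapes M"
    and c: "int c = int c' + head_offset (ds t) j"
  shows "scanned (run_cell N ds C (Suc t) c') ! j = rewritten (run_cell N ds C t c) j"
proof -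
  have "C (Suc t) = apply_transition (ds t) (C t)" "ds t \<in> transitions" "well_formed (C t)"
    using run assms(2) well_formed_run[OF run, of t] by (simp_all add: run_def enabled_def)
  moreover have "int c' - int N + head_offset (ds t) j = int c - int N" using c by simp
  ultimately have "symbol_at (C (Suc t)) j (int c' - int N) =
      (if int c - int N = 0 then fst (actions (ds t) ! j) else symbol_at (C t) j (int c - int N))"
    using assms(3) by (simp only: symbol_at_apply)
  then show ?thesis using assms(3) by (simp add: run_cell_def rewritten_def)
qed

lemma solution_if_run:
  assumes run: "run N x ds C"
  shows "grid_solution tableau N x (run_cell N ds C)"
proof -
  have "cell_compatible d (run_cell N ds C (t + src_row d) c)
      (run_cell N ds C (t + tgt_row d) (c + tgt_col d))"
    if "t < N" for t c d
  proof -
    have "target (ds t) = source (ds (Suc t))"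
      using run that by (simp add: run_def enabled_def apply_transition_def)
    then show ?thesis
      using that scanned_run_cell_Suc[OF run, of t _ c c]
        scanned_run_cell_Suc[OF run, of t _ c "Suc c"]
        scanned_run_cell_Suc[OF run, of t _ "Suc c" c]
      by (auto simp: cell_compatible_def direction_defs)
  qed
  moreover have "scanned (run_cell N ds C 0 c) = input_symbol N x c # replicate (tapes M - 1) 0"
    for c
    using run machine_bounds(1)
    by (intro nth_equalityI) (auto simp: run_cell_def run_def symbol_at_initial nth_Cons')
  moreover have "source (ds 0) = 0" using run by (auto simp: run_def enabled_def initial_def)
  ultimately show ?thesis
    using run_cell_in_cells[OF run] run
    by (simp add: grid_solution_def tableau_def run_def)
qed

context
  fixes N x v
  assumes solution: "grid_solution tableau N x v"
begin

definition row_transition :: "nat \<Rightarrow> transition" where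
  "row_transition t = applied (v t N)"

definition configuration :: "nat \<Rightarrow> config" where
  "configuration = rec_nat (initial M x) (\<lambda>t. apply_transition (row_transition t))"

lemma configuration_simps:
  "configuration 0 = initial M x"
  "configuration (Suc t) = apply_transition (row_transition t) (configuration t)"
  by (simp_all add: configuration_def)

lemma solution_in_cells:
  assumes "t \<le> N" "c \<le> 2 * N"
  shows "scanned (v t c) \<in> reads M" "applied (v t c) \<in> transitions"
    "at_head (v t c) \<Longrightarrow> scanned (v t c) = reading (applied (v t c))"
  using solution assms by (auto simp: grid_solution_def tableau_def cells_def)

lemma row_transition_in_transitions: "t \<le> N \<Longrightarrow> row_transition t \<in> transitions"
  by (simp add: row_transition_def solution_in_cells)

lemma solution_compatible:
  assumes "t < N" "c < 2 * N" "d \<in> {1..4}"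
  shows "cell_compatible d (v (t + src_row d) c) (v (t + tgt_row d) (c + tgt_col d))"
  using solution assms by (simp add: grid_solution_def tableau_def)

lemma applied_eq_row_transition:
  assumes t: "t < N" and c: "c \<le> 2 * N"
  shows "applied (v t c) = row_transition t"
proof -
  have "applied (v t c) = applied (v t 0)" if "c \<le> 2 * N" for c
    using that
  proof (induction c)
    case (Suc c)
    then show ?case using solution_compatible[OF t, of c 1]
      by (simp add: cell_compatible_def direction_defs)
  qed simp
  from this[OF c] this[of N] show ?thesis by (simp add: row_transition_def)
qed

lemma at_head_Suc:
  assumes "t < N" "c < 2 * N"
  shows "at_head (v (Suc t) c) = at_head (v t c)"
    "at_head (v t c) \<Longrightarrow> target (applied (v t c)) = source (applied (v (Suc t) c))"
  using solution_compatible[OF assms, of 2] by (simp_all add: cell_compatible_def direction_defs)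

lemma scanned_Suc:
  assumes t: "t < N" and c: "0 < c" "c < 2 * N" and j: "j < tapes M"
    and c': "int c' = int c + head_offset (row_transition t) j"
  shows "scanned (v (Suc t) c) ! j = rewritten (v t c') j"
proof -
  have applied: "applied (v t c) = row_transition t" "applied (v t (c - 1)) = row_transition t"
    "applied (v t (Suc c)) = row_transition t"
    using applied_eq_row_transition[OF t] c by simp_all
  have compatible: "cell_compatible 2 (v t c) (v (Suc t) c)"
    "cell_compatible 3 (v t (c - 1)) (v (Suc t) c)" "cell_compatible 4 (v (Suc t) c) (v t (Suc c))"
    using solution_compatible[OF t, of c 2] solution_compatible[OF t, of "c - 1" 3]
      solution_compatible[OF t, of c 4] c
    by (simp_all add: direction_defs)
  have "head_offset (row_transition t) j \<in> {0, - 1, 1}"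
    unfolding head_offset_def by (cases "snd (actions (row_transition t) ! j)") auto
  then consider "head_offset (row_transition t) j = 0" "c' = c"
    | "head_offset (row_transition t) j = - 1" "c' = c - 1"
    | "head_offset (row_transition t) j = 1" "c' = Suc c"
    using c' by force
  then show ?thesis
    using compatible j applied by cases (simp_all add: cell_compatible_def)
qed

text \<open>Since each step loses a column at either side, the statement covers only a triangle.\<close>

definition faithful :: "nat \<Rightarrow> bool" where
  "faithful t \<longleftrightarrow> well_formed (configuration t) \<and> fst (configuration t) = source (row_transition t) \<and>
     (\<forall>c. t \<le> c \<and> c + t \<le> 2 * N \<longrightarrow> at_head (v t c) = (c = N) \<and>
        (\<forall>j<tapes M. scanned (v t c) ! j = symbol_at (configuration t) j (int c - int N)))"

lemma faithful_0: "faithful 0"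
proof -
  have first: "at_head (v 0 c) = (c = N)"
    "scanned (v 0 c) = input_symbol N x c # replicate (tapes M - 1) 0"
      "source (applied (v 0 c)) = 0"
    if "c \<le> 2 * N" for c
    using solution that by (simp_all add: grid_solution_def tableau_def)
  then have "source (row_transition 0) = 0" by (simp add: row_transition_def)
  moreover have "fst (initial M x) = 0" by (simp add: initial_def)
  ultimately show ?thesis
    using first well_formed_initial
    by (simp add: faithful_def configuration_simps symbol_at_initial nth_Cons')
qed

lemma faithful_Suc:
  assumes t: "t < N" and "faithful t"
  shows "faithful (Suc t)"
proof -
  have d: "row_transition t \<in> transitions" and wf: "well_formed (configuration t)"
    and head: "\<And>c. t \<le> c \<Longrightarrow> c + t \<le> 2 * N \<Longrightarrow> at_head (v t c) = (c = N)"
    and scanned: "\<And>c j. t \<le> c \<Longrightarrow> c + t \<le> 2 * N \<Longrightarrow> j < tapes M \<Longrightarrow>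
      scanned (v t c) ! j = symbol_at (configuration t) j (int c - int N)"
    using assms row_transition_in_transitions[of t] by (auto simp: faithful_def)
  have "scanned (v (Suc t) c) ! j = symbol_at (configuration (Suc t)) j (int c - int N)"
    if c: "Suc t \<le> c" "c + Suc t \<le> 2 * N" and j: "j < tapes M" for c j
  proof -
    have "head_offset (row_transition t) j \<in> {0, - 1, 1}"
      unfolding head_offset_def by (cases "snd (actions (row_transition t) ! j)") auto
    then obtain c' where c': "int c' = int c + head_offset (row_transition t) j" "t \<le> c'"
      "c' + t \<le> 2 * N"
      using c by (intro that[of "nat (int c + head_offset (row_transition t) j)"]) auto
    then have distance: "int c - int N + head_offset (row_transition t) j = int c' - int N" by simp
    have "symbol_at (configuration (Suc t)) j (int c - int N) = rewritten (v t c') j"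
      using head[OF c'(2,3)] scanned[OF c'(2,3) j] applied_eq_row_transition[OF t, of c'] c'(3)
      unfolding configuration_simps symbol_at_apply[OF wf d j] distance
      by (auto simp: rewritten_def)
    then show ?thesis using scanned_Suc[OF t _ _ j c'(1)] c by simp
  qed
  moreover have "at_head (v (Suc t) c) = (c = N)" if "Suc t \<le> c" "c + Suc t \<le> 2 * N" for c
    using at_head_Suc(1)[OF t, of c] head[of c] that by simp
  moreover have "fst (configuration (Suc t)) = source (row_transition (Suc t))"
    using at_head_Suc(2)[OF t, of N] head[of N] t
    by (simp add: configuration_simps apply_transition_def row_transition_def)
  ultimately show ?thesis
    using well_formed_apply[OF wf d] by (simp add: faithful_def configuration_simps)
qed

lemma faithful: "t \<le> N \<Longrightarrow> faithful t"
  by (induction t) (simp_all add: faithful_0 faithful_Suc)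

lemma run_if_solution: "run N x row_transition configuration"
proof -
  have "enabled (row_transition t) (configuration t)" if t: "t \<le> N" for t
  proof -
    have wf: "well_formed (configuration t)" and head: "at_head (v t N)"
      and scanned: "\<And>j. j < tapes M \<Longrightarrow> scanned (v t N) ! j = symbol_at (configuration t) j 0"
      using faithful[OF t] t by (auto simp: faithful_def)
    have "scanned (v t N) = map read (snd (configuration t))"
      using solution_in_cells(1)[of t N] t scanned
      unfolding map_read_eq[OF wf] by (intro nth_equalityI) (auto simp: reads_def)
    then show ?thesis
      using faithful[OF t] head t solution_in_cells(3)[of t N] row_transition_in_transitions[OF t]
      by (simp add: enabled_def faithful_def row_transition_def)
  qed
  moreover have "idle (row_transition N)"
    using solution by (simp add: grid_solution_def tableau_def row_transition_def)
  ultimately show ?thesis by (simp add: run_def configuration_simps)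
qed

end

theorem accepts_iff_tableau_solvable:
  assumes "\<And>t C. (step M ^^ t) (initial M x) C \<Longrightarrow> t \<le> N"
  shows "accepts x \<longleftrightarrow> grid_solvable tableau N x"
proof
  assume "accepts x"
  then obtain ds C where "run N x ds C" using run_if_accepts[of x N] assms by blast
  then show "grid_solvable tableau N x"
    unfolding grid_solvable_def by (blast intro: solution_if_run)
next
  assume "grid_solvable tableau N x"
  then obtain v where "grid_solution tableau N x v" unfolding grid_solvable_def by blast
  then show "accepts x" by (rule accepts_if_run[OF run_if_solution])
qed

end

lemma poly_le_power:
  fixes p :: "nat poly"
  shows "\<exists>e\<ge>1. \<forall>n. poly p n \<le> (n + e) ^ e"
proof (induction p)
  case 0
  then show ?case by (auto intro!: exI[of _ 1])
next
  case (pCons a p)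
  then obtain e where e: "e \<ge> 1" "\<And>n. poly p n \<le> (n + e) ^ e" by blast
  let ?e = "e + a + 1"
  have "poly (pCons a p) n \<le> (n + ?e) ^ ?e" for n
  proof -
    have "poly (pCons a p) n \<le> a * 1 + n * (n + e) ^ e" using e(2)[of n] by simp
    also have "\<dots> \<le> a * (n + e) ^ e + n * (n + e) ^ e"
      using e(1) by (intro add_mono mult_left_mono) simp_all
    also have "\<dots> = (n + a) * (n + e) ^ e" by (simp add: algebra_simps)
    also have "\<dots> \<le> (n + ?e) * (n + ?e) ^ e" by (intro mult_mono power_mono) auto
    also have "\<dots> = (n + ?e) ^ (e + 1)" by simp
    also have "\<dots> \<le> (n + ?e) ^ ?e" by (rule power_increasing) auto
    finally show ?thesis .
  qed
  then show ?case by (intro exI[of _ ?e]) auto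
qed

theorem NP_as_grid_problem:
  assumes "L \<in> NP"
  obtains P :: "nat grid_problem" and A e where "A \<ge> 1" "cell_values P = {..<A}" "e \<ge> 1"
    "\<And>x. x \<in> L \<longleftrightarrow> grid_solvable P ((length x + e) ^ e) x"
proof -
  from assms obtain M p where M: "turing_machine M"
    and time: "\<And>x t C. (step M ^^ t) (initial M x) C \<Longrightarrow> t \<le> poly p (length x)"
    and L: "\<And>x. x \<in> L \<longleftrightarrow> (\<exists>t C. (step M ^^ t) (initial M x) C \<and> halted M C \<and> fst C = 1)"
    unfolding NP_def by blast
  interpret ntm M by unfold_locales (rule M)
  obtain e where e: "e \<ge> 1" "\<And>n. poly p n \<le> (n + e) ^ e" using poly_le_power by blast
  obtain zs where zs: "set zs = cells" using finite_list[OF finite_cells] by blast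
  define P where "P = pullback ((!) zs) {..<length zs} tableau"
  have "cell_values tableau = (!) zs ` {..<length zs}"
    by (simp add: tableau_def lessThan_atLeast0 nth_image zs)
  then have "grid_solvable P N x \<longleftrightarrow> grid_solvable tableau N x" for N x
    unfolding P_def by (rule grid_solvable_pullback)
  moreover have "x \<in> L \<longleftrightarrow> grid_solvable tableau ((length x + e) ^ e) x" for x
    unfolding L accepts_def[symmetric]
    by (rule accepts_iff_tableau_solvable) (use time e(2) le_trans in blast)
  moreover have "length zs \<ge> 1" using cells_nonempty zs by (cases zs) auto
  moreover have "cell_values P = {..<length zs}" by (simp add: P_def pullback_def)
  ultimately show thesis using that[of "length zs" P e] e(1) by simp
qed


section \<open>The instances\<close>

subsection \<open>Vertex names\<close>

fun binary_value :: "bool list \<Rightarrow> nat" where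
  "binary_value [] = 0"
| "binary_value (b # bs) = of_bool b + 2 * binary_value bs"

lemma binary_value_pos: "bs \<noteq> [] \<Longrightarrow> last bs \<Longrightarrow> binary_value bs > 0"
  by (induction bs) (auto split: if_splits)

lemma binary_binary_value: "bs = [] \<or> last bs \<Longrightarrow> binary (binary_value bs) = bs"
proof (induction bs)
  case Nil
  then show ?case by (simp add: binary.simps)
next
  case (Cons b bs)
  then have "binary_value (b # bs) > 0" by (intro binary_value_pos) auto
  moreover have "odd (binary_value (b # bs)) = b" "binary_value (b # bs) div 2 = binary_value bs"
    by auto
  moreover have "binary (binary_value bs) = bs" using Cons by (auto split: if_splits)
  ultimately show ?case using binary.simps[of "binary_value (b # bs)"] by simp
qed

definition name_bits :: "nat \<Rightarrow> nat \<Rightarrow> nat \<Rightarrow> bool list" where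
  "name_bits t c z = replicate t True @ False # replicate c True @ False # replicate (Suc z) True"

definition name :: "nat \<Rightarrow> nat \<Rightarrow> nat \<Rightarrow> nat" where
  "name t c z = binary_value (name_bits t c z)"

lemma binary_name: "binary (name t c z) = name_bits t c z"
  unfolding name_def by (rule binary_binary_value) (simp add: name_bits_def del: replicate_Suc)

lemma replicate_True_False_eq_iff:
  "replicate m True @ False # u = replicate n True @ False # v \<longleftrightarrow> m = n \<and> u = v"
proof (induction m arbitrary: n)
  case 0
  then show ?case by (cases n) auto
next
  case (Suc m)
  then show ?case by (cases n) auto
qed

lemma name_eq_iff [simp]: "name t c z = name t' c' z' \<longleftrightarrow> t = t' \<and> c = c' \<and> z = z'"
proof
  assume "name t c z = name t' c' z'"
  then have "name_bits t c z = name_bits t' c' z'" by (metis binary_name)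
  then show "t = t' \<and> c = c' \<and> z = z'"
    by (auto simp: name_bits_def replicate_True_False_eq_iff simp del: replicate_Suc
        dest: arg_cong[of _ _ length])
qed simp

definition triple_encode :: "nat \<Rightarrow> nat \<Rightarrow> nat \<Rightarrow> nat" where
  "triple_encode a p r = prod_encode (a, prod_encode (p, r))"

lemma triple_encode_eq_iff [simp]:
  "triple_encode a p r = triple_encode a' p' r' \<longleftrightarrow> a = a' \<and> p = p' \<and> r = r'"
  by (simp add: triple_encode_def)

fun tail_name :: "(nat \<times> nat) \<times> nat \<times> nat \<Rightarrow> nat \<Rightarrow> nat" where
  "tail_name ((t, c), a, p) r = name t c (triple_encode a p r)"

lemma tail_name_eq_iff: "tail_name x r = tail_name y s \<longleftrightarrow> x = y \<and> r = s"
  by (cases "(x, r)" rule: tail_name.cases; cases "(y, s)" rule: tail_name.cases) auto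


subsection \<open>Templates\<close>

text \<open>Vertices and edges are described relative to a cell of the grid.\<close>

type_synonym template = "nat \<times> nat \<times> nat"

definition place :: "nat \<Rightarrow> nat \<Rightarrow> template \<Rightarrow> nat" where
  "place t c = (\<lambda>(dt, dc, z). name (t + dt) (c + dc) z)"

definition place_edge :: "nat \<Rightarrow> nat \<Rightarrow> template \<times> template \<Rightarrow> nat \<times> nat" where
  "place_edge t c = map_prod (place t c) (place t c)"

definition grid_list :: "nat \<Rightarrow> nat \<Rightarrow> (nat \<Rightarrow> nat \<Rightarrow> 'a list) \<Rightarrow> 'a list" where
  "grid_list n m h = concat (map (\<lambda>t. concat (map (h t) [0..<m])) [0..<n])"

lemma grid_list_Nil: "grid_list n m (\<lambda>t c. []) = []"
  by (simp add: grid_list_def)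

lemma set_grid_list_map:
  "set (grid_list n m (\<lambda>t c. map (f t c) xs)) = {f t c e | t c e. t < n \<and> c < m \<and> e \<in> set xs}"
  by (force simp: grid_list_def)

lemma set_grid_list_map_append:
  "set (grid_list n m (\<lambda>t c. map (f t c) (xs @ ys))) =
     set (grid_list n m (\<lambda>t c. map (f t c) xs)) \<union> set (grid_list n m (\<lambda>t c. map (f t c) ys))"
  unfolding set_grid_list_map by auto

locale grid_reduction =
  fixes P :: "nat grid_problem" and A l \<Delta> :: nat
  assumes A_pos: "A \<ge> 1" and cell_values: "cell_values P = {..<A}" and l: "l \<ge> 4" and \<Delta>: "\<Delta> \<ge> 4"
begin

inductive conflict :: "nat \<Rightarrow> bool list \<Rightarrow> nat \<Rightarrow> nat \<times> nat \<Rightarrow> nat \<Rightarrow> nat \<times> nat \<Rightarrow> nat \<Rightarrow> bool"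
  for N x where
  two_values: "t \<le> N \<Longrightarrow> c \<le> 2 * N \<Longrightarrow> a < A \<Longrightarrow> b < A \<Longrightarrow> a \<noteq> b \<Longrightarrow> conflict N x 0 (t, c) a (t, c) b"
| incompatible: "d \<in> {1..4} \<Longrightarrow> t < N \<Longrightarrow> c < 2 * N \<Longrightarrow> a < A \<Longrightarrow> b < A \<Longrightarrow> \<not> compatible P d a b \<Longrightarrow>
    conflict N x d (t + src_row d, c) a (t + tgt_row d, c + tgt_col d) b"
| bad_first_row: "c \<le> 2 * N \<Longrightarrow> a < A \<Longrightarrow> \<not> first_row P (c = N) (input_symbol N x c) a \<Longrightarrow>
    conflict N x 0 (0, c) a (0, c) a"
| not_accepting: "a < A \<Longrightarrow> \<not> accepting P a \<Longrightarrow> conflict N x 0 (N, N) a (N, N) a"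

lemma conflict_direction:
  assumes "conflict N x d v a w b"
  obtains t c where "v = (t + src_row d, c)" "w = (t + tgt_row d, c + tgt_col d)"
  using assms by cases (auto simp: direction_defs)

abbreviation grid :: "nat \<Rightarrow> (nat \<times> nat) set" where
  "grid N \<equiv> {..N} \<times> {..2 * N}"

sublocale csp: directed_csp "grid N" A 5 "conflict N x" for N x
proof
  show "d < 5 \<and> v \<in> grid N \<and> w \<in> grid N \<and> a < A \<and> b < A" if "conflict N x d v a w b" for d v a w b
    using that by cases (auto simp: direction_defs)
  show "conflict N x 0 v a v b" if "v \<in> grid N" "a < A" "b < A" "a \<noteq> b" for v a b
    using that by (auto intro: two_values)
  show "w = w'" if "conflict N x d v a w b" "conflict N x d v a' w' b'" for d v a w b a' w' b'
    using that by (auto elim!: conflict_direction)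
  show "v = v'" if "conflict N x d v a w b" "conflict N x d v' a' w b'" for d v a w b v' a' b'
    using that by (auto elim!: conflict_direction)
qed (use A_pos in auto)

lemma solvable_iff_grid_solvable: "csp.solvable N x \<longleftrightarrow> grid_solvable P N x"
proof
  assume "csp.solvable N x"
  then obtain f where f: "\<forall>v\<in>grid N. f v < A" "\<And>d v w. \<not> conflict N x d v (f v) w (f w)"
    unfolding csp.solvable_def by blast
  have "grid_solution P N x (\<lambda>t c. f (t, c))"
    unfolding grid_solution_def
  proof (intro conjI ballI allI impI)
    show "compatible P d (f (t + src_row d, c)) (f (t + tgt_row d, c + tgt_col d))"
      if "d \<in> {1..4}" "t < N" "c < 2 * N" for d t c
    proof (rule ccontr)
      have "f (t + src_row d, c) < A" "f (t + tgt_row d, c + tgt_col d) < A"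
        using f(1) that direction_bounds[of d] by simp_all
      moreover assume "\<not> compatible P d (f (t + src_row d, c)) (f (t + tgt_row d, c + tgt_col d))"
      ultimately show False using f(2) incompatible[OF that] by blast
    qed
    show "first_row P (c = N) (input_symbol N x c) (f (0, c))" if "c \<le> 2 * N" for c
      using f(1) f(2)[of 0 "(0, c)" "(0, c)"] bad_first_row[OF that, of "f (0, c)" x] that by auto
    show "accepting P (f (N, N))"
      using f(1) f(2)[of 0 "(N, N)" "(N, N)"] not_accepting[of "f (N, N)" N x] by auto
  qed (use f cell_values in auto)
  then show "grid_solvable P N x" by (auto simp: grid_solvable_def)
next
  assume "grid_solvable P N x"
  then obtain v where v: "grid_solution P N x v" by (auto simp: grid_solvable_def)
  have "\<not> conflict N x d p (case_prod v p) q (case_prod v q)" for d p q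
  proof
    assume "conflict N x d p (case_prod v p) q (case_prod v q)"
    then show False by cases (use v in \<open>auto simp: grid_solution_def\<close>)
  qed
  moreover have "\<forall>p\<in>grid N. case_prod v p < A" using v cell_values by (auto simp: grid_solution_def)
  ultimately show "csp.solvable N x" unfolding csp.solvable_def by blast
qed

definition star_name :: "nat \<Rightarrow> nat" where
  "star_name i = name 0 0 (triple_encode A 0 i)"

sublocale cover: cover_graph "csp.nodes N" "csp.copy_edges N \<union> csp.conflict_edges N x" csp.color
  tail_name star_name l \<Delta> for N x
proof (rule csp.cover_graph_nodes[OF l \<Delta>])
  show "star_name i \<noteq> tail_name u r" if "u \<in> csp.nodes N" for u r i
    using that by (cases "(u, r)" rule: tail_name.cases) (auto simp: star_name_def csp.nodes_def)
qed (auto simp: tail_name_eq_iff star_name_def)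

definition conflict_template :: "nat \<Rightarrow> nat \<Rightarrow> nat \<Rightarrow> template \<times> template" where
  "conflict_template d a b =
     ((src_row d, 0, triple_encode a (csp.out_port d b) 0),
      (tgt_row d, tgt_col d, triple_encode b (csp.in_port d a) 0))"

definition vertex_templates :: "template list" where
  "vertex_templates =
     [(0, 0, triple_encode a p r). a \<leftarrow> [0..<A], p \<leftarrow> [0..<Suc (2 * csp.half)], r \<leftarrow> [0..<l - 2]]"

definition tail_templates :: "nat \<Rightarrow> (template \<times> template) list" where
  "tail_templates i = [((0, 0, triple_encode a p r), (0, 0, triple_encode a p (Suc r))).
     a \<leftarrow> [0..<A], p \<leftarrow> [0..<Suc (2 * csp.half)], r \<leftarrow> [0..<l - 3],
     cover.tail_color ((0, 0), a, p) r = i]"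

definition copy_templates :: "nat \<Rightarrow> (template \<times> template) list" where
  "copy_templates i = [((0, 0, triple_encode a p 0), (0, 0, triple_encode a (Suc p) 0)).
     a \<leftarrow> [0..<A], p \<leftarrow> [0..<2 * csp.half], cover.third ((0, 0), a, p) ((0, 0), a, Suc p) = i]"

definition two_values_templates :: "(template \<times> template) list" where
  "two_values_templates = [conflict_template 0 a b. a \<leftarrow> [0..<A], b \<leftarrow> [0..<A], a \<noteq> b]"

definition incompatible_templates :: "(template \<times> template) list" where
  "incompatible_templates =
     [conflict_template d a b. d \<leftarrow> [1..<5], a \<leftarrow> [0..<A], b \<leftarrow> [0..<A], \<not> compatible P d a b]"

definition unary_templates :: "(nat \<Rightarrow> bool) \<Rightarrow> (template \<times> template) list" where
  "unary_templates Q = [conflict_template 0 a a. a \<leftarrow> [0..<A], \<not> Q a]"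

definition cell_templates :: "nat \<Rightarrow> (template \<times> template) list" where
  "cell_templates i = tail_templates i @ copy_templates i @
     (if i = 2 then two_values_templates else [])"

definition star_vertices :: "nat list" where
  "star_vertices = map star_name [0..<Suc \<Delta>]"

definition star_edges :: "(nat \<times> nat) list" where
  "star_edges = map (\<lambda>j. (star_name 0, star_name (Suc j))) [0..<\<Delta>]"

definition first_row_edges :: "nat \<Rightarrow> bool list \<Rightarrow> (nat \<times> nat) list" where
  "first_row_edges N x = concat (map (\<lambda>c. map (place_edge 0 c)
     (unary_templates (first_row P (c = N) (input_symbol N x c)))) [0..<Suc (2 * N)])"

definition vertex_list :: "nat \<Rightarrow> nat list" where
  "vertex_list N =
     grid_list (Suc N) (Suc (2 * N)) (\<lambda>t c. map (place t c) vertex_templates) @ star_vertices"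

definition class_list :: "nat \<Rightarrow> bool list \<Rightarrow> nat \<Rightarrow> (nat \<times> nat) list" where
  "class_list N x i =
     grid_list (Suc N) (Suc (2 * N)) (\<lambda>t c. map (place_edge t c) (cell_templates i)) @
     (if i = 0 then star_edges else []) @
     (if i = 2 then
        grid_list N (2 * N) (\<lambda>t c. map (place_edge t c) incompatible_templates) @
        first_row_edges N x @ map (place_edge N N) (unary_templates (accepting P))
      else [])"

definition instance_of :: "nat \<Rightarrow> bool list \<Rightarrow> inst" where
  "instance_of N x = (vertex_list N, map (class_list N x) [0..<l - 1], csp.budget N)"


subsection \<open>Correctness\<close>

lemma place_edge_conflict_template:
  "place_edge t c (conflict_template d a b) =
     (tail_name ((t + src_row d, c), a, csp.out_port d b) 0,
      tail_name ((t + tgt_row d, c + tgt_col d), b, csp.in_port d a) 0)"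
  by (simp add: place_edge_def conflict_template_def place_def)

lemma set_vertex_templates:
  "set vertex_templates =
     {(0, 0, triple_encode a p r) | a p r. a < A \<and> p < Suc (2 * csp.half) \<and> r < l - 2}"
  by (force simp: vertex_templates_def simp del: upt_Suc)

lemma set_tail_templates:
  "set (tail_templates i) =
     {((0, 0, triple_encode a p r), (0, 0, triple_encode a p (Suc r))) | a p r.
        a < A \<and> p < Suc (2 * csp.half) \<and> r < l - 3 \<and> cover.tail_color ((0, 0), a, p) r = i}"
  by (force simp: tail_templates_def simp del: upt_Suc split: if_splits)

lemma set_copy_templates:
  "set (copy_templates i) =
     {((0, 0, triple_encode a p 0), (0, 0, triple_encode a (Suc p) 0)) | a p.
        a < A \<and> p < 2 * csp.half \<and> cover.third ((0, 0), a, p) ((0, 0), a, Suc p) = i}"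
  by (force simp: copy_templates_def split: if_splits)

lemma set_two_values_templates:
  "set two_values_templates = {conflict_template 0 a b | a b. a < A \<and> b < A \<and> a \<noteq> b}"
  by (force simp: two_values_templates_def split: if_splits)

lemma set_incompatible_templates:
  "set incompatible_templates =
     {conflict_template d a b | d a b. d \<in> {1..4} \<and> a < A \<and> b < A \<and> \<not> compatible P d a b}"
  by (force simp: incompatible_templates_def split: if_splits)

lemma set_unary_templates:
  "set (unary_templates Q) = {conflict_template 0 a a | a. a < A \<and> \<not> Q a}"
  by (auto simp: unary_templates_def)

lemma set_first_row_edges:
  "set (first_row_edges N x) = {place_edge 0 c (conflict_template 0 a a) | c a.
     c \<le> 2 * N \<and> a < A \<and> \<not> first_row P (c = N) (input_symbol N x c) a}"
  unfolding first_row_edges_def set_concat set_map set_upt set_unary_templates image_image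
  by (force simp: less_Suc_eq_le)

lemma grid_colors:
  "cover.tail_color (v, a, p) r = (if r = 0 then csp.position_color p else r + 2)"
  "cover.third (v, a, p) (w, b, q) = 3 - (csp.position_color p + csp.position_color q)"
  unfolding cover.tail_color_def cover.third_def by (simp_all add: csp.color_def)

lemma set_vertex_list: "set (vertex_list N) = verts (cover.graph N x)"
proof -
  have "set (grid_list (Suc N) (Suc (2 * N)) (\<lambda>t c. map (place t c) vertex_templates)) =
      {tail_name u r | u r. u \<in> csp.nodes N \<and> r < l - 2}" (is "?L = ?R")
  proof -
    have "?L = {tail_name ((t, c), a, p) r | t c a p r.
        t < Suc N \<and> c < Suc (2 * N) \<and> a < A \<and> p < Suc (2 * csp.half) \<and> r < l - 2}"
      unfolding set_grid_list_map set_vertex_templates by (force simp: place_def)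
    also have "\<dots> = ?R" by (auto simp: csp.nodes_def less_Suc_eq_le)
    finally show ?thesis .
  qed
  moreover have "set star_vertices = star_name ` {..\<Delta>}"
    by (simp only: star_vertices_def set_map set_upt atLeast0LessThan lessThan_Suc_atMost)
  ultimately show ?thesis by (simp add: vertex_list_def cover.graph_def)
qed

lemma set_tail_edges:
  "set (grid_list (Suc N) (Suc (2 * N)) (\<lambda>t c. map (place_edge t c) (tail_templates i))) =
     {(tail_name u r, tail_name u (Suc r)) | u r. u \<in> csp.nodes N \<and> r < l - 3 \<and>
       cover.tail_color u r = i}"
  (is "?L = ?R")
proof -
  have "?L = {(tail_name ((t, c), a, p) r, tail_name ((t, c), a, p) (Suc r)) | t c a p r.
      t < Suc N \<and> c < Suc (2 * N) \<and> a < A \<and> p < Suc (2 * csp.half) \<and> r < l - 3 \<and>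
      cover.tail_color ((0, 0), a, p) r = i}"
    unfolding set_grid_list_map set_tail_templates by (force simp: place_edge_def place_def)
  also have "\<dots> = ?R"
    unfolding csp.nodes_def by (force simp: less_Suc_eq_le grid_colors split del: if_split)
  finally show ?thesis .
qed

lemma set_copy_edges:
  "set (grid_list (Suc N) (Suc (2 * N)) (\<lambda>t c. map (place_edge t c) (copy_templates i))) =
     {(tail_name u 0, tail_name v 0) | u v. (u, v) \<in> csp.copy_edges N \<and> cover.third u v = i}"
  (is "?L = ?R")
proof -
  have "?L = {(tail_name ((t, c), a, p) 0, tail_name ((t, c), a, Suc p) 0) | t c a p.
      t < Suc N \<and> c < Suc (2 * N) \<and> a < A \<and> p < 2 * csp.half \<and>
      cover.third ((0, 0), a, p) ((0, 0), a, Suc p) = i}"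
    unfolding set_grid_list_map set_copy_templates by (force simp: place_edge_def place_def)
  also have "\<dots> = ?R"
    unfolding csp.copy_edges_def by (force simp: less_Suc_eq_le grid_colors)
  finally show ?thesis .
qed

definition conflict_list :: "nat \<Rightarrow> bool list \<Rightarrow> (nat \<times> nat) list" where
  "conflict_list N x =
     grid_list (Suc N) (Suc (2 * N)) (\<lambda>t c. map (place_edge t c) two_values_templates) @
     grid_list N (2 * N) (\<lambda>t c. map (place_edge t c) incompatible_templates) @
     first_row_edges N x @ map (place_edge N N) (unary_templates (accepting P))"

lemma set_conflict_list_subset:
  "set (conflict_list N x) \<subseteq> {(tail_name u 0, tail_name v 0) | u v.
     (u, v) \<in> csp.conflict_edges N x}"
  (is "_ \<subseteq> ?R")
proof -
  have placed: "place_edge t c (conflict_template d a b) \<in> ?R"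
    if "conflict N x d (t + src_row d, c) a (t + tgt_row d, c + tgt_col d) b" for t c d a b
    using that unfolding csp.conflict_edges_def place_edge_conflict_template by blast
  have "set (grid_list (Suc N) (Suc (2 * N))
      (\<lambda>t c. map (place_edge t c) two_values_templates)) \<subseteq> ?R"
    unfolding set_grid_list_map set_two_values_templates
    using placed[where d = 0] two_values by (fastforce simp: direction_defs)
  moreover have "set (grid_list N (2 * N) (\<lambda>t c. map (place_edge t c) incompatible_templates)) \<subseteq> ?R"
    unfolding set_grid_list_map set_incompatible_templates using placed incompatible by blast
  moreover have "set (first_row_edges N x) \<subseteq> ?R"
    unfolding set_first_row_edges
    using placed[of 0 0] bad_first_row by (fastforce simp: direction_defs)
  moreover have "set (map (place_edge N N) (unary_templates (accepting P))) \<subseteq> ?R"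
    unfolding set_map set_unary_templates
    using placed[of 0 N N] not_accepting by (fastforce simp: direction_defs)
  ultimately show ?thesis by (simp add: conflict_list_def)
qed

lemma conflict_in_conflict_list:
  assumes "conflict N x d v a w b"
  shows "(tail_name (v, a, csp.out_port d b) 0, tail_name (w, b, csp.in_port d a) 0)
    \<in> set (conflict_list N x)"
  using assms
proof cases
  case (two_values t c)
  then have "place_edge t c (conflict_template 0 a b) \<in>
      set (grid_list (Suc N) (Suc (2 * N)) (\<lambda>t c. map (place_edge t c) two_values_templates))"
    unfolding set_grid_list_map set_two_values_templates less_Suc_eq_le by blast
  then show ?thesis
    using two_values by (simp add: conflict_list_def place_edge_conflict_template direction_defs)
next
  case (incompatible t c)
  then have "place_edge t c (conflict_template d a b) \<in>
      set (grid_list N (2 * N) (\<lambda>t c. map (place_edge t c) incompatible_templates))"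
    unfolding set_grid_list_map set_incompatible_templates by blast
  then show ?thesis using incompatible by (simp add: conflict_list_def place_edge_conflict_template)
next
  case (bad_first_row c)
  then have "place_edge 0 c (conflict_template 0 a a) \<in> set (first_row_edges N x)"
    unfolding set_first_row_edges by blast
  then show ?thesis
    using bad_first_row by (simp add: conflict_list_def place_edge_conflict_template direction_defs)
next
  case not_accepting
  then have "place_edge N N (conflict_template 0 a a) \<in>
      set (map (place_edge N N) (unary_templates (accepting P)))"
    unfolding set_map set_unary_templates by force
  then show ?thesis
    using not_accepting by (simp add: conflict_list_def place_edge_conflict_template direction_defs)
qed

lemma set_conflict_list:
  "set (conflict_list N x) =
     {(tail_name u 0, tail_name v 0) | u v. (u, v) \<in> csp.conflict_edges N x}"
  using set_conflict_list_subset conflict_in_conflict_list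
  by (fastforce simp: csp.conflict_edges_def)

lemma third_conflict_edge: "(u, v) \<in> csp.conflict_edges N x \<Longrightarrow> cover.third u v = 2"
  unfolding cover.third_def csp.conflict_edges_def
  by (auto simp: csp.color_def csp.out_port_colors csp.in_port_colors dest: csp.conflict_range)

lemma set_class_list: "set (class_list N x i) = cover.class_pairs N x i"
proof -
  have "{(tail_name u 0, tail_name v 0) | u v.
      (u, v) \<in> csp.copy_edges N \<union> csp.conflict_edges N x \<and> cover.third u v = i} =
    {(tail_name u 0, tail_name v 0) | u v. (u, v) \<in> csp.copy_edges N \<and> cover.third u v = i} \<union>
    (if i = 2 then {(tail_name u 0, tail_name v 0) | u v. (u, v) \<in> csp.conflict_edges N x} else {})"
    using third_conflict_edge by auto
  moreover have "set (grid_list (Suc N) (Suc (2 * N))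
      (\<lambda>t c. map (place_edge t c) (cell_templates i))) =
      set (grid_list (Suc N) (Suc (2 * N)) (\<lambda>t c. map (place_edge t c) (tail_templates i))) \<union>
      set (grid_list (Suc N) (Suc (2 * N)) (\<lambda>t c. map (place_edge t c) (copy_templates i))) \<union>
      (if i = 2 then set (grid_list (Suc N) (Suc (2 * N))
        (\<lambda>t c. map (place_edge t c) two_values_templates)) else {})"
    by (simp add: cell_templates_def set_grid_list_map_append grid_list_Nil Un_assoc
      del: map_append)
  moreover have "set (if i = 0 then star_edges else []) =
      {(star_name 0, star_name (Suc j)) | j. i = 0 \<and> j < \<Delta>}"
    by (auto simp: star_edges_def)
  ultimately show ?thesis
    unfolding class_list_def cover.class_pairs_def set_append set_tail_edges set_copy_edges
      set_conflict_list[symmetric] conflict_list_def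
    by (cases "i = 2") auto
qed

lemma inst_graph_instance: "inst_graph (instance_of N x) = cover.graph N x"
proof -
  have "classes (cover.graph N x) =
      map (\<lambda>i. (\<lambda>(u, v). {u, v}) ` set (class_list N x i)) [0..<l - 1]"
    by (simp add: cover.graph_def cover.color_class_def ends_def set_class_list)
  then show ?thesis
    using set_vertex_list[of N x] by (simp add: inst_graph_def instance_of_def o_def)
qed

theorem instance_in_domain:
  "instance_of N x \<in> {I \<in> path_deletion_instances (l - 1). max_degree (inst_graph I) = \<Delta>}"
  using cover.colored_graph cover.max_degree_graph
  by (simp add: path_deletion_instances_def inst_graph_instance)

theorem instance_yes_iff:
  "instance_of N x \<in> colored_path_deletion (l - 1) l \<longleftrightarrow> grid_solvable P N x"
proof -
  have "inst_bound (instance_of N x) = csp.budget N" by (simp add: inst_bound_def instance_of_def)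
  then have "instance_of N x \<in> colored_path_deletion (l - 1) l \<longleftrightarrow>
      deletable (l - 1) l (cover.graph N x) (csp.budget N)"
    using instance_in_domain[of N x] by (simp add: colored_path_deletion_def inst_graph_instance)
  also have "\<dots> \<longleftrightarrow> csp.solvable N x"
    unfolding cover.deletable_iff_cover csp.solvable_iff_cover ..
  also have "\<dots> \<longleftrightarrow> grid_solvable P N x" by (rule solvable_iff_grid_solvable)
  finally show ?thesis .
qed

end


section \<open>A stack language and its compilation to Turing machines\<close>

datatype com =
    Skip
  | Push nat bool
  | Pop nat
  | Out bool
  | Seq com com (infixr ";;" 60)
  | Cond nat "nat \<Rightarrow> bool" com com
  | While nat "nat \<Rightarrow> bool" com

definition bit_symbol :: "bool \<Rightarrow> nat" where
  "bit_symbol b = (if b then 2 else 1)"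

fun top_symbol :: "bool list \<Rightarrow> nat" where
  "top_symbol [] = 0"
| "top_symbol (b # bs) = bit_symbol b"

type_synonym state = "bool list list \<times> bool list"

text \<open>The running times are those of the compiled programs.\<close>

inductive exec :: "com \<Rightarrow> state \<Rightarrow> nat \<Rightarrow> state \<Rightarrow> bool" where
  exec_Skip: "exec Skip s 0 s"
| exec_Push: "exec (Push r b) (s, out) 2 (s[r := b # s ! r], out)"
| exec_Pop: "exec (Pop r) (s, out) 1 (s[r := tl (s ! r)], out)"
| exec_Out: "exec (Out b) (s, out) 1 (s, out @ [b])"
| exec_Seq: "exec c1 s t1 s' \<Longrightarrow> exec c2 s' t2 s'' \<Longrightarrow> exec (c1 ;; c2) s (t1 + t2) s''"
| exec_Cond_True: "P (top_symbol (fst s ! r)) \<Longrightarrow> exec c1 s t s' \<Longrightarrow>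
    exec (Cond r P c1 c2) s (1 + t + 1) s'"
| exec_Cond_False: "\<not> P (top_symbol (fst s ! r)) \<Longrightarrow> exec c2 s t s' \<Longrightarrow>
    exec (Cond r P c1 c2) s (1 + t) s'"
| exec_While_True: "P (top_symbol (fst s ! r)) \<Longrightarrow> exec c s t1 s' \<Longrightarrow> exec (While r P c) s' t2 s'' \<Longrightarrow>
    exec (While r P c) s (1 + t1 + 1 + t2) s''"
| exec_While_False: "\<not> P (top_symbol (fst s ! r)) \<Longrightarrow> exec (While r P c) s 1 s"

fun uses_below :: "nat \<Rightarrow> com \<Rightarrow> bool" where
  "uses_below n Skip \<longleftrightarrow> True"
| "uses_below n (Push r b) \<longleftrightarrow> r < n"
| "uses_below n (Pop r) \<longleftrightarrow> r < n"
| "uses_below n (Out b) \<longleftrightarrow> True"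
| "uses_below n (c1 ;; c2) \<longleftrightarrow> uses_below n c1 \<and> uses_below n c2"
| "uses_below n (Cond r P c1 c2) \<longleftrightarrow> r < n \<and> uses_below n c1 \<and> uses_below n c2"
| "uses_below n (While r P c) \<longleftrightarrow> r < n \<and> uses_below n c"


subsection \<open>Compilation\<close>

text \<open>
  An instruction acts on a single tape: it maps the scanned symbol to the symbol to be written, a head
  movement and the next instruction address. Stacks grow to the left, so that the input tape is
  initially a stack with the head on its top; tape \<open>n\<close> is the output tape.
\<close>

type_synonym instr = "nat \<times> (nat \<Rightarrow> nat \<times> move \<times> nat)"

fun code_size :: "com \<Rightarrow> nat" where
  "code_size Skip = 0"
| "code_size (Push r b) = 2"
| "code_size (Pop r) = 1"
| "code_size (Out b) = 1"
| "code_size (c1 ;; c2) = code_size c1 + code_size c2"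
| "code_size (Cond r P c1 c2) = code_size c1 + code_size c2 + 2"
| "code_size (While r P c) = code_size c + 2"

definition jump :: "nat \<Rightarrow> (nat \<Rightarrow> nat) \<Rightarrow> instr" where
  "jump r f = (r, \<lambda>s. (s, Stay, f s))"

fun compile :: "nat \<Rightarrow> com \<Rightarrow> nat \<Rightarrow> instr list" where
  "compile n Skip p = []"
| "compile n (Push r b) p = [(r, \<lambda>s. (s, Left, p + 1)), (r, \<lambda>s. (bit_symbol b, Stay, p + 2))]"
| "compile n (Pop r) p = [(r, \<lambda>s. (0, Right, p + 1))]"
| "compile n (Out b) p = [(n, \<lambda>s. (bit_symbol b, Right, p + 1))]"
| "compile n (c1 ;; c2) p = compile n c1 p @ compile n c2 (p + code_size c1)"
| "compile n (Cond r P c1 c2) p =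
     jump r (\<lambda>s. if P s then p + 1 else p + code_size c1 + 2) # compile n c1 (p + 1) @
     jump r (\<lambda>s. p + code_size c1 + code_size c2 + 2) # compile n c2 (p + code_size c1 + 2)"
| "compile n (While r P c) p =
     jump r (\<lambda>s. if P s then p + 1 else p + code_size c + 2) # compile n c (p + 1) @
       [jump r (\<lambda>s. p)]"

lemma length_compile [simp]: "length (compile n c p) = code_size c"
  by (induction c arbitrary: p) auto

definition instr_bounded :: "nat \<Rightarrow> nat \<Rightarrow> instr \<Rightarrow> bool" where
  "instr_bounded n q = (\<lambda>(r, g). r \<le> n \<and> (\<forall>s<3. fst (g s) < 3 \<and> snd (snd (g s)) \<le> q))"

lemma instr_bounded_compile:
  "uses_below n c \<Longrightarrow> p + code_size c \<le> q \<Longrightarrow> list_all (instr_bounded n q) (compile n c p)"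
  by (induction c arbitrary: p) (auto simp: instr_bounded_def jump_def bit_symbol_def)

definition machine :: "nat \<Rightarrow> instr list \<Rightarrow> tm" where
  "machine n code = \<lparr>tapes = n + 1, states = length code + 2, symbols = 3,
     delta = \<lambda>q ss. if q < length code then
       {case code ! q of (r, g) \<Rightarrow> (case g (ss ! r) of (s, m, q') \<Rightarrow>
          (q', map (\<lambda>j. if j = r then (s, m) else (ss ! j, Stay)) [0..<n + 1]))} else {}\<rparr>"

lemma turing_machine_machine:
  assumes "list_all (instr_bounded n (length code)) code"
  shows "turing_machine (machine n code)"
  unfolding turing_machine_def
proof (intro conjI allI impI ballI)
  fix q ss tr
  assume ss: "ss \<in> reads (machine n code)" and tr: "tr \<in> delta (machine n code) q ss"
  have q: "q < length code" using tr by (auto simp: machine_def split: if_splits)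
  obtain r g where rg: "code ! q = (r, g)" by force
  obtain s m q' where g: "g (ss ! r) = (s, m, q')" by (metis prod_cases3)
  have ss_less: "ss ! j < 3" if "j \<le> n" for j
    using ss that by (auto simp: reads_def machine_def)
  have "instr_bounded n (length code) (code ! q)" using assms q by (simp add: list_all_length)
  then have "r \<le> n" "s < 3" "q' \<le> length code"
    using g ss_less[of r] unfolding rg instr_bounded_def by force+
  then show "case tr of (q', as) \<Rightarrow> q' < states (machine n code) \<and>
      length as = tapes (machine n code) \<and>
      (\<forall>(s, m)\<in>set as. s < symbols (machine n code))"
    using tr q rg g ss_less by (auto simp: machine_def)
qed (simp_all add: machine_def)

lemma deterministic_machine: "deterministic (machine n code)"
  by (auto simp: deterministic_def machine_def)


subsection \<open>Correctness of the compilation\<close>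

definition holds_stack :: "tape \<Rightarrow> bool list \<Rightarrow> bool" where
  "holds_stack t w \<longleftrightarrow> (\<forall>i\<ge>0. fst t (snd t + i) = contents w i)"

definition represents :: "nat \<Rightarrow> tape list \<Rightarrow> state \<Rightarrow> bool" where
  "represents n ts s \<longleftrightarrow> length ts = n + 1 \<and> length (fst s) = n \<and>
     (\<forall>j<n. holds_stack (ts ! j) (fst s ! j)) \<and> ts ! n = (contents (snd s), int (length (snd s)))"

lemma read_holds_stack: "holds_stack t w \<Longrightarrow> read t = top_symbol w"
  by (cases w) (auto simp: holds_stack_def read_def contents_def bit_symbol_def dest: spec[of _ 0])

lemma contents_tl: "0 \<le> i \<Longrightarrow> contents (tl w) i = contents w (i + 1)"
  by (cases w) (auto simp: contents_def nat_add_distrib)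

lemma contents_Cons: "0 < i \<Longrightarrow> contents (b # w) i = contents w (i - 1)"
  by (auto simp: contents_def nth_Cons' nat_diff_distrib)

lemma contents_snoc: "(contents w)(int (length w) := bit_symbol b) = contents (w @ [b])"
  by (auto simp: contents_def fun_eq_iff nth_append bit_symbol_def)

lemma holds_stack_tl: "holds_stack t w \<Longrightarrow> holds_stack (act t (0, Right)) (tl w)"
  by (auto simp: holds_stack_def act_def contents_tl add.assoc add.commute[of 1])

lemma holds_stack_Cons:
  assumes "holds_stack t w"
  shows "holds_stack (act (act t (read t, Left)) (bit_symbol b, Stay)) (b # w)"
  unfolding holds_stack_def
proof (intro allI impI)
  fix i :: int assume i: "0 \<le> i"
  let ?t = "act (act t (read t, Left)) (bit_symbol b, Stay)"
  show "fst ?t (snd ?t + i) = contents (b # w) i"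
  proof (cases "i = 0")
    case True
    then show ?thesis by (simp add: act_def contents_def bit_symbol_def)
  next
    case False
    then have "fst t (snd t + (i - 1)) = contents (b # w) i"
      using assms i by (simp add: holds_stack_def contents_Cons)
    then show ?thesis using False by (auto simp: act_def read_def algebra_simps)
  qed
qed

lemma act_read_Stay [simp]: "act t (read t, Stay) = t"
  by (cases t) (simp add: act_def read_def)

lemma machine_step:
  assumes "q < length code" "code ! q = (r, g)" "g (read (ts ! r)) = (s, m, q')"
    and "length ts = n + 1" "r \<le> n"
  shows "step (machine n code) (q, ts) (q', ts[r := act (ts ! r) (s, m)])"
proof -
  have "ts[r := act (ts ! r) (s, m)] =
      map2 act ts (map (\<lambda>j. if j = r then (s, m) else (map read ts ! j, Stay)) [0..<n + 1])"
    using assms(4) by (intro nth_equalityI) (auto simp del: upt_Suc simp: nth_list_update)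
  then show ?thesis
    using assms by (auto simp: step_def machine_def)
qed

definition simulates :: "nat \<Rightarrow> instr list \<Rightarrow> nat \<Rightarrow> nat \<times> state \<Rightarrow> nat \<times> state \<Rightarrow> bool" where
  "simulates n code t = (\<lambda>(p, s) (p', s'). \<forall>ts. represents n ts s \<longrightarrow>
     (\<exists>ts'. (step (machine n code) ^^ t) (p, ts) (p', ts') \<and> represents n ts' s'))"

lemma simulates_refl: "simulates n code 0 x x"
  by (auto simp: simulates_def)

lemma simulates_trans:
  assumes "simulates n code t1 x y" "simulates n code t2 y z"
  shows "simulates n code (t1 + t2) x z"
proof -
  obtain p s p' s' q w where xyz: "x = (p, s)" "y = (p', s')" "z = (q, w)" by (metis surj_pair)
  show ?thesis
    using assms unfolding simulates_def xyz prod.case by (metis relpowp_trans)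
qed

lemma simulates_jump:
  assumes "p < length code" "code ! p = jump r f" "r < n"
  shows "simulates n code 1 (p, s) (f (top_symbol (fst s ! r)), s)"
  unfolding simulates_def
proof clarify
  fix ts assume ts: "represents n ts s"
  then have "read (ts ! r) = top_symbol (fst s ! r)"
    using assms(3) by (intro read_holds_stack) (auto simp: represents_def)
  moreover have "step (machine n code) (p, ts)
      (f (read (ts ! r)), ts[r := act (ts ! r) (read (ts ! r), Stay)])"
    by (rule machine_step[OF assms(1,2)[unfolded jump_def] refl])
      (use ts assms(3) in \<open>auto simp: represents_def\<close>)
  ultimately show "\<exists>ts'. (step (machine n code) ^^ 1) (p, ts) (f (top_symbol (fst s ! r)), ts') \<and>
      represents n ts' s"
    using ts unfolding relpowp_1 by (metis act_read_Stay list_update_id)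
qed

lemma simulates_Push:
  assumes "p + 1 < length code" "code ! p = (r, \<lambda>s. (s, Left, p + 1))"
    "code ! (p + 1) = (r, \<lambda>s. (bit_symbol b, Stay, p + 2))" "r < n"
  shows "simulates n code 2 (p, s, out) (p + 2, s[r := b # s ! r], out)"
  unfolding simulates_def
proof clarify
  fix ts assume ts: "represents n ts (s, out)"
  define t' where "t' = act (ts ! r) (read (ts ! r), Left)"
  have len: "length ts = n + 1" using ts by (simp add: represents_def)
  have "step (machine n code) (p, ts) (p + 1, ts[r := t'])"
    unfolding t'_def by (rule machine_step[OF _ assms(2)]) (use assms len in auto)
  moreover have "step (machine n code) (p + 1, ts[r := t'])
      (p + 2, ts[r := t', r := act (ts[r := t'] ! r) (bit_symbol b, Stay)])"
    by (rule machine_step[OF _ assms(3)]) (use assms len in auto)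
  ultimately have "(step (machine n code) ^^ 2) (p, ts)
      (p + 2, ts[r := act t' (bit_symbol b, Stay)])"
    using len assms(4) by (auto simp: numeral_2_eq_2 eq_OO)
  moreover have "represents n (ts[r := act t' (bit_symbol b, Stay)]) (s[r := b # s ! r], out)"
    using ts assms(4) holds_stack_Cons by (auto simp: represents_def nth_list_update t'_def)
  ultimately show "\<exists>ts'. (step (machine n code) ^^ 2) (p, ts) (p + 2, ts') \<and>
      represents n ts' (s[r := b # s ! r], out)"
    by blast
qed

lemma simulates_Pop:
  assumes "p < length code" "code ! p = (r, \<lambda>s. (0, Right, p + 1))" "r < n"
  shows "simulates n code 1 (p, s, out) (p + 1, s[r := tl (s ! r)], out)"
  unfolding simulates_def
proof clarify
  fix ts assume ts: "represents n ts (s, out)"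
  have "step (machine n code) (p, ts) (p + 1, ts[r := act (ts ! r) (0, Right)])"
    by (rule machine_step[OF assms(1,2)]) (use ts assms(3) in \<open>auto simp: represents_def\<close>)
  moreover have "represents n (ts[r := act (ts ! r) (0, Right)]) (s[r := tl (s ! r)], out)"
    using ts assms(3) holds_stack_tl by (auto simp: represents_def nth_list_update)
  ultimately show "\<exists>ts'. (step (machine n code) ^^ 1) (p, ts) (p + 1, ts') \<and>
      represents n ts' (s[r := tl (s ! r)], out)"
    by auto
qed

lemma simulates_Out:
  assumes "p < length code" "code ! p = (n, \<lambda>s. (bit_symbol b, Right, p + 1))"
  shows "simulates n code 1 (p, s, out) (p + 1, s, out @ [b])"
  unfolding simulates_def
proof clarify
  fix ts assume ts: "represents n ts (s, out)"
  have "step (machine n code) (p, ts) (p + 1, ts[n := act (ts ! n) (bit_symbol b, Right)])"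
    by (rule machine_step[OF assms]) (use ts in \<open>auto simp: represents_def\<close>)
  moreover have "represents n (ts[n := act (ts ! n) (bit_symbol b, Right)]) (s, out @ [b])"
    using ts by (auto simp: represents_def nth_list_update act_def contents_snoc)
  ultimately show "\<exists>ts'. (step (machine n code) ^^ 1) (p, ts) (p + 1, ts') \<and>
      represents n ts' (s, out @ [b])"
    by auto
qed

definition code_at :: "instr list \<Rightarrow> nat \<Rightarrow> instr list \<Rightarrow> bool" where
  "code_at code p xs \<longleftrightarrow> (\<exists>ys zs. code = ys @ xs @ zs \<and> length ys = p)"

lemma code_at_append:
  "code_at code p (xs @ ys) \<Longrightarrow> code_at code p xs \<and> code_at code (p + length xs) ys"
  unfolding code_at_def by (metis append.assoc length_append)

lemma code_at_Cons:
  "code_at code p (x # xs) \<Longrightarrow> p < length code \<and> code ! p = x \<and> code_at code (p + 1) xs"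
proof -
  assume "code_at code p (x # xs)"
  then obtain ys zs where "code = ys @ x # xs @ zs" "length ys = p"
    by (auto simp: code_at_def)
  then have "code = (ys @ [x]) @ xs @ zs" "p < length code" "code ! p = x"
    "length (ys @ [x]) = p + 1"
    by (simp_all add: nth_append)
  then show ?thesis unfolding code_at_def by blast
qed

lemma simulates_Cond:
  assumes code: "code_at code p (compile n (Cond r P c1 c2) p)" and r: "r < n"
  shows "P (top_symbol (fst s ! r)) \<Longrightarrow> simulates n code t (p + 1, s) (p + 1 + code_size c1, s') \<Longrightarrow>
      simulates n code (1 + t + 1) (p, s) (p + code_size (Cond r P c1 c2), s')"
        (is "_ \<Longrightarrow> _ \<Longrightarrow> ?true_branch")
    and "\<not> P (top_symbol (fst s ! r)) \<Longrightarrow>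
      simulates n code t (p + code_size c1 + 2, s) (p + code_size c1 + 2 + code_size c2, s') \<Longrightarrow>
      simulates n code (1 + t) (p, s) (p + code_size (Cond r P c1 c2), s')"
        (is "_ \<Longrightarrow> _ \<Longrightarrow> ?false_branch")
proof -
  let ?end = "p + code_size (Cond r P c1 c2)"
  have test: "p < length code" "code ! p = jump r (\<lambda>s. if P s then p + 1 else p + code_size c1 + 2)"
    and exit: "p + 1 + code_size c1 < length code"
      "code ! (p + 1 + code_size c1) = jump r (\<lambda>s. ?end)"
    using code by (auto dest!: code_at_Cons code_at_append simp: add.assoc)
  note start = simulates_jump[OF test r, of s]
  show ?true_branch
    if "P (top_symbol (fst s ! r))" "simulates n code t (p + 1, s) (p + 1 + code_size c1, s')"
    using start that simulates_jump[OF exit r, of s']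
    by (simp only: if_True) (blast intro: simulates_trans)
  show ?false_branch
    if "\<not> P (top_symbol (fst s ! r))"
      "simulates n code t (p + code_size c1 + 2, s) (p + code_size c1 + 2 + code_size c2, s')"
    using start that by (auto dest: simulates_trans simp: add_ac)
qed

lemma simulates_While:
  assumes code: "code_at code p (compile n (While r P c) p)" and r: "r < n"
  shows "P (top_symbol (fst s ! r)) \<Longrightarrow> simulates n code t (p + 1, s) (p + 1 + code_size c, s') \<Longrightarrow>
      simulates n code (1 + t + 1) (p, s) (p, s')" (is "_ \<Longrightarrow> _ \<Longrightarrow> ?iteration")
    and "\<not> P (top_symbol (fst s ! r)) \<Longrightarrow> simulates n code 1 (p, s) (p + code_size (While r P c), s)"
      (is "_ \<Longrightarrow> ?exit")
proof -
  have test: "p < length code" "code ! p = jump r (\<lambda>s. if P s then p + 1 else p + code_size c + 2)"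
    and repeat: "p + 1 + code_size c < length code" "code ! (p + 1 + code_size c) = jump r (\<lambda>s. p)"
    using code by (auto dest!: code_at_Cons code_at_append)
  note start = simulates_jump[OF test r, of s]
  show ?iteration
    if "P (top_symbol (fst s ! r))" "simulates n code t (p + 1, s) (p + 1 + code_size c, s')"
    using start that simulates_jump[OF repeat r, of s']
    by (simp only: if_True) (blast intro: simulates_trans)
  show ?exit if "\<not> P (top_symbol (fst s ! r))" using start that by (simp add: add.assoc)
qed

theorem simulates_compile:
  "exec c s t s' \<Longrightarrow> uses_below n c \<Longrightarrow> code_at code p (compile n c p) \<Longrightarrow>
     simulates n code t (p, s) (p + code_size c, s')"
proof (induction arbitrary: p rule: exec.induct)
  case (exec_Skip s)
  then show ?case by (simp add: simulates_refl)
next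
  case (exec_Push r b s out)
  then show ?case using simulates_Push by (auto dest!: code_at_Cons)
next
  case (exec_Pop r s out)
  then show ?case using simulates_Pop by (auto dest!: code_at_Cons)
next
  case (exec_Out b s out)
  then show ?case using simulates_Out by (auto dest!: code_at_Cons)
next
  case (exec_Seq c1 s t1 s' c2 t2 s'')
  have "code_at code p (compile n c1 p)"
    "code_at code (p + code_size c1) (compile n c2 (p + code_size c1))"
    using code_at_append[OF exec_Seq.prems(2)[unfolded compile.simps]] by simp_all
  with exec_Seq have "simulates n code t1 (p, s) (p + code_size c1, s')"
    "simulates n code t2 (p + code_size c1, s') (p + code_size c1 + code_size c2, s'')"
    by simp_all
  then show ?case by (metis simulates_trans code_size.simps(5) add.assoc)
next
  case (exec_Cond_True P s r c1 t s' c2)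
  have "code_at code (p + 1) (compile n c1 (p + 1))" "r < n" "uses_below n c1"
    using exec_Cond_True.prems by (auto dest!: code_at_Cons code_at_append)
  with exec_Cond_True show ?case by (blast intro: simulates_Cond(1))
next
  case (exec_Cond_False P s r c2 t s' c1)
  have "code_at code (p + code_size c1 + 2) (compile n c2 (p + code_size c1 + 2))" "r < n"
    "uses_below n c2"
    using exec_Cond_False.prems by (auto dest!: code_at_Cons code_at_append simp: add_ac)
  with exec_Cond_False show ?case by (blast intro: simulates_Cond(2))
next
  case (exec_While_True P s r c t1 s' t2 s'')
  have "code_at code (p + 1) (compile n c (p + 1))" "r < n" "uses_below n c"
    using exec_While_True.prems by (auto dest!: code_at_Cons code_at_append)
  with exec_While_True show ?case by (blast intro: simulates_While(1) simulates_trans)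
next
  case (exec_While_False P s r c)
  then show ?case by (intro simulates_While(2)) simp_all
qed

definition runs :: "com \<Rightarrow> state \<Rightarrow> nat \<Rightarrow> state \<Rightarrow> bool" where
  "runs c s t s' \<longleftrightarrow> (\<exists>t'\<le>t. exec c s t' s')"

theorem polytime_if_runs:
  assumes uses: "uses_below (Suc n) c"
    and runs: "\<And>x. \<exists>t s'. t \<le> poly p (length x) \<and> runs c (x # replicate n [], []) t (s', f x)"
  shows "polytime f"
proof -
  define code where "code = compile (Suc n) c 0"
  let ?M = "machine (Suc n) code"
  have "\<exists>t C. t \<le> poly p (length x) \<and> (step ?M ^^ t) (initial ?M x) C \<and>
      halted ?M C \<and> fst (last (snd C)) = contents (f x)" for x
  proof -
    from runs[of x] obtain t s' where t: "t \<le> poly p (length x)"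
      and exec: "exec c (x # replicate n [], []) t (s', f x)"
      unfolding runs_def by (meson le_trans)
    let ?ts = "(contents x, 0) # replicate (Suc n) (contents [], 0::int)"
    have "represents (Suc n) ?ts (x # replicate n [], [])"
      by (auto simp: represents_def holds_stack_def nth_Cons' nth_append simp del: replicate_Suc)
    moreover have "simulates (Suc n) code t (0, x # replicate n [], []) (0 + code_size c, s', f x)"
      by (rule simulates_compile[OF exec uses]) (simp add: code_at_def code_def)
    ultimately obtain ts' where steps: "(step ?M ^^ t) (0, ?ts) (code_size c, ts')"
      and ts': "represents (Suc n) ts' (s', f x)"
      by (auto simp: simulates_def)
    have "initial ?M x = (0, ?ts)" by (simp add: initial_def machine_def)
    moreover have "halted ?M (code_size c, ts')"
      by (simp add: halted_def step_def machine_def code_def)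
    moreover have "last ts' = ts' ! Suc n"
      using ts' by (subst last_conv_nth) (auto simp: represents_def)
    then have "fst (last ts') = contents (f x)" using ts' by (simp add: represents_def)
    ultimately show ?thesis
      using t steps by (intro exI[of _ t] exI[of _ "(code_size c, ts')"]) auto
  qed
  moreover have "turing_machine ?M"
    using instr_bounded_compile[OF uses, of 0 "length code"]
    by (intro turing_machine_machine) (simp add: code_def)
  ultimately show ?thesis using deterministic_machine unfolding polytime_def by blast
qed


subsection \<open>Reasoning about programs\<close>

lemma runs_weaken: "runs c s t s1 \<Longrightarrow> s1 = s' \<Longrightarrow> t \<le> t' \<Longrightarrow> runs c s t' s'"
  unfolding runs_def by (meson le_trans)

lemma runs_start: "s0 = s \<Longrightarrow> runs c s t s' \<Longrightarrow> runs c s0 t s'"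
  by simp

lemma runs_Skip: "runs Skip s 0 s"
  unfolding runs_def by (blast intro: exec.intros)

lemma runs_Push: "runs (Push r b) (s, out) 2 (s[r := b # s ! r], out)"
  unfolding runs_def by (blast intro: exec.intros)

lemma runs_Pop: "runs (Pop r) (s, out) 1 (s[r := tl (s ! r)], out)"
  unfolding runs_def by (blast intro: exec.intros)

lemma runs_Out: "runs (Out b) (s, out) 1 (s, out @ [b])"
  unfolding runs_def by (blast intro: exec.intros)

lemma runs_Seq [trans]: "runs c1 s t1 s' \<Longrightarrow> runs c2 s' t2 s'' \<Longrightarrow> runs (c1 ;; c2) s (t1 + t2) s''"
  unfolding runs_def by (meson add_mono exec_Seq)

lemma exec_SeqE:
  assumes "exec (c1 ;; c2) s t s''"
  obtains t1 s' t2 where "exec c1 s t1 s'" "exec c2 s' t2 s''" "t = t1 + t2"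
  using assms by cases auto

lemma runs_Seq_assoc: "runs ((c1 ;; c2) ;; c3) = runs (c1 ;; c2 ;; c3)"
proof -
  have "exec ((c1 ;; c2) ;; c3) s t s' \<longleftrightarrow> exec (c1 ;; c2 ;; c3) s t s'" for s t s'
    by (auto elim!: exec_SeqE) (metis exec_Seq add.assoc)+
  then show ?thesis by (simp add: runs_def fun_eq_iff)
qed

lemma runs_Cond:
  assumes "P (top_symbol (fst s ! r)) \<Longrightarrow> runs c1 s t s'"
    "\<not> P (top_symbol (fst s ! r)) \<Longrightarrow> runs c2 s t s'"
  shows "runs (Cond r P c1 c2) s (t + 2) s'"
proof (cases "P (top_symbol (fst s ! r))")
  case True
  then obtain t' where t': "t' \<le> t" "exec c1 s t' s'" using assms(1) by (auto simp: runs_def)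
  have "exec (Cond r P c1 c2) s (1 + t' + 1) s'" by (rule exec_Cond_True[of P, OF True t'(2)])
  then show ?thesis unfolding runs_def using t'(1) by (intro exI[of _ "1 + t' + 1"]) simp
next
  case False
  then obtain t' where t': "t' \<le> t" "exec c2 s t' s'" using assms(2) by (auto simp: runs_def)
  have "exec (Cond r P c1 c2) s (1 + t') s'" by (rule exec_Cond_False[of P, OF False t'(2)])
  then show ?thesis unfolding runs_def using t'(1) by (intro exI[of _ "1 + t'"]) simp
qed

lemma runs_While:
  assumes "\<And>i. i < n \<Longrightarrow> P (top_symbol (fst (st i) ! r))" "\<And>i. i < n \<Longrightarrow> runs c (st i) T (st (Suc i))"
    "\<not> P (top_symbol (fst (st n) ! r))"
  shows "runs (While r P c) (st 0) (n * (T + 2) + 1) (st n)"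
  using assms
proof (induction n arbitrary: st)
  case 0
  then have "exec (While r P c) (st 0) 1 (st 0)" by (intro exec_While_False) simp
  then show ?case by (auto simp: runs_def)
next
  case (Suc n)
  have "runs (While r P c) (st (Suc 0)) (n * (T + 2) + 1) (st (Suc n))"
    using Suc.IH[of "\<lambda>i. st (Suc i)"] Suc.prems by simp
  then obtain t2 where t2: "t2 \<le> n * (T + 2) + 1" "exec (While r P c) (st (Suc 0)) t2 (st (Suc n))"
    by (auto simp: runs_def)
  from Suc.prems(2)[of 0] obtain t1 where t1: "t1 \<le> T" "exec c (st 0) t1 (st (Suc 0))"
    by (auto simp: runs_def)
  have "exec (While r P c) (st 0) (1 + t1 + 1 + t2) (st (Suc n))"
    using Suc.prems(1)[of 0] t1 t2 by (intro exec_While_True) auto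
  then show ?case unfolding runs_def using t1(1) t2(1) by (intro exI[of _ "1 + t1 + 1 + t2"]) simp
qed

definition seqs :: "com list \<Rightarrow> com" where
  "seqs cs = foldr (;;) cs Skip"

lemma seqs_simps [simp]: "seqs [] = Skip" "seqs (c # cs) = c ;; seqs cs"
  by (simp_all add: seqs_def)

lemma uses_below_seqs [simp]: "uses_below n (seqs cs) \<longleftrightarrow> (\<forall>c\<in>set cs. uses_below n c)"
  by (induction cs) auto

lemma runs_seqs:
  assumes "\<And>x out. x \<in> set xs \<Longrightarrow> runs (f x) (s, out) (k x) (s, out @ h x)"
  shows "runs (seqs (map f xs)) (s, out) (sum_list (map k xs)) (s, out @ concat (map h xs))"
  using assms
proof (induction xs arbitrary: out)
  case Nil
  then show ?case using runs_Skip by simp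
next
  case (Cons x xs)
  have "runs (f x) (s, out) (k x) (s, out @ h x)" using Cons.prems by simp
  moreover have "runs (seqs (map f xs)) (s, out @ h x) (sum_list (map k xs))
      (s, (out @ h x) @ concat (map h xs))"
    by (rule Cons.IH) (use Cons.prems in simp)
  ultimately show ?case using runs_Seq by fastforce
qed

lemma runs_seqs_replicate:
  assumes "\<And>i. i < n \<Longrightarrow> runs c (st i) T (st (Suc i))"
  shows "runs (seqs (replicate n c)) (st 0) (n * T) (st n)"
  using assms
proof (induction n arbitrary: st)
  case 0
  then show ?case using runs_Skip by simp
next
  case (Suc n)
  have "runs (seqs (replicate n c)) (st (Suc 0)) (n * T) (st (Suc n))"
    using Suc.IH[of "\<lambda>i. st (Suc i)"] Suc.prems by simp
  with Suc.prems[of 0] show ?case by (simp add: runs_Seq)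
qed

definition outs :: "bool list \<Rightarrow> com" where
  "outs bs = seqs (map Out bs)"

lemma uses_below_outs [simp]: "uses_below n (outs bs)"
  by (simp add: outs_def)

lemma runs_outs: "runs (outs bs) (s, out) (length bs) (s, out @ bs)"
proof -
  have "runs (seqs (map Out bs)) (s, out) (sum_list (map (\<lambda>_. 1) bs))
      (s, out @ concat (map (\<lambda>b. [b]) bs))"
    by (rule runs_seqs) (rule runs_Out)
  then show ?thesis by (simp add: outs_def sum_list_triv)
qed

abbreviation nonempty :: "nat \<Rightarrow> bool" where
  "nonempty \<equiv> \<lambda>s. s \<noteq> 0"

definition unary :: "nat \<Rightarrow> bool list" where
  "unary n = replicate n True"

lemma top_symbol_eq_0_iff [simp]: "top_symbol w = 0 \<longleftrightarrow> w = []"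
  by (cases w) (auto simp: bit_symbol_def)

lemma unary_simps [simp]:
  "unary 0 = []" "tl (unary n) = unary (n - 1)" "True # unary n = unary (Suc n)"
  "unary n = [] \<longleftrightarrow> n = 0" "length (unary n) = n"
  by (auto simp: unary_def simp flip: replicate_Suc)

lemma unary_1: "[True] = unary (Suc 0)"
  by (simp add: unary_def)

lemma list_update_numeral [simp]: "(x # xs)[numeral v := y] = x # xs[pred_numeral v := y]"
  by (simp add: numeral_eq_Suc)

definition loop :: "nat \<Rightarrow> com \<Rightarrow> com" where
  "loop r c = While r nonempty (Pop r ;; c)"

lemma uses_below_loop [simp]: "uses_below n (loop r c) \<longleftrightarrow> r < n \<and> uses_below n c"
  by (auto simp: loop_def)

lemma runs_loop:
  assumes body: "\<And>i. i < n \<Longrightarrow> runs c ((ss i)[r := unary (n - Suc i)], os i) T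
      ((ss (Suc i))[r := unary (n - Suc i)], os (Suc i))"
    and length_ss: "\<And>i. i \<le> n \<Longrightarrow> r < length (ss i)"
    and start: "s = (ss 0)[r := unary n]"
  shows "runs (loop r c) (s, os 0) (n * (T + 3) + 1) ((ss n)[r := []], os n)"
proof -
  have "runs (While r nonempty (Pop r ;; c)) ((ss 0)[r := unary (n - 0)], os 0)
      (n * (1 + T + 2) + 1)
      ((ss n)[r := unary (n - n)], os n)"
  proof (rule runs_While)
    fix i assume i: "i < n"
    have "runs (Pop r) ((ss i)[r := unary (n - i)], os i) 1 ((ss i)[r := unary (n - Suc i)], os i)"
      by (rule runs_weaken[OF runs_Pop]) (use i length_ss in auto)
    then show "runs (Pop r ;; c) ((ss i)[r := unary (n - i)], os i) (1 + T)
        ((ss (Suc i))[r := unary (n - Suc i)], os (Suc i))"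
      by (rule runs_Seq[OF _ body[OF i]])
  qed (use length_ss in auto)
  moreover have "n * (1 + T + 2) + 1 = n * (T + 3) + 1" by (simp add: algebra_simps)
  ultimately show ?thesis by (simp only: loop_def start diff_zero diff_self_eq_0 unary_simps(1))
qed

definition move_to :: "nat \<Rightarrow> nat \<Rightarrow> com" where
  "move_to r r' = loop r (Push r' True)"

lemma uses_below_move_to [simp]: "uses_below n (move_to r r') \<longleftrightarrow> r < n \<and> r' < n"
  by (simp add: move_to_def)

lemma runs_move_to:
  assumes "s ! r = unary n" "s ! r' = unary m" "r \<noteq> r'" "r < length s" "r' < length s"
  shows "runs (move_to r r') (s, out) (5 * n + 1) (s[r := [], r' := unary (m + n)], out)"
proof -
  have "runs (loop r (Push r' True)) (s, out) (n * (2 + 3) + 1)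
      (s[r' := unary (m + n), r := []], out)"
  proof (rule runs_loop[where os = "\<lambda>_. out" and ss = "\<lambda>i. s[r' := unary (m + i)]"])
    fix i assume "i < n"
    show "runs (Push r' True) (s[r' := unary (m + i), r := unary (n - Suc i)], out) 2
        (s[r' := unary (m + Suc i), r := unary (n - Suc i)], out)"
      by (rule runs_weaken[OF runs_Push])
        (use assms in \<open>auto intro!: nth_equalityI simp: nth_list_update\<close>)
  next
    show "s = s[r' := unary (m + 0), r := unary n]"
      using assms by (metis add_0_right list_update_id)
  qed (use assms in auto)
  then show ?thesis
    using assms(3) by (simp add: move_to_def mult.commute list_update_swap)
qed

definition clear :: "nat \<Rightarrow> com" where
  "clear r = loop r Skip"

lemma uses_below_clear [simp]: "uses_below n (clear r) \<longleftrightarrow> r < n"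
  by (simp add: clear_def)

lemma runs_clear:
  assumes "s ! r = unary n" "r < length s"
  shows "runs (clear r) (s, out) (3 * n + 1) (s[r := []], out)"
proof -
  have "runs (loop r Skip) (s, out) (n * (0 + 3) + 1) (s[r := []], out)"
    by (rule runs_loop[where os = "\<lambda>_. out" and ss = "\<lambda>_. s"])
      (use assms in \<open>auto intro: runs_Skip simp flip: assms(1)\<close>)
  then show ?thesis by (simp add: clear_def mult.commute)
qed


section \<open>Programs that print grids\<close>

abbreviation (input) input_reg :: nat where "input_reg \<equiv> 0"
abbreviation (input) rows_reg :: nat where "rows_reg \<equiv> 1"
abbreviation (input) row_reg :: nat where "row_reg \<equiv> 2"
abbreviation (input) cols_reg :: nat where "cols_reg \<equiv> 3"
abbreviation (input) col_reg :: nat where "col_reg \<equiv> 4"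
abbreviation (input) scratch_reg :: nat where "scratch_reg \<equiv> 5"
abbreviation (input) buffer_reg :: nat where "buffer_reg \<equiv> 6"
abbreviation (input) tally_reg :: nat where "tally_reg \<equiv> 7"


subsection \<open>Printing templates\<close>

text \<open>
  The row and the column of the current cell are kept in unary in \<open>row_reg\<close> and \<open>col_reg\<close>, while
  \<open>rows_reg\<close> and \<open>cols_reg\<close> count the remaining ones.
\<close>

definition at_cell :: "nat \<Rightarrow> nat \<Rightarrow> bool list list \<Rightarrow> bool" where
  "at_cell t c s \<longleftrightarrow> length s = 8 \<and> s ! row_reg = unary t \<and> s ! col_reg = unary c \<and>
     s ! scratch_reg = []"

definition print_index :: "nat \<Rightarrow> com" where
  "print_index r = loop r (Push scratch_reg True ;; Out True ;; Out True) ;; move_to scratch_reg r"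

lemma runs_print_index:
  assumes "s ! r = unary n" "s ! scratch_reg = []" "r \<noteq> scratch_reg" "r < length s"
    "scratch_reg < length s"
  shows "runs (print_index r) (s, out) (12 * n + 2) (s, out @ replicate (2 * n) True)"
proof -
  let ?ss = "\<lambda>i. s[scratch_reg := unary i]" and ?os = "\<lambda>i. out @ replicate (2 * i) True"
  have loop: "runs (loop r (Push scratch_reg True ;; Out True ;; Out True)) (s, ?os 0)
      (n * (4 + 3) + 1)
      ((?ss n)[r := []], ?os n)"
  proof (rule runs_loop[where ss = ?ss and os = ?os])
    fix i assume "i < n"
    show "runs (Push scratch_reg True ;; Out True ;; Out True)
        ((?ss i)[r := unary (n - Suc i)], ?os i) 4
        ((?ss (Suc i))[r := unary (n - Suc i)], ?os (Suc i))"
      by (rule runs_weaken[OF runs_Seq[OF runs_Push runs_Seq[OF runs_Out runs_Out]]])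
        (use assms in \<open>auto intro!: nth_equalityI simp: nth_list_update replicate_append_same\<close>)
  next
    show "s = (?ss 0)[r := unary n]" using assms by (metis list_update_id unary_simps(1))
  qed (use assms in auto)
  have move: "runs (move_to scratch_reg r) ((?ss n)[r := []], ?os n) (5 * n + 1)
      (((?ss n)[r := []])[scratch_reg := [], r := unary (0 + n)], ?os n)"
    by (rule runs_move_to) (use assms in auto)
  have start: "(s, out) = (s, ?os 0)" by simp
  have restored: "((?ss n)[r := []])[scratch_reg := [], r := unary (0 + n)] = s"
    by (rule nth_equalityI) (use assms in \<open>auto simp: nth_list_update\<close>)
  show ?thesis
    unfolding print_index_def
    by (rule runs_weaken[OF runs_Seq[OF runs_start[OF start loop] move]])
      (simp_all only: restored, simp)
qed

lemma enc_nat_eq: "enc_nat n = concat (map (\<lambda>b. [True, b]) (binary n)) @ [False]"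
proof -
  have "enc_list (\<lambda>b. [b]) bs = concat (map (\<lambda>b. [True, b]) bs) @ [False]" for bs
    by (induction bs) auto
  then show ?thesis by (simp add: enc_nat_def)
qed

lemma concat_map_replicate_True:
  "concat (map (\<lambda>b. [True, b]) (replicate n True)) = replicate (2 * n) True"
  by (induction n) auto

lemma enc_nat_name:
  "enc_nat (name t c z) = replicate (2 * t) True @ [True, False] @
     replicate (2 * c) True @ [True, False] @
     replicate (2 * Suc z) True @ [False]"
  unfolding enc_nat_eq binary_name name_bits_def
  by (simp add: concat_map_replicate_True del: replicate_Suc mult_Suc_right map_replicate)

definition print_vertex :: "template \<Rightarrow> com" where
  "print_vertex = (\<lambda>(dt, dc, z).
     print_index row_reg ;; outs (replicate (2 * dt) True @ [True, False]) ;;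
     print_index col_reg ;;
       outs (replicate (2 * dc) True @ [True, False] @ replicate (2 * Suc z) True @ [False]))"

definition vertex_cost :: "template \<Rightarrow> nat" where
  "vertex_cost = (\<lambda>(dt, dc, z). 24 + 2 * (dt + dc + z))"

lemma runs_print_vertex:
  assumes cell: "at_cell t c s" and less: "t + c < B"
  shows "runs (print_vertex p) (s, out) (vertex_cost p * B) (s, out @ enc_nat (place t c p))"
proof -
  obtain dt dc z where p: "p = (dt, dc, z)" by (metis prod_cases3)
  have "(24 + 2 * (dt + dc + z)) * (t + c + 1) \<le> vertex_cost p * B"
    unfolding p vertex_cost_def prod.case using less by (intro mult_left_mono) auto
  then have time: "12 * t + 12 * c + 22 + 2 * dt + 2 * dc + 2 * Suc z \<le> vertex_cost p * B"
    by (simp add: algebra_simps)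
  have row: "runs (print_index row_reg) (s, out') (12 * t + 2) (s, out' @ replicate (2 * t) True)"
    and col: "runs (print_index col_reg) (s, out') (12 * c + 2) (s, out' @ replicate (2 * c) True)"
      for out'
    by (rule runs_print_index; use cell in \<open>simp add: at_cell_def\<close>)+
  note row
  also note runs_outs
  also note col
  also note runs_outs
  finally show ?thesis
    unfolding p print_vertex_def prod.case runs_Seq_assoc
    by (rule runs_weaken)
      (use time[unfolded p] in \<open>simp_all add: place_def enc_nat_name replicate_add distrib_left
        del: replicate_Suc mult_Suc_right\<close>)
qed

definition enc_items :: "('a \<Rightarrow> bool list) \<Rightarrow> 'a list \<Rightarrow> bool list" where
  "enc_items e xs = concat (map (\<lambda>x. True # e x) xs)"

lemma enc_list_eq: "enc_list e xs = enc_items e xs @ [False]"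
  by (induction xs) (auto simp: enc_items_def)

lemma enc_items_append: "enc_items e (xs @ ys) = enc_items e xs @ enc_items e ys"
  by (simp add: enc_items_def)

lemma enc_items_concat: "enc_items e (concat xss) = concat (map (enc_items e) xss)"
  by (induction xss) (auto simp: enc_items_def)

lemma enc_items_grid_list:
  "enc_items e (grid_list n m h) = grid_list n m (\<lambda>t c. enc_items e (h t c))"
  unfolding grid_list_def enc_items_concat by (simp add: o_def enc_items_concat)

definition print_vertices :: "template list \<Rightarrow> com" where
  "print_vertices ps = seqs (map (\<lambda>p. Out True ;; print_vertex p) ps)"

definition print_edges :: "(template \<times> template) list \<Rightarrow> com" where
  "print_edges es = seqs (map (\<lambda>(p, q). Out True ;; print_vertex p ;; print_vertex q) es)"

definition vertices_cost :: "template list \<Rightarrow> nat" where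
  "vertices_cost ps = sum_list (map (\<lambda>p. 1 + vertex_cost p) ps)"

definition edges_cost :: "(template \<times> template) list \<Rightarrow> nat" where
  "edges_cost es = sum_list (map (\<lambda>(p, q). 1 + vertex_cost p + vertex_cost q) es)"

lemma runs_print_vertices:
  assumes "at_cell t c s" "t + c < B"
  shows "runs (print_vertices ps) (s, out) (vertices_cost ps * B)
    (s, out @ enc_items enc_nat (map (place t c) ps))"
proof -
  have "runs (Out True ;; print_vertex p) (s, out) ((1 + vertex_cost p) * B)
      (s, out @ True # enc_nat (place t c p))" for p out
    by (rule runs_weaken[OF runs_Seq[OF runs_Out runs_print_vertex[OF assms]]])
      (use assms(2) in \<open>auto simp: algebra_simps\<close>)
  then have "runs (print_vertices ps) (s, out) (sum_list (map (\<lambda>p. (1 + vertex_cost p) * B) ps))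
      (s, out @ concat (map (\<lambda>p. True # enc_nat (place t c p)) ps))"
    unfolding print_vertices_def by (rule runs_seqs)
  then show ?thesis
    by (simp only: enc_items_def map_map o_def vertices_cost_def sum_list_mult_const)
qed

lemma runs_print_edges:
  assumes "at_cell t c s" "t + c < B"
  shows "runs (print_edges es) (s, out) (edges_cost es * B)
    (s, out @ enc_items enc_edge (map (place_edge t c) es))"
proof -
  have "runs (case e of (p, q) \<Rightarrow> Out True ;; print_vertex p ;; print_vertex q) (s, out)
      ((case e of (p, q) \<Rightarrow> 1 + vertex_cost p + vertex_cost q) * B)
        (s, out @ True # enc_edge (place_edge t c e))"
    for e out
    by (cases e, simp only: prod.case)
      (rule runs_weaken[OF runs_Seq[OF runs_Out
          runs_Seq[OF runs_print_vertex[OF assms] runs_print_vertex[OF assms]]]],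
        use assms(2) in \<open>auto simp: enc_edge_def place_edge_def algebra_simps\<close>)
  then have "runs (print_edges es) (s, out)
      (sum_list (map (\<lambda>e. (case e of (p, q) \<Rightarrow> 1 + vertex_cost p + vertex_cost q) * B) es))
      (s, out @ concat (map (\<lambda>e. True # enc_edge (place_edge t c e)) es))"
    unfolding print_edges_def by (rule runs_seqs)
  then show ?thesis by (simp only: enc_items_def map_map o_def edges_cost_def sum_list_mult_const)
qed

lemma uses_below_print [simp]: "uses_below 8 (print_vertices ps)" "uses_below 8 (print_edges es)"
  by (auto simp: print_vertices_def print_edges_def print_vertex_def print_index_def)


subsection \<open>Loops over the grid\<close>

definition grid_loop :: "com \<Rightarrow> com" where
  "grid_loop body =
     loop rows_reg
       (loop cols_reg (body ;; Push col_reg True) ;; move_to col_reg cols_reg ;;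
         Push row_reg True) ;;
     move_to row_reg rows_reg"

definition grid_time :: "nat \<Rightarrow> nat \<Rightarrow> nat \<Rightarrow> nat" where
  "grid_time n m T = n * (m * (T + 10) + 7) + 5 * n + 2"

lemma runs_column_loop:
  assumes body: "\<And>c b out. c < m \<Longrightarrow>
      runs body ([x, u, v, unary b, unary c, [], f, g c], out) T
        ([x, u, v, unary b, unary c, [], f, g (Suc c)], out @ h c)"
  shows "runs (loop cols_reg (body ;; Push col_reg True)) ([x, u, v, unary m, [], [], f, g 0], out)
     (m * (T + 5) + 1) ([x, u, v, [], unary m, [], f, g m], out @ concat (map h [0..<m]))"
proof -
  let ?ss = "\<lambda>c. [x, u, v, [], unary c, [], f, g c]" and ?os = "\<lambda>c. out @ concat (map h [0..<c])"
  have "runs (loop cols_reg (body ;; Push col_reg True)) ([x, u, v, unary m, [], [], f, g 0], ?os 0)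
      (m * (T + 2 + 3) + 1) ((?ss m)[cols_reg := []], ?os m)"
  proof (rule runs_loop[where ss = ?ss and os = ?os])
    fix c assume c: "c < m"
    show "runs (body ;; Push col_reg True) ((?ss c)[cols_reg := unary (m - Suc c)], ?os c) (T + 2)
        ((?ss (Suc c))[cols_reg := unary (m - Suc c)], ?os (Suc c))"
      by (rule runs_weaken[OF runs_Seq[OF runs_start[OF _ body[OF c]] runs_Push]]) auto
  qed auto
  then show ?thesis by (simp add: add.commute)
qed

lemma runs_grid_loop:
  assumes body: "\<And>t c a b out. t < n \<Longrightarrow> c < m \<Longrightarrow>
      runs body ([x, unary a, unary t, unary b, unary c, [], f, g (t * m + c)], out) T
        ([x, unary a, unary t, unary b, unary c, [], f, g (Suc (t * m + c))], out @ h t c)"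
  shows "runs (grid_loop body) ([x, unary n, [], unary m, [], [], f, g 0], out) (grid_time n m T)
     ([x, unary n, [], unary m, [], [], f, g (n * m)], out @ grid_list n m h)"
proof -
  have columns: "runs (loop cols_reg (body ;; Push col_reg True))
      ([x, unary a, unary t, unary m, [], [], f, g (t * m)], out) (m * (T + 5) + 1)
      ([x, unary a, unary t, [], unary m, [], f, g (Suc t * m)], out @ concat (map (h t) [0..<m]))"
    if "t < n" for a t out
    using runs_column_loop[of m body x "unary a" "unary t" f "\<lambda>c. g (t * m + c)" T "h t"] body that
    by (simp add: add.commute)
  let ?ss = "\<lambda>t. [x, [], unary t, unary m, [], [], f, g (t * m)]"
    and ?os = "\<lambda>t. out @ concat (map (\<lambda>t. concat (map (h t) [0..<m])) [0..<t])"
  have rows: "runs (loop rows_reg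
        (loop cols_reg (body ;; Push col_reg True) ;; move_to col_reg cols_reg ;;
          Push row_reg True))
      ([x, unary n, [], unary m, [], [], f, g 0], ?os 0)
      (n * (m * (T + 10) + 4 + 3) + 1) ((?ss n)[rows_reg := []], ?os n)"
  proof (rule runs_loop[where ss = ?ss and os = ?os])
    fix t assume t: "t < n"
    show "runs (loop cols_reg (body ;; Push col_reg True) ;; move_to col_reg cols_reg ;;
        Push row_reg True)
       ((?ss t)[rows_reg := unary (n - Suc t)], ?os t) (m * (T + 10) + 4)
       ((?ss (Suc t))[rows_reg := unary (n - Suc t)], ?os (Suc t))"
      by (rule runs_weaken[OF runs_Seq[OF runs_start[OF _ columns[OF t]]
            runs_Seq[OF runs_move_to[of _ _ m _ 0] runs_Push]]])
        (auto simp: algebra_simps)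
  qed auto
  show ?thesis
    unfolding grid_loop_def
    by (rule runs_weaken[OF runs_Seq[OF runs_start[OF _ rows] runs_move_to[of _ _ n _ 0]]])
      (auto simp: grid_time_def grid_list_def)
qed

text \<open>The counters are initially set for a grid with \<open>N\<close> rows and \<open>2 * N\<close> columns.\<close>

definition cell_loop :: "com \<Rightarrow> com" where
  "cell_loop body =
     Push rows_reg True ;; Push cols_reg True ;; grid_loop body ;; Pop rows_reg ;; Pop cols_reg"

definition cell_time :: "nat \<Rightarrow> nat \<Rightarrow> nat" where
  "cell_time N T = grid_time (Suc N) (Suc (2 * N)) T + 6"

lemma runs_cell_loop:
  assumes "\<And>t c a b out. t \<le> N \<Longrightarrow> c \<le> 2 * N \<Longrightarrow>
      runs body ([x, unary a, unary t, unary b, unary c, [], f, g (t * Suc (2 * N) + c)], out) T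
        ([x, unary a, unary t, unary b, unary c, [], f, g (Suc (t * Suc (2 * N) + c))],
         out @ h t c)"
  shows "runs (cell_loop body) ([x, unary N, [], unary (2 * N), [], [], f, g 0], out)
      (cell_time N T)
     ([x, unary N, [], unary (2 * N), [], [], f, g (Suc N * Suc (2 * N))],
      out @ grid_list (Suc N) (Suc (2 * N)) h)"
proof -
  let ?out' = "out @ grid_list (Suc N) (Suc (2 * N)) h"
  have "runs (Push rows_reg True) ([x, unary N, [], unary (2 * N), [], [], f, g 0], out) 2
      ([x, unary (Suc N), [], unary (2 * N), [], [], f, g 0], out)"
    by (rule runs_weaken[OF runs_Push]) simp_all
  also have "runs (Push cols_reg True) \<dots> 2
      ([x, unary (Suc N), [], unary (Suc (2 * N)), [], [], f, g 0], out)"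
    by (rule runs_weaken[OF runs_Push]) simp_all
  also have "runs (grid_loop body) \<dots> (grid_time (Suc N) (Suc (2 * N)) T)
      ([x, unary (Suc N), [], unary (Suc (2 * N)), [], [], f, g (Suc N * Suc (2 * N))], ?out')"
    by (rule runs_grid_loop) (use assms in \<open>simp add: less_Suc_eq_le\<close>)
  also have "runs (Pop rows_reg) \<dots> 1
      ([x, unary N, [], unary (Suc (2 * N)), [], [], f, g (Suc N * Suc (2 * N))], ?out')"
    by (rule runs_weaken[OF runs_Pop]) simp_all
  also have "runs (Pop cols_reg) \<dots> 1
      ([x, unary N, [], unary (2 * N), [], [], f, g (Suc N * Suc (2 * N))], ?out')"
    by (rule runs_weaken[OF runs_Pop]) simp_all
  finally show ?thesis
    unfolding cell_loop_def runs_Seq_assoc by (rule runs_weaken) (simp_all add: cell_time_def)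
qed

abbreviation ready :: "bool list \<Rightarrow> nat \<Rightarrow> bool list list" where
  "ready x N \<equiv> [x, unary N, [], unary (2 * N), [], [], [], []]"

lemma at_cell_list [simp]:
  "at_cell t c [x, u, unary t', v, unary c', w, f, g] \<longleftrightarrow> unary t' = unary t \<and> unary c' = unary c \<and>
     w = []"
  by (simp add: at_cell_def)

lemma runs_cell_loop_vertices:
  "runs (cell_loop (print_vertices ps)) (ready x N, out)
     (cell_time N (vertices_cost ps * (3 * N + 1)))
     (ready x N, out @ enc_items enc_nat
       (grid_list (Suc N) (Suc (2 * N)) (\<lambda>t c. map (place t c) ps)))"
  unfolding enc_items_grid_list
  by (rule runs_cell_loop[where g = "\<lambda>_. []"], rule runs_print_vertices) auto

lemma runs_cell_loop_edges:
  "runs (cell_loop (print_edges es)) (ready x N, out) (cell_time N (edges_cost es * (3 * N + 1)))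
     (ready x N, out @ enc_items enc_edge
       (grid_list (Suc N) (Suc (2 * N)) (\<lambda>t c. map (place_edge t c) es)))"
  unfolding enc_items_grid_list
  by (rule runs_cell_loop[where g = "\<lambda>_. []"], rule runs_print_edges) auto

lemma runs_grid_loop_edges:
  "runs (grid_loop (print_edges es)) (ready x N, out)
     (grid_time N (2 * N) (edges_cost es * (3 * N + 1)))
     (ready x N, out @ enc_items enc_edge (grid_list N (2 * N) (\<lambda>t c. map (place_edge t c) es)))"
  unfolding enc_items_grid_list
  by (rule runs_grid_loop[where g = "\<lambda>_. []"], rule runs_print_edges) auto


subsection \<open>Counting in binary\<close>

lemma binary_Suc_cases:
  obtains j rest where "binary n = unary j @ rest" "rest = [] \<or> (\<exists>w. rest = False # w)"
    "binary (Suc n) = replicate j False @ True # tl rest"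
proof (induction n arbitrary: thesis rule: less_induct)
  case (less n)
  consider (zero) "n = 0" | (even) "n > 0" "even n" | (odd) "odd n" by blast
  then show ?case
  proof cases
    case zero
    then show ?thesis using less.prems[of 0 "[]"] by (simp add: binary.simps)
  next
    case even
    then have "binary n = False # binary (n div 2)" "binary (Suc n) = True # binary (n div 2)"
      by (auto simp: binary.simps[of n] binary.simps[of "Suc n"])
    then show ?thesis using less.prems[of 0 "binary n"] by simp
  next
    case odd
    then have n: "binary n = True # binary (n div 2)"
      "binary (Suc n) = False # binary (Suc (n div 2))"
      "n div 2 < n"
      by (auto simp: binary.simps[of n] binary.simps[of "Suc n"] elim!: oddE)
    obtain j rest where "binary (n div 2) = unary j @ rest" "rest = [] \<or> (\<exists>w. rest = False # w)"
      "binary (Suc (n div 2)) = replicate j False @ True # tl rest"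
      by (rule less.IH[OF n(3)])
    then show ?thesis using less.prems[of "Suc j" rest] n by (simp flip: unary_simps(3))
  qed
qed

lemma length_binary_le: "length (binary n) \<le> n"
proof (induction n rule: less_induct)
  case (less n)
  show ?case
  proof (cases "n = 0")
    case False
    then have "length (binary (n div 2)) \<le> n div 2" using less by simp
    then show ?thesis using False by (simp add: binary.simps[of n])
  qed (simp add: binary.simps)
qed

definition pop_ones :: com where
  "pop_ones = While tally_reg (\<lambda>s. s = 2) (Pop tally_reg ;; Push scratch_reg True)"

definition push_zeros :: com where
  "push_zeros = loop scratch_reg (Push tally_reg False)"

definition increment :: com where
  "increment =
     pop_ones ;; Cond tally_reg nonempty (Pop tally_reg) Skip ;; Push tally_reg True ;; push_zeros"

lemma runs_pop_ones:
  assumes "rest = [] \<or> (\<exists>w. rest = False # w)"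
  shows "runs pop_ones ([x, a, b, c, d, [], f, unary j @ rest], out) (5 * j + 1)
     ([x, a, b, c, d, unary j, f, rest], out)"
proof -
  let ?st = "\<lambda>i. ([x, a, b, c, d, unary i, f, unary (j - i) @ rest], out)"
  have "runs pop_ones (?st 0) (j * (3 + 2) + 1) (?st j)"
    unfolding pop_ones_def
  proof (rule runs_While)
    fix i assume "i < j"
    then have "unary (j - i) = True # unary (j - Suc i)" by (simp add: Suc_diff_Suc)
    then have tally: "unary (j - i) @ rest = True # unary (j - Suc i) @ rest" by simp
    show "top_symbol (fst (?st i) ! tally_reg) = 2" by (simp add: tally bit_symbol_def)
    show "runs (Pop tally_reg ;; Push scratch_reg True) (?st i) 3 (?st (Suc i))"
      by (rule runs_weaken[OF runs_Seq[OF runs_Pop runs_Push]]) (simp_all add: tally)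
  next
    show "top_symbol (fst (?st j) ! tally_reg) \<noteq> 2" using assms by (auto simp: bit_symbol_def)
  qed
  then show ?thesis by (simp add: mult.commute)
qed

lemma runs_push_zeros:
  "runs push_zeros ([x, a, b, c, d, unary j, f, w], out) (5 * j + 1)
     ([x, a, b, c, d, [], f, replicate j False @ w], out)"
proof -
  let ?ss = "\<lambda>i. [x, a, b, c, d, [], f, replicate i False @ w]"
  have "runs push_zeros ([x, a, b, c, d, unary j, f, w], (\<lambda>_. out) 0) (j * (2 + 3) + 1)
      ((?ss j)[scratch_reg := []], out)"
    unfolding push_zeros_def
  proof (rule runs_loop[where ss = ?ss])
    fix i assume "i < j"
    show "runs (Push tally_reg False) ((?ss i)[scratch_reg := unary (j - Suc i)], out) 2
        ((?ss (Suc i))[scratch_reg := unary (j - Suc i)], out)"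
      by (rule runs_weaken[OF runs_Push]) auto
  qed auto
  then show ?thesis by (simp add: mult.commute)
qed

lemma runs_increment:
  "runs increment ([x, a, b, c, d, [], f, binary n], out) (10 * n + 7)
     ([x, a, b, c, d, [], f, binary (Suc n)], out)"
proof -
  obtain j rest where n: "binary n = unary j @ rest"
    "binary (Suc n) = replicate j False @ True # tl rest"
    and rest: "rest = [] \<or> (\<exists>w. rest = False # w)"
    by (rule binary_Suc_cases)
  have j: "j \<le> n" using length_binary_le[of n] n(1) by simp
  have "runs pop_ones ([x, a, b, c, d, [], f, unary j @ rest], out) (5 * j + 1)
      ([x, a, b, c, d, unary j, f, rest], out)"
    by (rule runs_pop_ones[OF rest])
  also have "runs (Cond tally_reg nonempty (Pop tally_reg) Skip) \<dots> (1 + 2)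
      ([x, a, b, c, d, unary j, f, tl rest], out)"
    by (rule runs_Cond) (rule runs_weaken[OF runs_Pop] runs_weaken[OF runs_Skip]; use rest in auto)+
  also have "runs (Push tally_reg True) \<dots> 2 ([x, a, b, c, d, unary j, f, True # tl rest], out)"
    by (rule runs_weaken[OF runs_Push]) simp_all
  also have "runs push_zeros \<dots> (5 * j + 1)
      ([x, a, b, c, d, [], f, replicate j False @ True # tl rest], out)"
    by (rule runs_push_zeros)
  finally show ?thesis
    unfolding increment_def runs_Seq_assoc n by (rule runs_weaken) (use j in simp_all)
qed

definition add_tally :: "nat \<Rightarrow> com" where
  "add_tally q = seqs (replicate q increment)"

lemma runs_add_tally:
  "runs (add_tally q) ([x, a, b, c, d, [], f, binary n], out) (q * (10 * (n + q) + 7))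
     ([x, a, b, c, d, [], f, binary (n + q)], out)"
proof -
  let ?st = "\<lambda>i. ([x, a, b, c, d, [], f, binary (n + i)], out)"
  have "runs (seqs (replicate q increment)) (?st 0) (q * (10 * (n + q) + 7)) (?st q)"
  proof (rule runs_seqs_replicate)
    fix i assume "i < q"
    then show "runs increment (?st i) (10 * (n + q) + 7) (?st (Suc i))"
      by (intro runs_weaken[OF runs_increment]) auto
  qed
  then show ?thesis by (simp add: add_tally_def)
qed

definition print_tally :: com where
  "print_tally =
     While tally_reg nonempty
       (Out True ;; Cond tally_reg (\<lambda>s. s = 2) (Out True) (Out False) ;; Pop tally_reg) ;;
     Out False"

lemma runs_print_tally:
  "runs print_tally ([x, a, b, c, d, e, f, binary n], out) (7 * n + 2)
     ([x, a, b, c, d, e, f, []], out @ enc_nat n)"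
proof -
  let ?w = "binary n"
  let ?body = "Out True ;; Cond tally_reg (\<lambda>s. s = 2) (Out True) (Out False) ;; Pop tally_reg"
  let ?st = "\<lambda>i. ([x, a, b, c, d, e, f, drop i ?w], out @ concat (map (\<lambda>b. [True, b]) (take i ?w)))"
  have print_bits: "runs (While tally_reg nonempty ?body) (?st 0) (length ?w * (5 + 2) + 1)
      (?st (length ?w))"
  proof (rule runs_While)
    fix i assume i: "i < length ?w"
    then show "nonempty (top_symbol (fst (?st i) ! tally_reg))" by simp
    have print_bit: "runs (Cond tally_reg (\<lambda>s. s = 2) (Out True) (Out False))
        ([x, a, b, c, d, e, f, ?w ! i # w], out') (1 + 2)
        ([x, a, b, c, d, e, f, ?w ! i # w], out' @ [?w ! i])"
      for w out'
      by (rule runs_Cond)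
        (rule runs_weaken[OF runs_Out]; auto simp: bit_symbol_def split: if_splits)+
    have "drop i ?w = ?w ! i # drop (Suc i) ?w" using i by (rule Cons_nth_drop_Suc[symmetric])
    then show "runs ?body (?st i) 5 (?st (Suc i))"
      by (simp only:)
        (rule runs_weaken[OF runs_Seq[OF runs_Out runs_Seq[OF print_bit runs_Pop]]],
          use i in \<open>auto simp: take_Suc_conv_app_nth\<close>)
  qed simp
  show ?thesis
    unfolding print_tally_def
    by (rule runs_weaken[OF runs_Seq[OF runs_start[OF _ print_bits] runs_Out]])
      (use length_binary_le[of n] in \<open>auto simp: enc_nat_eq\<close>)
qed

lemma uses_below_tally [simp]: "uses_below 8 (add_tally q)" "uses_below 8 print_tally"
  by (simp_all add: add_tally_def increment_def pop_ones_def push_zeros_def print_tally_def)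


subsection \<open>Preparing the counters\<close>

definition copy_bit :: "nat \<Rightarrow> nat \<Rightarrow> com" where
  "copy_bit r r' = Cond r (\<lambda>s. s = 2) (Push r' True) (Push r' False)"

lemma runs_copy_bit:
  assumes "s ! r = b # w"
  shows "runs (copy_bit r r') (s, out) 4 (s[r' := b # s ! r'], out)"
proof -
  have "runs (copy_bit r r') (s, out) (2 + 2) (s[r' := b # s ! r'], out)"
    unfolding copy_bit_def
    by (rule runs_Cond)
      (rule runs_weaken[OF runs_Push];
        use assms in \<open>auto simp: bit_symbol_def split: if_splits\<close>)+
  then show ?thesis by simp
qed

definition count_input :: com where
  "count_input =
     While input_reg nonempty
       (copy_bit input_reg buffer_reg ;; Pop input_reg ;; Push row_reg True) ;;
     While buffer_reg nonempty (copy_bit buffer_reg input_reg ;; Pop buffer_reg)"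

lemma runs_count_input:
  "runs count_input ([x, [], [], [], [], [], [], []], out) (16 * length x + 2)
     ([x, [], unary (length x), [], [], [], [], []], out)"
proof -
  let ?n = "length x" and ?y = "rev x"
  let ?st = "\<lambda>i. ([drop i x, [], unary i, [], [], [], rev (take i x), []], out)"
  have count: "runs (While input_reg nonempty
        (copy_bit input_reg buffer_reg ;; Pop input_reg ;; Push row_reg True))
      (?st 0) (?n * (7 + 2) + 1) (?st ?n)"
  proof (rule runs_While)
    fix i assume i: "i < ?n"
    then show "nonempty (top_symbol (fst (?st i) ! input_reg))" by simp
    have drop: "drop i x = x ! i # drop (Suc i) x" using i by (rule Cons_nth_drop_Suc[symmetric])
    show "runs (copy_bit input_reg buffer_reg ;; Pop input_reg ;; Push row_reg True)
        (?st i) 7 (?st (Suc i))"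
      by (rule runs_weaken[OF runs_Seq[OF runs_copy_bit[of _ 0 "x ! i" "drop (Suc i) x"]
              runs_Seq[OF runs_Pop runs_Push]]])
        (use i drop in \<open>auto simp: take_Suc_conv_app_nth\<close>)
  qed simp
  let ?st = "\<lambda>i. ([rev (take i ?y), [], unary ?n, [], [], [], drop i ?y, []], out)"
  have restore: "runs (While buffer_reg nonempty (copy_bit buffer_reg input_reg ;; Pop buffer_reg))
      (?st 0) (?n * (5 + 2) + 1) (?st ?n)"
  proof (rule runs_While)
    fix i assume i: "i < ?n"
    then show "nonempty (top_symbol (fst (?st i) ! buffer_reg))" by simp
    have drop: "drop i ?y = ?y ! i # drop (Suc i) ?y" using i by (simp add: Cons_nth_drop_Suc)
    show "runs (copy_bit buffer_reg input_reg ;; Pop buffer_reg) (?st i) 5 (?st (Suc i))"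
      by (rule runs_weaken[OF runs_Seq[OF runs_copy_bit[of _ 6 "?y ! i" "drop (Suc i) ?y"]
              runs_Pop]])
        (use i drop in \<open>auto simp: take_Suc_conv_app_nth\<close>)
  qed simp
  show ?thesis
    unfolding count_input_def
    by (rule runs_weaken[OF runs_Seq[OF runs_start[OF _ count] runs_start[OF _ restore]]]) auto
qed

definition multiply :: com where
  "multiply =
     loop rows_reg (loop row_reg (Push col_reg True ;; Push scratch_reg True) ;;
       move_to col_reg row_reg) ;;
     move_to scratch_reg rows_reg"

lemma runs_multiply:
  "runs multiply ([x, unary a, unary b, [], [], [], [], []], out) (a * (17 * b + 5) + 2)
     ([x, unary (a * b), unary b, [], [], [], [], []], out)"
proof -
  have add: "runs (loop row_reg (Push col_reg True ;; Push scratch_reg True))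
      ([x, u, unary b, [], [], unary e, [], []], out) (b * (4 + 3) + 1)
      ([x, u, [], [], unary b, unary (e + b), [], []], out)" for u e
  proof -
    let ?ss = "\<lambda>i. [x, u, [], [], unary i, unary (e + i), [], []]"
    have "runs (loop row_reg (Push col_reg True ;; Push scratch_reg True))
        ([x, u, unary b, [], [], unary e, [], []], (\<lambda>_. out) 0) (b * (4 + 3) + 1)
        ((?ss b)[row_reg := []], out)"
    proof (rule runs_loop[where ss = ?ss])
      fix i assume "i < b"
      show "runs (Push col_reg True ;; Push scratch_reg True)
          ((?ss i)[row_reg := unary (b - Suc i)], out) 4
          ((?ss (Suc i))[row_reg := unary (b - Suc i)], out)"
        by (rule runs_weaken[OF runs_Seq[OF runs_Push runs_Push]]) auto
    qed auto
    then show ?thesis by simp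
  qed
  let ?ss = "\<lambda>i. [x, [], unary b, [], [], unary (i * b), [], []]"
  have add_repeatedly:
    "runs (loop rows_reg
        (loop row_reg (Push col_reg True ;; Push scratch_reg True) ;; move_to col_reg row_reg))
      ([x, unary a, unary b, [], [], [], [], []], (\<lambda>_. out) 0) (a * (12 * b + 2 + 3) + 1)
      ((?ss a)[rows_reg := []], out)"
  proof (rule runs_loop[where ss = ?ss])
    fix i assume "i < a"
    show "runs
        (loop row_reg (Push col_reg True ;; Push scratch_reg True) ;; move_to col_reg row_reg)
        ((?ss i)[rows_reg := unary (a - Suc i)], out) (12 * b + 2)
        ((?ss (Suc i))[rows_reg := unary (a - Suc i)], out)"
      by (rule runs_weaken[OF runs_Seq[OF runs_start[OF _ add[of "unary (a - Suc i)" "i * b"]]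
              runs_move_to[of _ _ b _ 0]]])
        (auto simp: add.commute)
  qed auto
  show ?thesis
    unfolding multiply_def
    by (rule runs_weaken[OF runs_Seq[OF runs_start[OF _ add_repeatedly]
          runs_move_to[of _ _ "a * b" _ 0]]])
      (auto simp: algebra_simps)
qed

lemma runs_power:
  assumes "b \<ge> 1"
  shows "runs (seqs (replicate e multiply)) ([x, unary 1, unary b, [], [], [], [], []], out)
     (e * (b ^ e * (17 * b + 5) + 2)) ([x, unary (b ^ e), unary b, [], [], [], [], []], out)"
proof -
  let ?st = "\<lambda>i. ([x, unary (b ^ i), unary b, [], [], [], [], []], out)"
  have "runs (seqs (replicate e multiply)) (?st 0) (e * (b ^ e * (17 * b + 5) + 2)) (?st e)"
  proof (rule runs_seqs_replicate)
    fix i assume "i < e"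
    then have "b ^ i \<le> b ^ e" using assms by (intro power_increasing) auto
    then show "runs multiply (?st i) (b ^ e * (17 * b + 5) + 2) (?st (Suc i))"
      by (intro runs_weaken[OF runs_multiply] add_mono mult_right_mono) (auto simp: mult.commute)
  qed
  then show ?thesis by simp
qed

definition prepare :: "nat \<Rightarrow> com" where
  "prepare e =
     count_input ;; seqs (replicate e (Push row_reg True)) ;;
     Push rows_reg True ;; seqs (replicate e multiply) ;; clear row_reg ;;
     loop rows_reg (Push scratch_reg True ;; Push cols_reg True ;; Push cols_reg True) ;;
     move_to scratch_reg rows_reg"

definition prepare_time :: "nat \<Rightarrow> nat \<Rightarrow> nat \<Rightarrow> nat" where
  "prepare_time e n N =
     16 * n + 2 + (e * 2 +
       (2 + (e * (N * (17 * (n + e) + 5) + 2) + (3 * (n + e) + 1 + (9 * N + 1 + (5 * N + 1))))))"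

lemma runs_prepare:
  assumes "e \<ge> 1" and N: "N = (length x + e) ^ e"
  shows "runs (prepare e) ([x, [], [], [], [], [], [], []], out) (prepare_time e (length x) N)
      (ready x N, out)"
proof -
  let ?b = "length x + e"
  have "runs count_input ([x, [], [], [], [], [], [], []], out) (16 * length x + 2)
      ([x, [], unary (length x + 0), [], [], [], [], []], out)"
    using runs_count_input by simp
  also have "runs (seqs (replicate e (Push row_reg True))) \<dots> (e * 2)
      ([x, [], unary ?b, [], [], [], [], []], out)"
    by (rule runs_seqs_replicate[
          where st = "\<lambda>i. ([x, [], unary (length x + i), [], [], [], [], []], out)"])
      (rule runs_weaken[OF runs_Push]; simp)
  also have "runs (Push rows_reg True) \<dots> 2 ([x, unary 1, unary ?b, [], [], [], [], []], out)"
    by (rule runs_weaken[OF runs_Push]) (simp_all add: unary_1)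
  also have "runs (seqs (replicate e multiply)) \<dots> (e * (N * (17 * ?b + 5) + 2))
      ([x, unary N, unary ?b, [], [], [], [], []], out)"
    unfolding N by (rule runs_power) (use assms(1) in simp)
  also have "runs (clear row_reg) \<dots> (3 * ?b + 1) ([x, unary N, [], [], [], [], [], []], out)"
    by (rule runs_weaken[OF runs_clear[of _ _ ?b]]) simp_all
  also have "runs
      (loop rows_reg (Push scratch_reg True ;; Push cols_reg True ;; Push cols_reg True)) \<dots>
      (9 * N + 1) ([x, [], [], unary (2 * N), [], unary N, [], []], out)"
  proof -
    let ?ss = "\<lambda>i. [x, [], [], unary (2 * i), [], unary i, [], []]"
    have "runs (loop rows_reg (Push scratch_reg True ;; Push cols_reg True ;; Push cols_reg True))
        ([x, unary N, [], [], [], [], [], []], (\<lambda>_. out) 0) (N * (6 + 3) + 1)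
        ((?ss N)[rows_reg := []], out)"
    proof (rule runs_loop[where ss = ?ss])
      fix i assume "i < N"
      show "runs (Push scratch_reg True ;; Push cols_reg True ;; Push cols_reg True)
          ((?ss i)[rows_reg := unary (N - Suc i)], out) 6
          ((?ss (Suc i))[rows_reg := unary (N - Suc i)], out)"
        by (rule runs_weaken[OF runs_Seq[OF runs_Push runs_Seq[OF runs_Push runs_Push]]]) auto
    qed auto
    then show ?thesis by (simp add: mult.commute)
  qed
  also have "runs (move_to scratch_reg rows_reg) \<dots> (5 * N + 1) (ready x N, out)"
    by (rule runs_weaken[OF runs_move_to[of _ _ N _ 0]]) simp_all
  finally show ?thesis
    unfolding prepare_def runs_Seq_assoc by (rule runs_weaken) (simp_all add: prepare_time_def)
qed

lemma uses_below_prepare: "uses_below 8 (prepare e)"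
  by (simp add: prepare_def count_input_def copy_bit_def multiply_def)


section \<open>The reduction in polynomial time\<close>

lemma top_symbol_drop: "top_symbol (drop i x) = contents x (int i)"
  by (cases "i < length x") (auto simp: contents_def bit_symbol_def Cons_nth_drop_Suc[symmetric])

lemma top_symbol_less: "top_symbol w < 3"
  by (cases w) (auto simp: bit_symbol_def)

context grid_reduction
begin


subsection \<open>Printing the constraints of the first row\<close>

definition print_first_row_cell :: "bool \<Rightarrow> com" where
  "print_first_row_cell m =
     Cond input_reg (\<lambda>s. s = 0) (print_edges (unary_templates (first_row P m 0)))
       (Cond input_reg (\<lambda>s. s = 1) (print_edges (unary_templates (first_row P m 1)))
         (print_edges (unary_templates (first_row P m 2))))"

definition first_row_cost :: nat where
  "first_row_cost = (\<Sum>m\<in>UNIV. \<Sum>s<3. edges_cost (unary_templates (first_row P m s)))"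

lemma edges_cost_le_first_row_cost:
  assumes "s < 3"
  shows "edges_cost (unary_templates (first_row P m s)) \<le> first_row_cost"
proof -
  have "edges_cost (unary_templates (first_row P m s)) \<le>
      (\<Sum>s<3. edges_cost (unary_templates (first_row P m s)))"
    using assms by (intro member_le_sum) auto
  also have "\<dots> \<le> first_row_cost"
    unfolding first_row_cost_def by (rule member_le_sum) auto
  finally show ?thesis .
qed

lemma runs_print_first_row_edges:
  assumes "at_cell 0 c s" "c < B" "i < 3"
  shows "runs (print_edges (unary_templates (first_row P m i))) (s, out) (first_row_cost * B)
     (s, out @ enc_items enc_edge (map (place_edge 0 c) (unary_templates (first_row P m i))))"
  by (rule runs_weaken[OF runs_print_edges[OF assms(1)]])
    (use assms edges_cost_le_first_row_cost in auto)

lemma runs_print_first_row_cell: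
  assumes cell: "at_cell 0 c s" "c < B"
  shows "runs (print_first_row_cell m) (s, out) (first_row_cost * B + 4)
     (s, out @ enc_items enc_edge
       (map (place_edge 0 c) (unary_templates (first_row P m (top_symbol (s ! input_reg))))))"
proof -
  let ?i = "top_symbol (s ! input_reg)"
  have "runs (print_first_row_cell m) (s, out) (first_row_cost * B + 2 + 2)
     (s, out @ enc_items enc_edge (map (place_edge 0 c) (unary_templates (first_row P m ?i))))"
    (is "runs _ _ _ ?s'")
    unfolding print_first_row_cell_def
  proof (rule runs_Cond)
    assume "top_symbol (fst (s, out) ! input_reg) = 0"
    then show "runs (print_edges (unary_templates (first_row P m 0))) (s, out)
        (first_row_cost * B + 2) ?s'"
      by (intro runs_weaken[OF runs_print_first_row_edges[OF cell, of 0]]) auto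
  next
    assume nonzero: "top_symbol (fst (s, out) ! input_reg) \<noteq> 0"
    show "runs (Cond input_reg (\<lambda>s. s = 1) (print_edges (unary_templates (first_row P m 1)))
        (print_edges (unary_templates (first_row P m 2)))) (s, out) (first_row_cost * B + 2) ?s'"
    proof (rule runs_Cond)
      assume "top_symbol (fst (s, out) ! input_reg) = 1"
      then show "runs (print_edges (unary_templates (first_row P m 1))) (s, out)
          (first_row_cost * B) ?s'"
        using runs_print_first_row_edges[OF cell, of 1] by simp
    next
      assume "top_symbol (fst (s, out) ! input_reg) \<noteq> 1"
      then have "?i = 2"
        using nonzero top_symbol_less[of "s ! input_reg"] unfolding fst_conv by linarith
      then show "runs (print_edges (unary_templates (first_row P m 2))) (s, out)
          (first_row_cost * B) ?s'"
        using runs_print_first_row_edges[OF cell, of 2] by simp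
    qed
  qed
  then show ?thesis by (rule runs_weaken) auto
qed

definition first_row_code :: "nat \<Rightarrow> bool list \<Rightarrow> nat \<Rightarrow> bool list" where
  "first_row_code N x c =
     enc_items enc_edge (map (place_edge 0 c)
       (unary_templates (first_row P (c = N) (input_symbol N x c))))"

definition print_left_half :: com where
  "print_left_half =
     loop rows_reg (print_edges (unary_templates (first_row P False 0)) ;; Push col_reg True ;;
       Push buffer_reg True) ;;
     move_to buffer_reg rows_reg"

definition print_right_half :: com where
  "print_right_half =
     loop rows_reg (print_first_row_cell False ;; Pop input_reg ;; Push col_reg True ;;
       Push buffer_reg True) ;;
     move_to buffer_reg rows_reg"

definition print_first_row :: com where
  "print_first_row =
     print_left_half ;; print_first_row_cell True ;; Pop input_reg ;; Push col_reg True ;;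
     print_right_half ;; clear col_reg"

definition half_row_time :: "nat \<Rightarrow> nat" where
  "half_row_time N = N * (first_row_cost * (2 * N + 1) + 12) + 1 + (5 * N + 1)"

definition first_row_time :: "nat \<Rightarrow> nat" where
  "first_row_time N =
     half_row_time N +
       (first_row_cost * (2 * N + 1) + 4 +
         (1 + (2 + (half_row_time N + (3 * (2 * N + 1) + 1)))))"

lemma runs_print_left_half:
  "runs print_left_half (ready x N, out) (half_row_time N)
     ([x, unary N, [], unary (2 * N), unary N, [], [], []],
      out @ concat (map (first_row_code N x) [0..<N]))"
proof -
  let ?ss = "\<lambda>i. [x, [], [], unary (2 * N), unary i, [], unary i, []]"
    and ?os = "\<lambda>i. out @ concat (map (first_row_code N x) [0..<i])"
    and ?body =
      "print_edges (unary_templates (first_row P False 0)) ;;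
       Push col_reg True ;; Push buffer_reg True"
  have cells: "runs (loop rows_reg ?body) (ready x N, ?os 0)
      (N * (first_row_cost * (2 * N + 1) + 4 + 3) + 1)
      ((?ss N)[rows_reg := []], ?os N)"
  proof (rule runs_loop[where ss = ?ss and os = ?os])
    fix i assume i: "i < N"
    then have code: "first_row_code N x i =
        enc_items enc_edge (map (place_edge 0 i) (unary_templates (first_row P False 0)))"
      by (simp add: first_row_code_def contents_def)
    show "runs ?body ((?ss i)[rows_reg := unary (N - Suc i)], ?os i)
        (first_row_cost * (2 * N + 1) + 4)
        ((?ss (Suc i))[rows_reg := unary (N - Suc i)], ?os (Suc i))"
      by (rule runs_weaken[OF runs_Seq[OF runs_print_first_row_edges[of i _ "2 * N + 1"]
              runs_Seq[OF runs_Push runs_Push]]])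
        (use i in \<open>auto simp: code at_cell_def\<close>)
  qed auto
  show ?thesis
    unfolding print_left_half_def
    by (rule runs_weaken[OF runs_Seq[OF runs_start[OF _ cells] runs_move_to[of _ _ N _ 0]]])
      (auto simp: half_row_time_def)
qed

lemma runs_print_right_half:
  assumes "length x \<le> N"
  shows "runs print_right_half ([tl x, unary N, [], unary (2 * N), unary (Suc N), [], [], []], out)
      (half_row_time N)
     ([[], unary N, [], unary (2 * N), unary (Suc (2 * N)), [], [], []],
      out @ concat (map (first_row_code N x) [Suc N..<Suc (2 * N)]))"
proof -
  let ?ss = "\<lambda>i. [drop (Suc i) x, [], [], unary (2 * N), unary (Suc N + i), [], unary i, []]"
    and ?os = "\<lambda>i. out @ concat (map (\<lambda>i. first_row_code N x (Suc N + i)) [0..<i])"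
    and ?body =
      "print_first_row_cell False ;; Pop input_reg ;;
       Push col_reg True ;; Push buffer_reg True"
  have cells: "runs (loop rows_reg ?body)
      ([tl x, unary N, [], unary (2 * N), unary (Suc N), [], [], []], ?os 0)
      (N * (first_row_cost * (2 * N + 1) + 9 + 3) + 1) ((?ss N)[rows_reg := []], ?os N)"
  proof (rule runs_loop[where ss = ?ss and os = ?os])
    fix i assume i: "i < N"
    have code: "first_row_code N x (Suc N + i) = enc_items enc_edge (map (place_edge 0 (Suc N + i))
        (unary_templates (first_row P False (top_symbol (drop (Suc i) x)))))"
      unfolding top_symbol_drop first_row_code_def by (simp add: algebra_simps)
    show "runs ?body ((?ss i)[rows_reg := unary (N - Suc i)], ?os i)
        (first_row_cost * (2 * N + 1) + 9)
        ((?ss (Suc i))[rows_reg := unary (N - Suc i)], ?os (Suc i))"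
      by (rule runs_weaken[OF runs_Seq[OF runs_print_first_row_cell[of "Suc N + i" _ "2 * N + 1"]
              runs_Seq[OF runs_Pop runs_Seq[OF runs_Push runs_Push]]]])
        (use i code in \<open>auto simp: drop_Suc tl_drop at_cell_def\<close>)
  qed (auto simp: drop_Suc)
  have shift: "[Suc N..<Suc (2 * N)] = map (\<lambda>i. i + Suc N) [0..<N]"
    unfolding map_add_upt by (simp add: mult_2 del: upt_Suc)
  have "map (\<lambda>i. first_row_code N x (Suc N + i)) [0..<N] =
      map (first_row_code N x) [Suc N..<Suc (2 * N)]"
    unfolding shift map_map o_def by (simp add: add.commute)
  moreover have "drop (Suc N) x = []" using assms by simp
  ultimately show ?thesis
    unfolding print_right_half_def
    by (intro runs_weaken[OF runs_Seq[OF runs_start[OF _ cells] runs_move_to[of _ _ N _ 0]]])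
      (auto simp: half_row_time_def mult_2)
qed

lemma enc_first_row_edges:
  "enc_items enc_edge (first_row_edges N x) =
     concat (map (first_row_code N x) [0..<N]) @ first_row_code N x N @
     concat (map (first_row_code N x) [Suc N..<Suc (2 * N)])"
proof -
  have "[0..<Suc (2 * N)] = [0..<N] @ N # [Suc N..<Suc (2 * N)]"
    using upt_add_eq_append[of 0 N "Suc N"] upt_conv_Cons[of N "N + Suc N"] by (simp add: mult_2)
  then show ?thesis
    unfolding first_row_edges_def enc_items_concat map_map o_def first_row_code_def[symmetric]
    by (simp del: upt_Suc)
qed

lemma runs_print_first_row:
  assumes "length x \<le> N"
  shows "runs print_first_row (ready x N, out) (first_row_time N)
     (ready [] N, out @ enc_items enc_edge (first_row_edges N x))"
proof -
  let ?left = "out @ concat (map (first_row_code N x) [0..<N])"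
  have "runs print_left_half (ready x N, out) (half_row_time N)
      ([x, unary N, [], unary (2 * N), unary N, [], [], []], ?left)"
    by (rule runs_print_left_half)
  also have "runs (print_first_row_cell True) \<dots> (first_row_cost * (2 * N + 1) + 4)
      ([x, unary N, [], unary (2 * N), unary N, [], [], []], ?left @ first_row_code N x N)"
    by (rule runs_weaken[OF runs_print_first_row_cell[of N _ "2 * N + 1"]])
      (use top_symbol_drop[of 0 x] in \<open>simp_all add: at_cell_def first_row_code_def\<close>)
  also have "runs (Pop input_reg) \<dots> 1
      ([tl x, unary N, [], unary (2 * N), unary N, [], [], []], ?left @ first_row_code N x N)"
    by (rule runs_weaken[OF runs_Pop]) simp_all
  also have "runs (Push col_reg True) \<dots> 2
      ([tl x, unary N, [], unary (2 * N), unary (Suc N), [], [], []], ?left @ first_row_code N x N)"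
    by (rule runs_weaken[OF runs_Push]) simp_all
  also have "runs print_right_half \<dots> (half_row_time N)
      ([[], unary N, [], unary (2 * N), unary (Suc (2 * N)), [], [], []],
       out @ enc_items enc_edge (first_row_edges N x))"
    by (rule runs_weaken[OF runs_print_right_half[OF assms]])
      (simp_all add: enc_first_row_edges del: upt_Suc)
  also have "runs (clear col_reg) \<dots> (3 * (2 * N + 1) + 1)
      (ready [] N, out @ enc_items enc_edge (first_row_edges N x))"
    by (rule runs_weaken[OF runs_clear[of _ _ "Suc (2 * N)"]]) simp_all
  finally show ?thesis
    unfolding print_first_row_def runs_Seq_assoc
    by (rule runs_weaken) (simp_all add: first_row_time_def)
qed


subsection \<open>Printing the instance\<close>

definition print_final_cell :: com where
  "print_final_cell =
     loop rows_reg (Push row_reg True ;; Push col_reg True) ;;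
     print_edges (unary_templates (accepting P)) ;;
     clear col_reg ;; move_to row_reg rows_reg"

definition final_cell_time :: "nat \<Rightarrow> nat" where
  "final_cell_time N =
     N * (4 + 3) + 1 + (edges_cost (unary_templates (accepting P)) * (3 * N + 1) +
       (3 * N + 1 + (5 * N + 1)))"

lemma runs_print_final_cell:
  "runs print_final_cell (ready x N, out) (final_cell_time N)
     (ready x N, out @ enc_items enc_edge (map (place_edge N N) (unary_templates (accepting P))))"
proof -
  let ?ss = "\<lambda>i. [x, [], unary i, unary (2 * N), unary i, [], [], []]"
  have go_to_cell: "runs (loop rows_reg (Push row_reg True ;; Push col_reg True))
      (ready x N, (\<lambda>_. out) 0)
      (N * (4 + 3) + 1) ((?ss N)[rows_reg := []], out)"
  proof (rule runs_loop[where ss = ?ss])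
    fix i assume "i < N"
    show "runs (Push row_reg True ;; Push col_reg True)
        ((?ss i)[rows_reg := unary (N - Suc i)], out) 4
        ((?ss (Suc i))[rows_reg := unary (N - Suc i)], out)"
      by (rule runs_weaken[OF runs_Seq[OF runs_Push runs_Push]]) auto
  qed auto
  let ?out' = "out @ enc_items enc_edge (map (place_edge N N) (unary_templates (accepting P)))"
  have "runs (loop rows_reg (Push row_reg True ;; Push col_reg True)) (ready x N, out) (7 * N + 1)
      ([x, [], unary N, unary (2 * N), unary N, [], [], []], out)"
    using go_to_cell by (simp add: mult.commute)
  also have "runs (print_edges (unary_templates (accepting P))) \<dots>
      (edges_cost (unary_templates (accepting P)) * (3 * N + 1))
      ([x, [], unary N, unary (2 * N), unary N, [], [], []], ?out')"
    by (rule runs_print_edges) simp_all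
  also have "runs (clear col_reg) \<dots> (3 * N + 1)
      ([x, [], unary N, unary (2 * N), [], [], [], []], ?out')"
    by (rule runs_weaken[OF runs_clear[of _ _ N]]) simp_all
  also have "runs (move_to row_reg rows_reg) \<dots> (5 * N + 1) (ready x N, ?out')"
    by (rule runs_weaken[OF runs_move_to[of _ _ N _ 0]]) simp_all
  finally show ?thesis
    unfolding print_final_cell_def runs_Seq_assoc
    by (rule runs_weaken) (simp_all add: final_cell_time_def)
qed

definition print_conflicts :: com where
  "print_conflicts =
     grid_loop (print_edges incompatible_templates) ;; print_first_row ;; print_final_cell"

definition print_class :: "nat \<Rightarrow> com" where
  "print_class i =
     Out True ;; cell_loop (print_edges (cell_templates i)) ;;
     outs (if i = 0 then enc_items enc_edge star_edges else []) ;;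
     (if i = 2 then print_conflicts else Skip) ;; Out False"

definition class_time :: "nat \<Rightarrow> nat \<Rightarrow> nat" where
  "class_time N i =
     1 + (cell_time N (edges_cost (cell_templates i) * (3 * N + 1)) +
       (length (enc_items enc_edge star_edges) +
         (grid_time N (2 * N) (edges_cost incompatible_templates * (3 * N + 1)) +
           (first_row_time N + final_cell_time N) + 1)))"

lemma enc_items_Nil: "enc_items e [] = []"
  by (simp add: enc_items_def)

lemma runs_print_conflicts:
  assumes "length x \<le> N"
  shows "runs print_conflicts (ready x N, out)
     (grid_time N (2 * N) (edges_cost incompatible_templates * (3 * N + 1)) + first_row_time N +
      final_cell_time N)
     (ready [] N, out @ enc_items enc_edge
        (grid_list N (2 * N) (\<lambda>t c. map (place_edge t c) incompatible_templates) @
         first_row_edges N x @ map (place_edge N N) (unary_templates (accepting P))))"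
proof -
  note runs_grid_loop_edges
  also note runs_print_first_row[OF assms]
  also note runs_print_final_cell
  finally show ?thesis
    unfolding print_conflicts_def runs_Seq_assoc
    by (rule runs_weaken) (simp_all add: enc_items_append)
qed

lemma runs_print_class_prefix:
  "runs ((Out True ;; cell_loop (print_edges (cell_templates i))) ;;
       outs (if i = 0 then enc_items enc_edge star_edges else [])) (ready x N, out)
     (1 + cell_time N (edges_cost (cell_templates i) * (3 * N + 1)) +
      length (enc_items enc_edge star_edges))
     (ready x N, out @ True # enc_items enc_edge
        (grid_list (Suc N) (Suc (2 * N)) (\<lambda>t c. map (place_edge t c) (cell_templates i)) @
         (if i = 0 then star_edges else [])))"
  by (rule runs_weaken[OF runs_Seq[OF runs_Seq[OF runs_Out runs_cell_loop_edges] runs_outs]])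
    (simp_all add: enc_items_append enc_items_Nil)

lemma runs_print_class_other:
  assumes "i \<noteq> 2"
  shows "runs (print_class i) (ready y N, out) (class_time N i)
     (ready y N, out @ True # enc_list enc_edge (class_list N x i))"
proof -
  note runs_print_class_prefix[of i y N out]
  also note runs_Skip
  also note runs_Out[of False]
  finally show ?thesis
    unfolding print_class_def runs_Seq_assoc if_not_P[OF assms]
    by (rule runs_weaken) (use assms in \<open>simp_all add: enc_list_eq class_list_def class_time_def\<close>)
qed

lemma runs_print_class_2:
  assumes "length x \<le> N"
  shows "runs (print_class 2) (ready x N, out) (class_time N 2)
     (ready [] N, out @ True # enc_list enc_edge (class_list N x 2))"
proof -
  note runs_print_class_prefix[of 2 x N out]
  also note runs_print_conflicts[OF assms]
  also note runs_Out[of False]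
  finally show ?thesis
    unfolding print_class_def runs_Seq_assoc if_P[OF refl]
    by (rule runs_weaken) (simp_all add: enc_list_eq class_list_def class_time_def enc_items_append)
qed

lemma runs_print_classes:
  assumes "2 \<notin> set is"
  shows "runs (seqs (map print_class is)) (ready y N, out) (sum_list (map (class_time N) is))
     (ready y N, out @ enc_items (enc_list enc_edge) (map (class_list N x) is))"
proof -
  have "runs (seqs (map print_class is)) (ready y N, out) (sum_list (map (class_time N) is))
      (ready y N, out @ concat (map (\<lambda>i. True # enc_list enc_edge (class_list N x i)) is))"
    by (rule runs_seqs, rule runs_print_class_other) (use assms in auto)
  then show ?thesis by (simp add: enc_items_def o_def)
qed

definition print_budget :: com where
  "print_budget = cell_loop (add_tally (A * csp.half + A - 1)) ;; print_tally"

definition budget_time :: "nat \<Rightarrow> nat" where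
  "budget_time N =
     cell_time N ((A * csp.half + A - 1) * (10 * csp.budget N + 7)) + (7 * csp.budget N + 2)"

lemma budget_eq_grid_size: "csp.budget N = Suc N * Suc (2 * N) * (A * csp.half + A - 1)"
  by (simp only: csp.budget_def card_cartesian_product card_atMost)

lemma runs_print_budget:
  "runs print_budget (ready x N, out) (budget_time N) (ready x N, out @ enc_nat (csp.budget N))"
proof -
  let ?q = "A * csp.half + A - 1"
  let ?g = "\<lambda>k. binary (k * ?q)"
  have "runs (cell_loop (add_tally ?q)) ([x, unary N, [], unary (2 * N), [], [], [], ?g 0], out)
     (cell_time N (?q * (10 * csp.budget N + 7)))
     ([x, unary N, [], unary (2 * N), [], [], [], ?g (Suc N * Suc (2 * N))],
      out @ grid_list (Suc N) (Suc (2 * N)) (\<lambda>t c. []))"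
  proof (rule runs_cell_loop)
    fix t c a b out assume tc: "t \<le> N" "c \<le> 2 * N"
    let ?k = "t * Suc (2 * N) + c"
    have "Suc ?k \<le> Suc t * Suc (2 * N)" using tc(2) by simp
    also have "\<dots> \<le> Suc N * Suc (2 * N)" using tc(1) by (intro mult_right_mono) auto
    finally have "?k * ?q + ?q \<le> csp.budget N"
      unfolding budget_eq_grid_size using mult_le_mono1[of "Suc ?k" _ ?q] by (simp add: add.commute)
    then show "runs (add_tally ?q) ([x, unary a, unary t, unary b, unary c, [], [], ?g ?k], out)
        (?q * (10 * csp.budget N + 7))
        ([x, unary a, unary t, unary b, unary c, [], [], ?g (Suc ?k)], out @ [])"
      by (intro runs_weaken[OF runs_add_tally] mult_left_mono) (auto simp: add.commute)
  qed
  moreover have "?g 0 = []" "Suc N * Suc (2 * N) * ?q = csp.budget N"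
    unfolding budget_eq_grid_size by (simp_all add: binary.simps)
  ultimately have tally:
    "runs (cell_loop (add_tally ?q)) (ready x N, out) (cell_time N (?q * (10 * csp.budget N + 7)))
      ([x, unary N, [], unary (2 * N), [], [], [], binary (csp.budget N)], out)"
    by (simp only: grid_list_Nil append_Nil2)
  show ?thesis
    unfolding print_budget_def budget_time_def by (rule runs_Seq[OF tally runs_print_tally])
qed

definition print_instance :: "nat \<Rightarrow> com" where
  "print_instance e =
     prepare e ;;
     cell_loop (print_vertices vertex_templates) ;;
     outs (enc_items enc_nat star_vertices @ [False]) ;;
     seqs (map print_class [0..<2]) ;; print_class 2 ;; seqs (map print_class [3..<l - 1]) ;;
     Out False ;; print_budget"

definition instance_time :: "nat \<Rightarrow> nat \<Rightarrow> nat \<Rightarrow> nat" where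
  "instance_time e n N =
     prepare_time e n N + (cell_time N (vertices_cost vertex_templates * (3 * N + 1)) +
       (length (enc_items enc_nat star_vertices) + 1 +
         (sum_list (map (class_time N) [0..<2]) + (class_time N 2 +
           (sum_list (map (class_time N) [3..<l - 1]) + (1 + budget_time N))))))"

lemma enc_instance:
  "enc_inst (instance_of N x) =
     enc_items enc_nat (grid_list (Suc N) (Suc (2 * N)) (\<lambda>t c. map (place t c) vertex_templates)) @
     (enc_items enc_nat star_vertices @ [False]) @
     enc_items (enc_list enc_edge) (map (class_list N x) [0..<2]) @
     (True # enc_list enc_edge (class_list N x 2)) @
     enc_items (enc_list enc_edge) (map (class_list N x) [3..<l - 1]) @ [False] @
     enc_nat (csp.budget N)"
proof -
  have "l - 1 = 2 + (l - 3)" using l by simp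
  then have "[0..<l - 1] = [0..<2] @ [2..<l - 1]" by (simp only: upt_add_eq_append[of 0 2] le0)
  moreover have "[2..<l - 1] = 2 # [3..<l - 1]"
    using l upt_conv_Cons[of 2 "l - 1"] by simp
  ultimately have "map (class_list N x) [0..<l - 1] =
      map (class_list N x) [0..<2] @ [class_list N x 2] @ map (class_list N x) [3..<l - 1]"
    by (simp del: upt_Suc)
  then show ?thesis
    unfolding enc_inst_def instance_of_def prod.case vertex_list_def enc_list_eq[of enc_nat]
      enc_list_eq[of "enc_list enc_edge"]
    by (simp only: enc_items_append append_assoc) (simp add: enc_items_def)
qed

lemma runs_print_instance:
  assumes "e \<ge> 1" "N = (length x + e) ^ e"
  shows "runs (print_instance e) (x # replicate 7 [], []) (instance_time e (length x) N)
     (ready [] N, enc_inst (instance_of N x))"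
proof -
  have "length x + e \<le> N"
    using assms power_increasing[of 1 e "length x + e"] by simp
  then have length_x: "length x \<le> N" by simp
  have "2 \<notin> set [0..<2]" "2 \<notin> set [3..<l - 1]" by simp_all
  note runs_other_classes = this[THEN runs_print_classes]
  have "runs (prepare e) (x # replicate 7 [], []) (prepare_time e (length x) N) (ready x N, [])"
    using runs_prepare[OF assms] by (simp add: eval_nat_numeral)
  also note runs_cell_loop_vertices
  also note runs_outs
  also note runs_other_classes(1)[where x = x]
  also note runs_print_class_2[OF length_x]
  also note runs_other_classes(2)[where x = x]
  also note runs_Out
  also note runs_print_budget
  finally show ?thesis
    unfolding print_instance_def runs_Seq_assoc
    by (rule runs_weaken) (simp_all add: enc_instance instance_time_def)
qed

end


subsection \<open>Polynomial time\<close>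

definition poly_bounded :: "(nat \<Rightarrow> nat) \<Rightarrow> bool" where
  "poly_bounded f \<longleftrightarrow> (\<exists>p. \<forall>n. f n \<le> poly p n)"

lemma poly_bounded_const: "poly_bounded (\<lambda>n. c)"
  unfolding poly_bounded_def by (intro exI[of _ "[:c:]"]) simp

lemma poly_bounded_id: "poly_bounded (\<lambda>n. n)"
  unfolding poly_bounded_def by (intro exI[of _ "[:0, 1:]"]) simp

lemma poly_bounded_add: "poly_bounded f \<Longrightarrow> poly_bounded g \<Longrightarrow> poly_bounded (\<lambda>n. f n + g n)"
  unfolding poly_bounded_def by (metis add_mono poly_add)

lemma poly_bounded_mult: "poly_bounded f \<Longrightarrow> poly_bounded g \<Longrightarrow> poly_bounded (\<lambda>n. f n * g n)"
  unfolding poly_bounded_def by (metis mult_le_mono poly_mult)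

lemma poly_bounded_Suc: "poly_bounded f \<Longrightarrow> poly_bounded (\<lambda>n. Suc (f n))"
  using poly_bounded_add[OF poly_bounded_const[of 1]] by simp

lemma poly_bounded_power: "poly_bounded f \<Longrightarrow> poly_bounded (\<lambda>n. f n ^ k)"
  by (induction k) (auto intro: poly_bounded_const poly_bounded_mult)

lemma poly_bounded_sum_list:
  "(\<And>i. poly_bounded (\<lambda>n. f n i)) \<Longrightarrow> poly_bounded (\<lambda>n. sum_list (map (f n) is))"
  by (induction "is") (auto intro: poly_bounded_const poly_bounded_add)

lemmas poly_bounded_intros = poly_bounded_const poly_bounded_id poly_bounded_add poly_bounded_mult
  poly_bounded_Suc poly_bounded_power poly_bounded_sum_list

context grid_reduction
begin

lemma poly_bounded_instance_time: "poly_bounded (\<lambda>n. instance_time e n ((n + e) ^ e))"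
  unfolding instance_time_def prepare_time_def cell_time_def grid_time_def class_time_def
    first_row_time_def half_row_time_def final_cell_time_def budget_time_def budget_eq_grid_size
  by (intro poly_bounded_intros)

lemma uses_below_print_instance: "uses_below 8 (print_instance e)"
  by (simp add: print_instance_def uses_below_prepare cell_loop_def grid_loop_def print_class_def
      print_first_row_def print_left_half_def print_right_half_def print_first_row_cell_def
      print_final_cell_def print_conflicts_def print_budget_def)

theorem polytime_instance:
  assumes "e \<ge> 1"
  shows "polytime (\<lambda>x. enc_inst (instance_of ((length x + e) ^ e) x))"
proof -
  obtain p where p: "\<And>n. instance_time e n ((n + e) ^ e) \<le> poly p n"
    using poly_bounded_instance_time unfolding poly_bounded_def by blast
  show ?thesis
  proof (rule polytime_if_runs)
    show "uses_below (Suc 7) (print_instance e)" using uses_below_print_instance by simp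
    show "\<exists>t s'. t \<le> poly p (length x) \<and> runs (print_instance e) (x # replicate 7 [], []) t
        (s', enc_inst (instance_of ((length x + e) ^ e) x))" for x
      using runs_print_instance[OF assms refl] p by blast
  qed
qed

end

theorem NP_hard_colored_path_deletion:
  assumes l: "l \<ge> 4" and \<Delta>: "\<Delta> \<ge> 4"
  shows "NP_hard enc_inst {I \<in> path_deletion_instances (l - 1). max_degree (inst_graph I) = \<Delta>}
     (colored_path_deletion (l - 1) l)"
  unfolding NP_hard_def
proof
  fix L assume "L \<in> NP"
  then obtain P :: "nat grid_problem" and A e where P: "A \<ge> 1" "cell_values P = {..<A}"
    and e: "e \<ge> 1"
    and L: "\<And>x. x \<in> L \<longleftrightarrow> grid_solvable P ((length x + e) ^ e) x"
    by (rule NP_as_grid_problem) blast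
  interpret grid_reduction P A l \<Delta> by unfold_locales (use P l \<Delta> in auto)
  show "\<exists>g. polytime (\<lambda>x. enc_inst (g x)) \<and>
      (\<forall>x. g x \<in> {I \<in> path_deletion_instances (l - 1). max_degree (inst_graph I) = \<Delta>} \<and>
        (x \<in> L \<longleftrightarrow> g x \<in> colored_path_deletion (l - 1) l))"
    using polytime_instance[OF e] instance_in_domain instance_yes_iff L
    by (intro exI[of _ "\<lambda>x. instance_of ((length x + e) ^ e) x"]) simp
qed

theorem theorem7:
  fixes l :: nat
  assumes "l \<ge> 4"
  shows "NP_hard enc_inst
           {I \<in> path_deletion_instances (l - 1). max_degree (inst_graph I) = 16}
           (colored_path_deletion (l - 1) l)"
  by (rule NP_hard_colored_path_deletion[OF assms]) simp

end
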